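(* Fix a $\gamma$-saturated normal uniform ideal $J$ on a cardinal $\kappa$ with $\gamma<\kappa$, and $m,n\in\omega$. Let $\langle P_\alpha,\dot Q_\beta:\alpha\le\kappa,\beta<\kappa\rangle$ be a finite support iteration such that for each $\beta<\kappa$, $\Vdash_{P_\beta}$ "$\dot Q_\beta$ is $\sigma$-centered". Then $P=P_\kappa$ is $J^n$-$m$-linked.
   Context: A poset is $\sigma$-centered if it is a countable union of centered subsets (sets any finitely many of whose elements have a common lower bound). All ideals are proper ($\kappa\notin J$) and uniform ($[\kappa]^{<\kappa}\subseteq J$); $J^*$ is the dual filter, $J^+$ the positive sets; normality is in the usual sense. $J$ is $\gamma$-saturated if for every $\langle X_i:i<\gamma\rangle\subseteq J^+$ there are $i<j<\gamma$ with $X_i\cap X_j\in J^+$. For $n\ge1$, $[\kappa]^n$ is the set of strictly increasing $n$-tuples from $\kappa$, identified with $n$-element subsets. Fubini powers: $J^0=\{\emptyset\}$ on $[\kappa]^0=\{\emptyset\}$, $J^1=J$, and for $n\ge2$, $X\subseteq[\kappa]^n$ is in $J^n$ iff $\{\alpha:\{\bar\beta\in[\kappa]^{n-1}:(\alpha,\bar\beta)\in X\}\in J^{n-1}\}\in J^*$; $(J^n)^+$ denotes the $J^n$-positive sets. For $a,b\in[\kappa]^n$, $a\simeq b$ means the order-preserving bijection from $a$ onto $b$ is the identity on $a\cap b$. A poset $P$ is $J^n$-$m$-linked if for every $X\in(J^n)^+$ and every $\langle p_a\in P:a\in X\rangle$ there is $Y\subseteq X$ with $Y\in(J^n)^+$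 such that whenever $k\le m$ and $a_0,\dots,a_{k-1}\in Y$ are pairwise $\simeq$, the conditions $p_{a_0},\dots,p_{a_{k-1}}$ have a common lower bound in $P$. *)

theory Defs
  imports Main "HOL-Library.Equipollence"
begin

section \<open>Ideals on a cardinal and their Fubini powers\<close>

text \<open>The cardinal \<open>\<kappa>\<close> is the universe of a type \<open>'k\<close> of class \<open>wellorder\<close>, so the elements of \<open>'k\<close>
  are the ordinals below \<open>\<kappa>\<close>. That the order type is a cardinal is the following condition.\<close>

definition is_cardinal :: "'k::wellorder itself \<Rightarrow> bool" where
  "is_cardinal _ \<longleftrightarrow> (\<forall>\<alpha>::'k. {..<\<alpha>} \<prec> (UNIV :: 'k set))"

definition uniform_ideal :: "'k set set \<Rightarrow> bool" where
  "uniform_ideal J \<longleftrightarrow>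
     (\<forall>A\<in>J. \<forall>B\<subseteq>A. B \<in> J) \<and> (\<forall>A\<in>J. \<forall>B\<in>J. A \<union> B \<in> J) \<and>
     UNIV \<notin> J \<and> (\<forall>A. A \<prec> (UNIV :: 'k set) \<longrightarrow> A \<in> J)"

definition normal_ideal :: "'k::wellorder set set \<Rightarrow> bool" where
  "normal_ideal J \<longleftrightarrow>
     (\<forall>X f. X \<notin> J \<and> (\<forall>\<alpha>\<in>X. f \<alpha> < \<alpha>) \<longrightarrow> (\<exists>Y\<subseteq>X. Y \<notin> J \<and> (\<exists>\<xi>. \<forall>\<alpha>\<in>Y. f \<alpha> = \<xi>)))"

definition saturated_ideal :: "'k::wellorder \<Rightarrow> 'k set set \<Rightarrow> bool" where
  "saturated_ideal \<gamma> J \<longleftrightarrow>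
     (\<forall>X :: 'k \<Rightarrow> 'k set. (\<forall>i<\<gamma>. X i \<notin> J) \<longrightarrow> (\<exists>j<\<gamma>. \<exists>i<j. X i \<inter> X j \<notin> J))"

definition dual_filter :: "'k set set \<Rightarrow> 'k set set" where
  "dual_filter J = {A. - A \<in> J}"

definition tuples :: "nat \<Rightarrow> 'k::wellorder list set" where
  "tuples n = {a. length a = n \<and> sorted_wrt (<) a}"

fun fubini_power :: "'k::wellorder set set \<Rightarrow> nat \<Rightarrow> 'k list set set" where
  "fubini_power J 0 = {{}}"
| "fubini_power J (Suc 0) = {(\<lambda>\<alpha>. [\<alpha>]) ` A | A. A \<in> J}"
| "fubini_power J (Suc (Suc n)) =
     {X. X \<subseteq> tuples (Suc (Suc n)) \<and>
         {\<alpha>. {b \<in> tuples (Suc n). \<alpha> # b \<in> X} \<in> fubini_power J (Suc n)} \<in> dual_filter J}"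

definition fubini_positive :: "'k::wellorder set set \<Rightarrow> nat \<Rightarrow> 'k list set set" where
  "fubini_positive J n = {X. X \<subseteq> tuples n \<and> X \<notin> fubini_power J n}"

definition similar :: "'k::wellorder list \<Rightarrow> 'k list \<Rightarrow> bool"  (infix \<open>\<simeq>\<close> 50) where
  "a \<simeq> b \<longleftrightarrow> (\<exists>h. bij_betw h (set a) (set b) \<and> strict_mono_on (set a) h \<and>
                   (\<forall>x \<in> set a \<inter> set b. h x = x))"


section \<open>Forcing notions and linkedness\<close>

text \<open>As usual in forcing, a poset is a preordered set; \<open>(q, p) \<in> leq P\<close> means that \<open>q\<close> is
  stronger than \<open>p\<close>.\<close>

record 'c poset =
  conds :: "'c set"
  leq :: "'c rel"

definition linked :: "'k::wellorder set set \<Rightarrow> nat \<Rightarrow> nat \<Rightarrow> 'c poset \<Rightarrow> bool" where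
  "linked J n m P \<longleftrightarrow>
     (\<forall>X \<in> fubini_positive J n. \<forall>p. (\<forall>a\<in>X. p a \<in> conds P) \<longrightarrow>
        (\<exists>Y\<subseteq>X. Y \<in> fubini_positive J n \<and>
           (\<forall>k\<le>m. \<forall>a :: nat \<Rightarrow> 'k list.
              (\<forall>i<k. a i \<in> Y) \<and> (\<forall>i<k. \<forall>j<k. a i \<simeq> a j) \<longrightarrow>
              (\<exists>r \<in> conds P. \<forall>i<k. (r, p (a i)) \<in> leq P))))"


section \<open>Names and the forcing relation\<close>

text \<open>A name is a set of pairs (condition, name). HOL has no type of all names; the pairs of a name
  are indexed by a type \<open>'i\<close>, which bounds the hereditary size of names and is otherwise arbitrary.\<close>

datatype ('c, 'i) name = Name "'i \<rightharpoonup> 'c \<times> ('c, 'i) name"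

primrec pairs :: "('c, 'i) name \<Rightarrow> ('c \<times> ('c, 'i) name) set" where
  "pairs (Name f) = ran f"

inductive is_name :: "'c set \<Rightarrow> ('c, 'i) name \<Rightarrow> bool" for C where
  "(\<And>p y. (p, y) \<in> pairs x \<Longrightarrow> p \<in> C) \<Longrightarrow> (\<And>p y. (p, y) \<in> pairs x \<Longrightarrow> is_name C y) \<Longrightarrow> is_name C x"

text \<open>The forcing language: formulas of set theory with constants (names) from \<open>'n\<close>.\<close>

datatype 'n fm =
    FMem 'n 'n  (infix \<open>\<^bold>\<in>\<close> 50)
  | FEq 'n 'n  (infix \<open>\<^bold>=\<close> 50)
  | FNeg "'n fm"  (\<open>\<^bold>\<not> _\<close> [40] 40)
  | FConj "'n fm" "'n fm"  (infixr \<open>\<^bold>\<and>\<close> 35)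
  | FAll "'n \<Rightarrow> 'n fm"  (binder \<open>\<^bold>\<forall>\<close> 10)

definition FDisj  (infixr \<open>\<^bold>\<or>\<close> 30) where
  "(\<phi> \<^bold>\<or> \<psi>) = (\<^bold>\<not> (\<^bold>\<not> \<phi> \<^bold>\<and> \<^bold>\<not> \<psi>))"

definition FImp  (infixr \<open>\<^bold>\<longrightarrow>\<close> 25) where
  "(\<phi> \<^bold>\<longrightarrow> \<psi>) = (\<^bold>\<not> (\<phi> \<^bold>\<and> \<^bold>\<not> \<psi>))"

definition FIff  (infixr \<open>\<^bold>\<longleftrightarrow>\<close> 25) where
  "(\<phi> \<^bold>\<longleftrightarrow> \<psi>) = ((\<phi> \<^bold>\<longrightarrow> \<psi>) \<^bold>\<and> (\<psi> \<^bold>\<longrightarrow> \<phi>))"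

definition FEx  (binder \<open>\<^bold>\<exists>\<close> 10) where
  "FEx \<phi> = (\<^bold>\<not> (\<^bold>\<forall>x. \<^bold>\<not> \<phi> x))"

text \<open>The usual recursion for forcing an equality, with density conditions spelled out.\<close>

function forces_eq :: "'c rel \<Rightarrow> ('c, 'i) name \<Rightarrow> ('c, 'i) name \<Rightarrow> 'c \<Rightarrow> bool" where
  "forces_eq le x y p \<longleftrightarrow>
     (\<forall>u\<in>pairs x. \<forall>q. (q, p) \<in> le \<and> (q, fst u) \<in> le \<longrightarrow>
        (\<exists>r. (r, q) \<in> le \<and> (\<exists>v\<in>pairs y. (r, fst v) \<in> le \<and> forces_eq le (snd u) (snd v) r))) \<and>
     (\<forall>v\<in>pairs y. \<forall>q. (q, p) \<in> le \<and> (q, fst v) \<in> le \<longrightarrow>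
        (\<exists>r. (r, q) \<in> le \<and> (\<exists>u\<in>pairs x. (r, fst u) \<in> le \<and> forces_eq le (snd u) (snd v) r)))"
  by pat_completeness auto
termination
proof -
  have "wf {(y :: ('c, 'i) name, x). \<exists>p. (p, y) \<in> pairs x}"
  proof (rule wfUNIVI)
    fix R :: "('c, 'i) name \<Rightarrow> bool" and x
    assume *: "\<forall>x. (\<forall>y. (y, x) \<in> {(y, x). \<exists>p. (p, y) \<in> pairs x} \<longrightarrow> R y) \<longrightarrow> R x"
    show "R x"
    proof (induction x)
      case (Name f)
      have "R y" if "(p, y) \<in> ran f" for p y
      proof -
        from that obtain i where "f i = Some (p, y)" by (auto simp: ran_def)
        then show ?thesis
          using Name[of "f i" "(p, y)" y] rangeI[of f i] by auto
      qed
      then show ?case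
        using *[rule_format, of "Name f"] by auto
    qed
  qed
  then show ?thesis
    by (relation "inv_image {(y :: ('c, 'i) name, x). \<exists>p. (p, y) \<in> pairs x}
                    (\<lambda>(le :: 'c rel, x, y, p). x)") (auto intro: wf_inv_image)
qed

declare forces_eq.simps [simp del]

primrec forces :: "'c poset \<Rightarrow> 'c \<Rightarrow> ('c, 'i) name fm \<Rightarrow> bool" where
  "forces P p (x \<^bold>\<in> y) \<longleftrightarrow>
     (\<forall>q. (q, p) \<in> leq P \<longrightarrow>
        (\<exists>r. (r, q) \<in> leq P \<and> (\<exists>v\<in>pairs y. (r, fst v) \<in> leq P \<and> forces_eq (leq P) x (snd v) r)))"
| "forces P p (x \<^bold>= y) \<longleftrightarrow> forces_eq (leq P) x y p"
| "forces P p (\<^bold>\<not> \<phi>) \<longleftrightarrow> (\<forall>q. (q, p) \<in> leq P \<longrightarrow> \<not> forces P q \<phi>)"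
| "forces P p (\<phi> \<^bold>\<and> \<psi>) \<longleftrightarrow> forces P p \<phi> \<and> forces P p \<psi>"
| "forces P p (FAll \<phi>) \<longleftrightarrow> (\<forall>x. is_name (conds P) x \<longrightarrow> forces P p (\<phi> x))"

definition forced :: "'c poset \<Rightarrow> ('c, 'i) name fm \<Rightarrow> bool" where
  "forced P \<phi> \<longleftrightarrow> (\<forall>p \<in> conds P. forces P p \<phi>)"


section \<open>Formulas of set theory\<close>

definition subset_fm :: "'n \<Rightarrow> 'n \<Rightarrow> 'n fm"  (infix \<open>\<^bold>\<subseteq>\<close> 50) where
  "(x \<^bold>\<subseteq> y) = (\<^bold>\<forall>z. z \<^bold>\<in> x \<^bold>\<longrightarrow> z \<^bold>\<in> y)"

definition upair_fm :: "'n \<Rightarrow> 'n \<Rightarrow> 'n \<Rightarrow> 'n fm" where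
  "upair_fm z x y = (\<^bold>\<forall>u. u \<^bold>\<in> z \<^bold>\<longleftrightarrow> (u \<^bold>= x \<^bold>\<or> u \<^bold>= y))"

text \<open>\<open>z = {{x}, {x, y}}\<close>\<close>

definition opair_fm :: "'n \<Rightarrow> 'n \<Rightarrow> 'n \<Rightarrow> 'n fm" where
  "opair_fm z x y = (\<^bold>\<exists>u v. upair_fm u x x \<^bold>\<and> upair_fm v x y \<^bold>\<and> upair_fm z u v)"

definition related_fm :: "'n \<Rightarrow> 'n \<Rightarrow> 'n \<Rightarrow> 'n fm" where
  "related_fm r x y = (\<^bold>\<exists>z. opair_fm z x y \<^bold>\<and> z \<^bold>\<in> r)"

definition inductive_fm :: "'n \<Rightarrow> 'n fm" where
  "inductive_fm w =
     ((\<^bold>\<forall>x. (\<^bold>\<forall>z. \<^bold>\<not> z \<^bold>\<in> x) \<^bold>\<longrightarrow> x \<^bold>\<in> w) \<^bold>\<and>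
      (\<^bold>\<forall>x. x \<^bold>\<in> w \<^bold>\<longrightarrow> (\<^bold>\<forall>y. (\<^bold>\<forall>z. z \<^bold>\<in> y \<^bold>\<longleftrightarrow> (z \<^bold>\<in> x \<^bold>\<or> z \<^bold>= x)) \<^bold>\<longrightarrow> y \<^bold>\<in> w)))"

definition omega_fm :: "'n \<Rightarrow> 'n fm" where
  "omega_fm w = (inductive_fm w \<^bold>\<and> (\<^bold>\<forall>v. inductive_fm v \<^bold>\<longrightarrow> w \<^bold>\<subseteq> v))"

text \<open>\<open>f\<close> is a function from \<open>A\<close> onto \<open>B\<close>.\<close>

definition onto_fm :: "'n \<Rightarrow> 'n \<Rightarrow> 'n \<Rightarrow> 'n fm" where
  "onto_fm f A B =
     ((\<^bold>\<forall>z. z \<^bold>\<in> f \<^bold>\<longrightarrow> (\<^bold>\<exists>x y. x \<^bold>\<in> A \<^bold>\<and> y \<^bold>\<in> B \<^bold>\<and> opair_fm z x y)) \<^bold>\<and>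
      (\<^bold>\<forall>x. x \<^bold>\<in> A \<^bold>\<longrightarrow> (\<^bold>\<exists>y. related_fm f x y)) \<^bold>\<and>
      (\<^bold>\<forall>x y z. related_fm f x y \<^bold>\<and> related_fm f x z \<^bold>\<longrightarrow> y \<^bold>= z) \<^bold>\<and>
      (\<^bold>\<forall>y. y \<^bold>\<in> B \<^bold>\<longrightarrow> (\<^bold>\<exists>x. related_fm f x y)))"

definition finite_fm :: "'n \<Rightarrow> 'n fm" where
  "finite_fm F = (\<^bold>\<exists>w k f. omega_fm w \<^bold>\<and> k \<^bold>\<in> w \<^bold>\<and> onto_fm f k F)"

text \<open>Countable and nonempty. Nonemptiness is harmless for countable unions, since the empty set can be
  added to a family of centered subsets of a (nonempty) poset.\<close>

definition countable_fm :: "'n \<Rightarrow> 'n fm" where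
  "countable_fm S = (\<^bold>\<exists>w f. omega_fm w \<^bold>\<and> onto_fm f w S)"

definition preorder_fm :: "'n \<Rightarrow> 'n \<Rightarrow> 'n fm" where
  "preorder_fm Q L =
     ((\<^bold>\<forall>x. x \<^bold>\<in> Q \<^bold>\<longrightarrow> related_fm L x x) \<^bold>\<and>
      (\<^bold>\<forall>x y z. x \<^bold>\<in> Q \<^bold>\<and> y \<^bold>\<in> Q \<^bold>\<and> z \<^bold>\<in> Q \<^bold>\<and> related_fm L x y \<^bold>\<and> related_fm L y z
          \<^bold>\<longrightarrow> related_fm L x z))"

definition centered_fm :: "'n \<Rightarrow> 'n \<Rightarrow> 'n \<Rightarrow> 'n fm" where
  "centered_fm Q L C =
     (\<^bold>\<forall>F. F \<^bold>\<subseteq> C \<^bold>\<and> finite_fm F \<^bold>\<longrightarrow> (\<^bold>\<exists>r. r \<^bold>\<in> Q \<^bold>\<and> (\<^bold>\<forall>x. x \<^bold>\<in> F \<^bold>\<longrightarrow> related_fm L r x)))"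

definition sigma_centered_fm :: "'n \<Rightarrow> 'n \<Rightarrow> 'n fm" where
  "sigma_centered_fm Q L =
     (\<^bold>\<exists>S. countable_fm S \<^bold>\<and>
          (\<^bold>\<forall>C. C \<^bold>\<in> S \<^bold>\<longrightarrow> C \<^bold>\<subseteq> Q \<^bold>\<and> centered_fm Q L C) \<^bold>\<and>
          (\<^bold>\<forall>x. x \<^bold>\<in> Q \<^bold>\<longrightarrow> (\<^bold>\<exists>C. C \<^bold>\<in> S \<^bold>\<and> x \<^bold>\<in> C)))"


section \<open>Finite support iterations\<close>

text \<open>Conditions of an iteration are finite partial functions \<open>p\<close> sending \<open>\<beta>\<close> in the support of \<open>p\<close>
  to a \<open>P\<^sub>\<beta>\<close>-name \<open>p(\<beta>)\<close>; coordinates outside the support stand for the trivial condition, so the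
  iterands need no designated largest element. Names have at least \<open>\<kappa>\<close> indices (type \<open>'k + 'i\<close>),
  and hence at least as many as any \<open>P\<^sub>\<beta>\<close> has conditions, so that the quantifiers of the forcing
  language see all names relevant to \<open>\<sigma>\<close>-centeredness.\<close>

datatype ('k, 'i) cond = Cond (coords: "'k \<rightharpoonup> (('k, 'i) cond, 'k + 'i) name")

type_synonym ('k, 'i) iname = "(('k, 'i) cond, 'k + 'i) name"

definition restr :: "('k::wellorder, 'i) cond \<Rightarrow> 'k \<Rightarrow> ('k, 'i) cond" where
  "restr p \<beta> = Cond (coords p |` {..<\<beta>})"

definition stage_conds ::
  "('k::wellorder \<Rightarrow> ('k, 'i) cond poset) \<Rightarrow> ('k \<Rightarrow> ('k, 'i) iname) \<Rightarrow> 'k set \<Rightarrow> ('k, 'i) cond set" where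
  "stage_conds P Q A =
     {p. finite (dom (coords p)) \<and> dom (coords p) \<subseteq> A \<and>
         (\<forall>\<beta> \<sigma>. coords p \<beta> = Some \<sigma> \<longrightarrow>
            \<sigma> \<in> snd ` pairs (Q \<beta>) \<and> forces (P \<beta>) (restr p \<beta>) (\<sigma> \<^bold>\<in> Q \<beta>))}"

definition stage ::
  "('k::wellorder \<Rightarrow> ('k, 'i) cond poset) \<Rightarrow> ('k \<Rightarrow> ('k, 'i) iname) \<Rightarrow> ('k \<Rightarrow> ('k, 'i) iname) \<Rightarrow>
   'k set \<Rightarrow> ('k, 'i) cond poset" where
  "stage P Q L A =
     \<lparr>conds = stage_conds P Q A,
      leq = {(p, q). p \<in> stage_conds P Q A \<and> q \<in> stage_conds P Q A \<and>
               dom (coords q) \<subseteq> dom (coords p) \<and>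
               (\<forall>\<beta> \<sigma> \<tau>. coords p \<beta> = Some \<sigma> \<and> coords q \<beta> = Some \<tau> \<longrightarrow>
                  forces (P \<beta>) (restr p \<beta>) (related_fm (L \<beta>) \<sigma> \<tau>))}\<rparr>"

text \<open>\<open>P \<alpha>\<close> is the stage \<open>\<alpha> < \<kappa>\<close> and \<open>P\<kappa>\<close> the final stage; the \<open>\<beta>\<close>-th iterand is given by the name
  \<open>Q \<beta>\<close> of its underlying set and the name \<open>L \<beta>\<close> of its order.\<close>

definition fs_iteration ::
  "('k::wellorder \<Rightarrow> ('k, 'i) cond poset) \<Rightarrow> ('k, 'i) cond poset \<Rightarrow>
   ('k \<Rightarrow> ('k, 'i) iname) \<Rightarrow> ('k \<Rightarrow> ('k, 'i) iname) \<Rightarrow> bool" where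
  "fs_iteration P P\<kappa> Q L \<longleftrightarrow>
     (\<forall>\<alpha>. P \<alpha> = stage P Q L {..<\<alpha>}) \<and> P\<kappa> = stage P Q L UNIV \<and>
     (\<forall>\<beta>. is_name (conds (P \<beta>)) (Q \<beta>) \<and> is_name (conds (P \<beta>)) (L \<beta>) \<and>
          forced (P \<beta>) (preorder_fm (Q \<beta>) (L \<beta>)))"

end

theory Submission
  imports Defs "HOL-Library.Countable_Set"
begin

text \<open>Every condition can be extended so that, at each coordinate of its support, it decides the index
  of a centered piece containing the entry there; finitely many such conditions have a common lower
  bound as soon as their indices agree wherever two of them are defined. This reduces the theorem to
  finite partial functions \<open>f\<^sub>a\<close> from \<open>\<kappa>\<close> to \<open>\<omega>\<close>, where \<open>a\<close> ranges over a \<open>J\<^sup>n\<close>-positive set: on a smaller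
  positive set, \<open>a \<simeq> b\<close> has to imply that \<open>f\<^sub>a\<close> and \<open>f\<^sub>b\<close> are compatible.

  If \<open>\<kappa> \<le> 2\<^sup>\<gamma>\<close>, this follows from \<open>\<kappa>\<close>-completeness alone. Otherwise saturation splits \<open>\<kappa>\<close> into \<open>2\<^sup>\<gamma> < \<kappa>\<close>
  sets that are null or on which \<open>J\<close> is prime, and one argues by induction on \<open>n\<close>, splitting off the last
  element \<open>\<beta>\<close> of a tuple \<open>c\<beta>\<close>. By normality the part of \<open>f\<^sub>c\<^sub>\<beta>\<close> below \<open>\<beta>\<close> is independent of \<open>\<beta>\<close>. The induction
  hypothesis applies to these parts, and also to the classes of \<open>\<beta> \<mapsto> f\<^sub>c\<^sub>\<beta>\<close> in the ultrapower, which takes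
  care of tuples with the same last element. For different last elements \<open>\<beta>\<close> and \<open>\<beta>'\<close>, what \<open>f\<^sub>c\<^sub>\<beta>\<close> does
  above \<open>\<beta>\<close> is irrelevant, because the tuples consist of closure points of the supports.\<close>

section \<open>The forcing relation\<close>

text \<open>Labels are natural numbers because a word of finitely many values from a countable set
  is something a \<kappa>-complete ideal can make constant. \<open>J\<close> need not be prime,
  while ultrapowers need an ultrafilter. If 2^\<gamma> < \<kappa>, completeness makes one prime
  piece positive and the induction step works inside it. If \<kappa> \<le> 2^\<gamma>, ordinals are
  named by subsets of \<gamma> instead, and all pairs of tuples come to agree, similar or not.

  The part of \<open>f (c @ [\<beta>])\<close> below \<beta> and its ultrapower class depend on
  \<open>c\<close> alone, so the induction hypothesis has to hold for arbitrary families. Neither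
  controls a common domain point \<xi> \<ge> \<beta> of tuples with different last elements. For
  this the induction carries a set \<open>D\<close> in the dual filter that contains all elements of
  the tuples: between a member of \<open>D\<close> and a larger domain point of \<open>f a\<close>
  there is an element of \<open>a\<close>. Used for both tuples, this puts \<beta> into the other
  tuple, and similarity equates the last elements. For equal last elements \<beta>, each pair
  \<open>c\<close>, \<open>c'\<close> causes trouble only on a null set of \<beta>; there are
  \<kappa> many pairs, and normality disposes of them together.\<close>

lemma pairs_wf: "wf {(y :: ('c, 'j) name, x). \<exists>p. (p, y) \<in> pairs x}"
proof (rule wfUNIVI)
  fix R :: "('c, 'j) name \<Rightarrow> bool" and x
  assume *: "\<forall>x. (\<forall>y. (y, x) \<in> {(y, x). \<exists>p. (p, y) \<in> pairs x} \<longrightarrow> R y) \<longrightarrow> R x"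
  show "R x"
  proof (induction x)
    case (Name f)
    have "R y" if "(p, y) \<in> ran f" for p y
    proof -
      from that obtain i where "f i = Some (p, y)" by (auto simp: ran_def)
      then show ?thesis
        using Name[of "f i" "(p, y)" y] rangeI[of f i] by auto
    qed
    then show ?case
      using *[rule_format, of "Name f"] by auto
  qed
qed

lemma name_pairs_induct: "(\<And>x. (\<And>p y. (p, y) \<in> pairs x \<Longrightarrow> R y) \<Longrightarrow> R x) \<Longrightarrow> R (x :: ('c, 'j) name)"
  using wf_induct_rule[OF pairs_wf, of R x] by blast

text \<open>A name is an indexed map, so a set of pairs has to be realized as its range. Which map
  is chosen does not matter, because \<open>pairs\<close> sees only the range; one exists if
  \<open>A\<close> is countable and the index type infinite.\<close>

definition hat :: "'c \<Rightarrow> ('c, 'j) name set \<Rightarrow> ('c, 'j) name" where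
  "hat one A = Name (SOME f. ran f = Pair one ` A)"

lemma pairs_hat:
  assumes "infinite (UNIV :: 'j set)" "countable A"
  shows "pairs (hat one A :: ('c, 'j) name) = Pair one ` A"
proof -
  obtain e :: "nat \<Rightarrow> 'j" where e: "inj e"
    using assms(1) infinite_countable_subset by blast
  have "\<exists>f :: 'j \<rightharpoonup> 'c \<times> ('c, 'j) name. ran f = Pair one ` A"
  proof (cases "A = {}")
    case True
    then show ?thesis by (intro exI[of _ Map.empty]) auto
  next
    case False
    define f where "f = (\<lambda>j. if j \<in> range e then Some (one, from_nat_into A (inv e j)) else None)"
    have "ran f = Pair one ` range (from_nat_into A)"
    proof (intro equalityI subsetI)
      fix z assume "z \<in> ran f"
      then show "z \<in> Pair one ` range (from_nat_into A)" by (auto simp: ran_def f_def split: if_splits)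
    next
      fix z assume "z \<in> Pair one ` range (from_nat_into A)"
      then obtain i where "z = (one, from_nat_into A i)" by auto
      then have "f (e i) = Some z" using e by (simp add: f_def)
      then show "z \<in> ran f" by (rule ranI)
    qed
    then show ?thesis using False assms(2) by auto
  qed
  then show ?thesis unfolding hat_def by (metis (mono_tags, lifting) pairs.simps someI_ex)
qed

text \<open>These are the canonical names of the von Neumann numerals.\<close>

function numeral_name :: "'c \<Rightarrow> nat \<Rightarrow> ('c, 'j) name" where
  "numeral_name one n = hat one (numeral_name one ` {..<n})"
  by auto
termination by (relation "measure snd") auto

declare numeral_name.simps [simp del]

text \<open>All that the iteration uses of \<sigma>-centeredness: \<open>lab p \<sigma> n\<close>
  stands for "\<open>p\<close> decides that \<sigma> lies in piece \<open>n\<close>". The condition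
  \<open>0 < k\<close> is there because only a label ties \<open>p\<close> to the poset. The lower
  bound is a literal member of \<open>pairs Q\<close>, as the entries of conditions have to
  be.\<close>

definition labelling ::
  "'c poset \<Rightarrow> ('c, 'j) name \<Rightarrow> ('c, 'j) name \<Rightarrow> ('c \<Rightarrow> ('c, 'j) name \<Rightarrow> nat \<Rightarrow> bool) \<Rightarrow> bool" where
  "labelling P Q L lab \<longleftrightarrow>
     (\<forall>p q \<sigma> n. lab p \<sigma> n \<longrightarrow> (q, p) \<in> leq P \<longrightarrow> lab q \<sigma> n) \<and>
     (\<forall>p \<sigma>. p \<in> conds P \<longrightarrow> is_name (conds P) \<sigma> \<longrightarrow> forces P p (\<sigma> \<^bold>\<in> Q) \<longrightarrow> (\<exists>q n. (q, p) \<in> leq P \<and> lab q \<sigma> n)) \<and>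
     (\<forall>p k \<sigma> n. 0 < (k::nat) \<longrightarrow> (\<forall>i<k. is_name (conds P) (\<sigma> i) \<and> lab p (\<sigma> i) n) \<longrightarrow>
        (\<exists>q \<tau>. (q, p) \<in> leq P \<and> \<tau> \<in> snd ` pairs Q \<and> forces P q (\<tau> \<^bold>\<in> Q) \<and>
           (\<forall>i<k. forces P q (related_fm L \<tau> (\<sigma> i)))))"

text \<open>The parameter \<open>ty\<close> fixes the index type of names, which \<open>P\<close>
  and \<open>one\<close> do not mention; its infinity makes room for names with countably many
  members.\<close>

locale forcing_notion =
  fixes P :: "'c poset" and one :: 'c and ty :: "'j itself"
  assumes leq_conds: "(q, p) \<in> leq P \<Longrightarrow> q \<in> conds P \<and> p \<in> conds P"
    and leq_refl: "p \<in> conds P \<Longrightarrow> (p, p) \<in> leq P"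
    and leq_trans: "(p, q) \<in> leq P \<Longrightarrow> (q, r) \<in> leq P \<Longrightarrow> (p, r) \<in> leq P"
    and one: "one \<in> conds P"
    and leq_one: "p \<in> conds P \<Longrightarrow> (p, one) \<in> leq P"
    and infinite_index: "infinite (UNIV :: 'j set)"
begin

abbreviation below (infix \<open>\<sqsubseteq>\<close> 50) where "q \<sqsubseteq> p \<equiv> (q, p) \<in> leq P"

abbreviation frc :: "'c \<Rightarrow> ('c, 'j) name fm \<Rightarrow> bool" (infix \<open>\<tturnstile>\<close> 50) where
  "p \<tturnstile> \<phi> \<equiv> forces P p \<phi>"

abbreviation nm :: "('c, 'j) name \<Rightarrow> bool" where "nm \<equiv> is_name (conds P)"

lemma below_refl: "q \<sqsubseteq> p \<Longrightarrow> q \<sqsubseteq> q" "q \<sqsubseteq> p \<Longrightarrow> p \<sqsubseteq> p"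
  using leq_conds leq_refl by blast+

section \<open>Monotonicity, stability and derived rules of the forcing relation\<close>

lemma forces_eqD1:
  assumes "forces_eq (leq P) x y p" "u \<in> pairs x" "q \<sqsubseteq> p" "q \<sqsubseteq> fst u"
  obtains r v where "r \<sqsubseteq> q" "v \<in> pairs y" "r \<sqsubseteq> fst v" "forces_eq (leq P) (snd u) (snd v) r"
  using assms(1)[unfolded forces_eq.simps[of "leq P" x y p], THEN conjunct1, rule_format, OF assms(2) conjI[OF assms(3,4)]]
  by blast

lemma forces_eqD2:
  assumes "forces_eq (leq P) x y p" "v \<in> pairs y" "q \<sqsubseteq> p" "q \<sqsubseteq> fst v"
  obtains r u where "r \<sqsubseteq> q" "u \<in> pairs x" "r \<sqsubseteq> fst u" "forces_eq (leq P) (snd u) (snd v) r"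
  using assms(1)[unfolded forces_eq.simps[of "leq P" x y p], THEN conjunct2, rule_format, OF assms(2) conjI[OF assms(3,4)]]
  by blast

lemma forces_eqI:
  assumes "\<And>u q. u \<in> pairs x \<Longrightarrow> q \<sqsubseteq> p \<Longrightarrow> q \<sqsubseteq> fst u \<Longrightarrow>
      \<exists>r v. r \<sqsubseteq> q \<and> v \<in> pairs y \<and> r \<sqsubseteq> fst v \<and> forces_eq (leq P) (snd u) (snd v) r"
    and "\<And>v q. v \<in> pairs y \<Longrightarrow> q \<sqsubseteq> p \<Longrightarrow> q \<sqsubseteq> fst v \<Longrightarrow>
      \<exists>r u. r \<sqsubseteq> q \<and> u \<in> pairs x \<and> r \<sqsubseteq> fst u \<and> forces_eq (leq P) (snd u) (snd v) r"
  shows "forces_eq (leq P) x y p"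
  by (subst forces_eq.simps) (use assms in \<open>simp add: Bex_def\<close>)

lemma forces_eq_mono:
  assumes "forces_eq (leq P) x y p" "q \<sqsubseteq> p"
  shows "forces_eq (leq P) x y q"
proof (rule forces_eqI)
  fix u r assume *: "u \<in> pairs x" "r \<sqsubseteq> q" "r \<sqsubseteq> fst u"
  show "\<exists>s v. s \<sqsubseteq> r \<and> v \<in> pairs y \<and> s \<sqsubseteq> fst v \<and> forces_eq (leq P) (snd u) (snd v) s"
    using forces_eqD1[OF assms(1) *(1) leq_trans[OF *(2) assms(2)] *(3)] by blast
next
  fix u r assume *: "u \<in> pairs y" "r \<sqsubseteq> q" "r \<sqsubseteq> fst u"
  show "\<exists>s v. s \<sqsubseteq> r \<and> v \<in> pairs x \<and> s \<sqsubseteq> fst v \<and> forces_eq (leq P) (snd v) (snd u) s"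
    using forces_eqD2[OF assms(1) *(1) leq_trans[OF *(2) assms(2)] *(3)] by blast
qed

lemma forces_eq_stable:
  assumes "\<And>q. q \<sqsubseteq> p \<Longrightarrow> \<exists>r. r \<sqsubseteq> q \<and> forces_eq (leq P) x y r"
  shows "forces_eq (leq P) x y p"
proof (rule forces_eqI)
  fix u q assume u: "u \<in> pairs x" and q: "q \<sqsubseteq> p" "q \<sqsubseteq> fst u"
  then obtain r where r: "r \<sqsubseteq> q" "forces_eq (leq P) x y r" using assms by blast
  obtain s v where "s \<sqsubseteq> r" "v \<in> pairs y" "s \<sqsubseteq> fst v" "forces_eq (leq P) (snd u) (snd v) s"
    using forces_eqD1[OF r(2) u below_refl(1)[OF r(1)] leq_trans[OF r(1) q(2)]] .
  then show "\<exists>r v. r \<sqsubseteq> q \<and> v \<in> pairs y \<and> r \<sqsubseteq> fst v \<and> forces_eq (leq P) (snd u) (snd v) r"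
    using leq_trans[OF _ r(1)] by blast
next
  fix u q assume u: "u \<in> pairs y" and q: "q \<sqsubseteq> p" "q \<sqsubseteq> fst u"
  then obtain r where r: "r \<sqsubseteq> q" "forces_eq (leq P) x y r" using assms by blast
  obtain s v where "s \<sqsubseteq> r" "v \<in> pairs x" "s \<sqsubseteq> fst v" "forces_eq (leq P) (snd v) (snd u) s"
    using forces_eqD2[OF r(2) u below_refl(1)[OF r(1)] leq_trans[OF r(1) q(2)]] .
  then show "\<exists>r v. r \<sqsubseteq> q \<and> v \<in> pairs x \<and> r \<sqsubseteq> fst v \<and> forces_eq (leq P) (snd v) (snd u) r"
    using leq_trans[OF _ r(1)] by blast
qed

lemma forces_mono: "p \<tturnstile> \<phi> \<Longrightarrow> q \<sqsubseteq> p \<Longrightarrow> q \<tturnstile> \<phi>"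
  by (induction \<phi> arbitrary: p q) (auto intro: leq_trans forces_eq_mono)

text \<open>The clauses of atomic formulas are density statements already, and the connectives
  preserve the property. Every rule below that passes to an extension in order to pick a witness or
  a disjunct rests on this.\<close>

lemma forces_stable: "(\<And>q. q \<sqsubseteq> p \<Longrightarrow> \<exists>r. r \<sqsubseteq> q \<and> r \<tturnstile> \<phi>) \<Longrightarrow> p \<tturnstile> \<phi>"
proof (induction \<phi> arbitrary: p)
  case (FMem x y)
  show ?case
    unfolding forces.simps
  proof (intro allI impI)
    fix q assume "q \<sqsubseteq> p"
    then obtain r where r: "r \<sqsubseteq> q" "r \<tturnstile> (x \<^bold>\<in> y)" using FMem by blast
    then obtain s v where "s \<sqsubseteq> r" "v\<in>pairs y" "s \<sqsubseteq> fst v" "forces_eq (leq P) x (snd v) s"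
      using below_refl(1)[OF r(1)] unfolding forces.simps by blast
    then show "\<exists>r. r \<sqsubseteq> q \<and> (\<exists>v\<in>pairs y. r \<sqsubseteq> fst v \<and> forces_eq (leq P) x (snd v) r)"
      using leq_trans[OF _ r(1)] by blast
  qed
next
  case (FEq x y)
  then show ?case unfolding forces.simps by (rule forces_eq_stable)
next
  case (FNeg \<phi>)
  show ?case
    unfolding forces.simps
  proof (intro allI impI notI)
    fix q assume "q \<sqsubseteq> p" "q \<tturnstile> \<phi>"
    moreover then obtain r where "r \<sqsubseteq> q" "r \<tturnstile> (\<^bold>\<not> \<phi>)" using FNeg.prems by blast
    ultimately show False using forces_mono below_refl unfolding forces.simps by blast
  qed
next
  case (FConj \<phi> \<psi>)
  then show ?case by (metis forces.simps(4))
next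
  case (FAll \<phi>)
  show ?case unfolding forces.simps
  proof (intro allI impI)
    fix x assume x: "nm x"
    show "p \<tturnstile> \<phi> x"
      using FAll.IH[of "\<phi> x" p] FAll.prems x rangeI[of \<phi> x] unfolding forces.simps by blast
  qed
qed

declare forces.simps(1,2) [simp del]

text \<open>Stability turns the classical encoding through negation into the Kripke clause.\<close>

lemma forces_imp: "p \<tturnstile> (\<phi> \<^bold>\<longrightarrow> \<psi>) \<longleftrightarrow> (\<forall>q. q \<sqsubseteq> p \<longrightarrow> q \<tturnstile> \<phi> \<longrightarrow> q \<tturnstile> \<psi>)"
proof
  assume *: "p \<tturnstile> (\<phi> \<^bold>\<longrightarrow> \<psi>)"
  show "\<forall>q. q \<sqsubseteq> p \<longrightarrow> q \<tturnstile> \<phi> \<longrightarrow> q \<tturnstile> \<psi>"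
  proof (intro allI impI)
    fix q assume q: "q \<sqsubseteq> p" "q \<tturnstile> \<phi>"
    show "q \<tturnstile> \<psi>"
    proof (rule forces_stable)
      fix r assume r: "r \<sqsubseteq> q"
      show "\<exists>s. s \<sqsubseteq> r \<and> s \<tturnstile> \<psi>"
        using * forces_mono[OF q(2) r] leq_trans[OF r q(1)] unfolding FImp_def forces.simps by blast
    qed
  qed
qed (auto simp: FImp_def dest: below_refl)

lemma forces_disj: "p \<tturnstile> (\<phi> \<^bold>\<or> \<psi>) \<longleftrightarrow> (\<forall>q. q \<sqsubseteq> p \<longrightarrow> (\<exists>r. r \<sqsubseteq> q \<and> (r \<tturnstile> \<phi> \<or> r \<tturnstile> \<psi>)))"
  unfolding FDisj_def forces.simps by blast

lemma forces_ex: "p \<tturnstile> FEx \<phi> \<longleftrightarrow> (\<forall>q. q \<sqsubseteq> p \<longrightarrow> (\<exists>r x. r \<sqsubseteq> q \<and> nm x \<and> r \<tturnstile> \<phi> x))"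
  unfolding FEx_def forces.simps by blast

lemma forces_iff: "p \<tturnstile> (\<phi> \<^bold>\<longleftrightarrow> \<psi>) \<longleftrightarrow> (\<forall>q. q \<sqsubseteq> p \<longrightarrow> (q \<tturnstile> \<phi> \<longleftrightarrow> q \<tturnstile> \<psi>))"
  unfolding FIff_def forces.simps forces_imp by blast

lemma forces_disjI1: "p \<tturnstile> \<phi> \<Longrightarrow> p \<tturnstile> (\<phi> \<^bold>\<or> \<psi>)"
  and forces_disjI2: "p \<tturnstile> \<psi> \<Longrightarrow> p \<tturnstile> (\<phi> \<^bold>\<or> \<psi>)"
  unfolding forces_disj using forces_mono below_refl by blast+

lemma forces_exI: "p \<tturnstile> \<phi> x \<Longrightarrow> nm x \<Longrightarrow> p \<tturnstile> FEx \<phi>"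
  unfolding forces_ex using forces_mono below_refl by blast

text \<open>Since the goal is itself a forced formula, it is enough to reach it densely below
  \<open>p\<close>, where one of the disjuncts has been decided.\<close>

lemma forces_disjE:
  assumes "p \<tturnstile> (\<phi> \<^bold>\<or> \<psi>)" "\<And>q. q \<sqsubseteq> p \<Longrightarrow> q \<tturnstile> \<phi> \<Longrightarrow> q \<tturnstile> \<chi>" "\<And>q. q \<sqsubseteq> p \<Longrightarrow> q \<tturnstile> \<psi> \<Longrightarrow> q \<tturnstile> \<chi>"
  shows "p \<tturnstile> \<chi>"
proof (rule forces_stable)
  fix q assume q: "q \<sqsubseteq> p"
  show "\<exists>r. r \<sqsubseteq> q \<and> r \<tturnstile> \<chi>"
    using assms(1)[unfolded forces_disj, rule_format, OF q] assms(2-) leq_trans[OF _ q] by blast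
qed

lemma forces_exE:
  assumes "p \<tturnstile> FEx \<phi>" "\<And>q x. q \<sqsubseteq> p \<Longrightarrow> nm x \<Longrightarrow> q \<tturnstile> \<phi> x \<Longrightarrow> q \<tturnstile> \<chi>"
  shows "p \<tturnstile> \<chi>"
proof (rule forces_stable)
  fix q assume q: "q \<sqsubseteq> p"
  show "\<exists>r. r \<sqsubseteq> q \<and> r \<tturnstile> \<chi>"
    using assms(1)[unfolded forces_ex, rule_format, OF q] assms(2-) leq_trans[OF _ q] by blast
qed

text \<open>For goals outside the forcing language, where stability cannot absorb the passage to an
  extension.\<close>

lemma forces_exE_dense:
  assumes "p \<tturnstile> FEx \<phi>" "q \<sqsubseteq> p"
  obtains r x where "r \<sqsubseteq> q" "nm x" "r \<tturnstile> \<phi> x"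
  using assms unfolding forces_ex by blast

lemma forces_allD: "p \<tturnstile> FAll \<phi> \<Longrightarrow> nm x \<Longrightarrow> p \<tturnstile> \<phi> x"
  by simp

lemma forces_mp: "p \<tturnstile> (\<phi> \<^bold>\<longrightarrow> \<psi>) \<Longrightarrow> p \<tturnstile> \<phi> \<Longrightarrow> p \<in> conds P \<Longrightarrow> p \<tturnstile> \<psi>"
  using forces_imp leq_refl by blast

subsection \<open>Equality and membership\<close>

lemma forces_eq_refl: "forces_eq (leq P) x x p"
proof (induction x arbitrary: p rule: name_pairs_induct)
  case (1 x)
  then have "forces_eq (leq P) (snd u) (snd u) q" if "u \<in> pairs x" for u q
    using that by (metis prod.collapse)
  then show ?case
    by (intro forces_eqI) (blast dest: below_refl(1))+
qed

lemma forces_eq_sym: "forces_eq (leq P) x y p \<Longrightarrow> forces_eq (leq P) y x p"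
proof (induction x arbitrary: y p rule: name_pairs_induct)
  case (1 x)
  from 1(1)[of "fst u" "snd u" for u] have IH:
    "\<And>u y p. u \<in> pairs x \<Longrightarrow> forces_eq (leq P) (snd u) y p \<Longrightarrow> forces_eq (leq P) y (snd u) p" by simp
  show ?case
  proof (rule forces_eqI)
    fix u q assume *: "u \<in> pairs y" "q \<sqsubseteq> p" "q \<sqsubseteq> fst u"
    obtain r v where "r \<sqsubseteq> q" "v \<in> pairs x" "r \<sqsubseteq> fst v" "forces_eq (leq P) (snd v) (snd u) r"
      using forces_eqD2[OF 1(2) *] .
    then show "\<exists>r v. r \<sqsubseteq> q \<and> v \<in> pairs x \<and> r \<sqsubseteq> fst v \<and> forces_eq (leq P) (snd u) (snd v) r"
      using IH by blast
  next
    fix u q assume *: "u \<in> pairs x" "q \<sqsubseteq> p" "q \<sqsubseteq> fst u"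
    obtain r v where "r \<sqsubseteq> q" "v \<in> pairs y" "r \<sqsubseteq> fst v" "forces_eq (leq P) (snd u) (snd v) r"
      using forces_eqD1[OF 1(2) *] .
    then show "\<exists>r v. r \<sqsubseteq> q \<and> v \<in> pairs y \<and> r \<sqsubseteq> fst v \<and> forces_eq (leq P) (snd v) (snd u) r"
      using IH *(1) by blast
  qed
qed

lemma forces_eq_trans:
  "forces_eq (leq P) x y p \<Longrightarrow> forces_eq (leq P) y z p \<Longrightarrow> forces_eq (leq P) x z p"
proof (induction x arbitrary: y z p rule: name_pairs_induct)
  case (1 x)
  from 1(1)[of "fst u" "snd u" for u] have IH: "\<And>u y z p. u \<in> pairs x \<Longrightarrow>
      forces_eq (leq P) (snd u) y p \<Longrightarrow> forces_eq (leq P) y z p \<Longrightarrow> forces_eq (leq P) (snd u) z p" by simp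
  show ?case
  proof (rule forces_eqI)
    fix u q assume u: "u \<in> pairs x" and q: "q \<sqsubseteq> p" "q \<sqsubseteq> fst u"
    obtain r v where r: "r \<sqsubseteq> q" "v \<in> pairs y" "r \<sqsubseteq> fst v" "forces_eq (leq P) (snd u) (snd v) r"
      using forces_eqD1[OF 1(2) u q] .
    obtain s w where s: "s \<sqsubseteq> r" "w \<in> pairs z" "s \<sqsubseteq> fst w" "forces_eq (leq P) (snd v) (snd w) s"
      using forces_eqD1[OF 1(3) r(2) leq_trans[OF r(1) q(1)] r(3)] .
    have "forces_eq (leq P) (snd u) (snd w) s"
      using IH[OF u forces_eq_mono[OF r(4) s(1)] s(4)] .
    then show "\<exists>r v. r \<sqsubseteq> q \<and> v \<in> pairs z \<and> r \<sqsubseteq> fst v \<and> forces_eq (leq P) (snd u) (snd v) r"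
      using leq_trans[OF s(1) r(1)] s by blast
  next
    fix w q assume w: "w \<in> pairs z" and q: "q \<sqsubseteq> p" "q \<sqsubseteq> fst w"
    obtain r v where r: "r \<sqsubseteq> q" "v \<in> pairs y" "r \<sqsubseteq> fst v" "forces_eq (leq P) (snd v) (snd w) r"
      using forces_eqD2[OF 1(3) w q] .
    obtain s u where s: "s \<sqsubseteq> r" "u \<in> pairs x" "s \<sqsubseteq> fst u" "forces_eq (leq P) (snd u) (snd v) s"
      using forces_eqD2[OF 1(2) r(2) leq_trans[OF r(1) q(1)] r(3)] .
    have "forces_eq (leq P) (snd u) (snd w) s"
      using IH[OF s(2) s(4) forces_eq_mono[OF r(4) s(1)]] .
    then show "\<exists>r u. r \<sqsubseteq> q \<and> u \<in> pairs x \<and> r \<sqsubseteq> fst u \<and> forces_eq (leq P) (snd u) (snd w) r"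
      using leq_trans[OF s(1) r(1)] s by blast
  qed
qed

lemma eq_refl: "p \<tturnstile> (x \<^bold>= x)"
  and eq_sym: "p \<tturnstile> (x \<^bold>= y) \<Longrightarrow> p \<tturnstile> (y \<^bold>= x)"
  and eq_trans: "p \<tturnstile> (x \<^bold>= y) \<Longrightarrow> p \<tturnstile> (y \<^bold>= z) \<Longrightarrow> p \<tturnstile> (x \<^bold>= z)"
  unfolding forces.simps by (fact forces_eq_refl forces_eq_sym forces_eq_trans)+

lemma memI:
  assumes "(c, u) \<in> pairs y" "p \<sqsubseteq> c"
  shows "p \<tturnstile> (u \<^bold>\<in> y)"
  unfolding forces.simps
proof (intro allI impI)
  fix q assume q: "q \<sqsubseteq> p"
  have "q \<sqsubseteq> q" "q \<sqsubseteq> fst (c, u)" "forces_eq (leq P) u (snd (c, u)) q"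
    using below_refl(1)[OF q] leq_trans[OF q assms(2)] forces_eq_refl by auto
  then show "\<exists>r. r \<sqsubseteq> q \<and> (\<exists>v\<in>pairs y. r \<sqsubseteq> fst v \<and> forces_eq (leq P) u (snd v) r)"
    using assms(1) by blast
qed

lemma mem_dense:
  assumes "p \<tturnstile> (x \<^bold>\<in> y)" "q \<sqsubseteq> p"
  obtains r c u where "r \<sqsubseteq> q" "(c, u) \<in> pairs y" "r \<sqsubseteq> c" "r \<tturnstile> (x \<^bold>= u)"
  using assms(1)[unfolded forces.simps, rule_format, OF assms(2)] by (auto simp: forces.simps(2))

lemma memE:
  assumes "p \<tturnstile> (x \<^bold>\<in> y)"
    and "\<And>q c u. q \<sqsubseteq> p \<Longrightarrow> (c, u) \<in> pairs y \<Longrightarrow> q \<sqsubseteq> c \<Longrightarrow> q \<tturnstile> (x \<^bold>= u) \<Longrightarrow> q \<tturnstile> \<chi>"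
  shows "p \<tturnstile> \<chi>"
proof (rule forces_stable)
  fix q assume q: "q \<sqsubseteq> p"
  obtain r c u where "r \<sqsubseteq> q" "(c, u) \<in> pairs y" "r \<sqsubseteq> c" "r \<tturnstile> (x \<^bold>= u)"
    using mem_dense[OF assms(1) q] .
  then show "\<exists>r. r \<sqsubseteq> q \<and> r \<tturnstile> \<chi>" using assms(2) leq_trans[OF _ q] by blast
qed

lemma mem_eqL:
  assumes "p \<tturnstile> (x \<^bold>\<in> y)" "p \<tturnstile> (x \<^bold>= x')"
  shows "p \<tturnstile> (x' \<^bold>\<in> y)"
  unfolding forces.simps
proof (intro allI impI)
  fix q assume q: "q \<sqsubseteq> p"
  then obtain r v where r: "r \<sqsubseteq> q" "v \<in> pairs y" "r \<sqsubseteq> fst v" "forces_eq (leq P) x (snd v) r"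
    using assms(1) unfolding forces.simps by blast
  have "forces_eq (leq P) x' x r"
    using assms(2) leq_trans[OF r(1) q] forces_eq_mono forces_eq_sym unfolding forces.simps by blast
  then show "\<exists>r. r \<sqsubseteq> q \<and> (\<exists>v\<in>pairs y. r \<sqsubseteq> fst v \<and> forces_eq (leq P) x' (snd v) r)"
    using r forces_eq_trans by blast
qed

lemma mem_eqR:
  assumes "p \<tturnstile> (x \<^bold>\<in> y)" "p \<tturnstile> (y \<^bold>= y')"
  shows "p \<tturnstile> (x \<^bold>\<in> y')"
proof (rule memE[OF assms(1)])
  fix q c u assume *: "q \<sqsubseteq> p" "(c, u) \<in> pairs y" "q \<sqsubseteq> c" "q \<tturnstile> (x \<^bold>= u)"
  have e: "forces_eq (leq P) y y' q" using forces_mono[OF assms(2) *(1)] unfolding forces.simps .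
  have "q \<tturnstile> (u \<^bold>\<in> y')"
    unfolding forces.simps
  proof (intro allI impI)
    fix r assume r: "r \<sqsubseteq> q"
    obtain s v where "s \<sqsubseteq> r" "v \<in> pairs y'" "s \<sqsubseteq> fst v" "forces_eq (leq P) (snd (c, u)) (snd v) s"
      using forces_eqD1[OF e *(2) r] leq_trans[OF r *(3)] by auto
    then show "\<exists>s. s \<sqsubseteq> r \<and> (\<exists>v\<in>pairs y'. s \<sqsubseteq> fst v \<and> forces_eq (leq P) u (snd v) s)"
      by auto
  qed
  then show "q \<tturnstile> (x \<^bold>\<in> y')" using *(4) eq_sym mem_eqL by blast
qed

lemma nm_snd: "nm x \<Longrightarrow> (c, u) \<in> pairs x \<Longrightarrow> nm u"
  by (metis is_name.cases)

text \<open>Forced equality concerns only the literal members of the two names, and these are among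
  the tested \<open>z\<close> because \<open>x\<close> and \<open>y\<close> are hereditarily
  names.\<close>

lemma extensionality:
  assumes "nm x" "nm y" "\<And>z q. nm z \<Longrightarrow> q \<sqsubseteq> p \<Longrightarrow> q \<tturnstile> (z \<^bold>\<in> x) \<longleftrightarrow> q \<tturnstile> (z \<^bold>\<in> y)"
  shows "p \<tturnstile> (x \<^bold>= y)"
  unfolding forces.simps
proof (rule forces_eqI)
  fix u q assume *: "u \<in> pairs x" "q \<sqsubseteq> p" "q \<sqsubseteq> fst u"
  have "q \<tturnstile> (snd u \<^bold>\<in> x)" using memI * by (metis prod.collapse)
  moreover have "nm (snd u)" using nm_snd assms(1) *(1) by (metis prod.collapse)
  ultimately have "q \<tturnstile> (snd u \<^bold>\<in> y)" using assms(3) *(2) by blast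
  then show "\<exists>r v. r \<sqsubseteq> q \<and> v \<in> pairs y \<and> r \<sqsubseteq> fst v \<and> forces_eq (leq P) (snd u) (snd v) r"
    using below_refl(1)[OF *(2)] unfolding forces.simps by blast
next
  fix u q assume *: "u \<in> pairs y" "q \<sqsubseteq> p" "q \<sqsubseteq> fst u"
  have "q \<tturnstile> (snd u \<^bold>\<in> y)" using memI * by (metis prod.collapse)
  moreover have "nm (snd u)" using nm_snd assms(2) *(1) by (metis prod.collapse)
  ultimately have "q \<tturnstile> (snd u \<^bold>\<in> x)" using assms(3) *(2) by blast
  then show "\<exists>r v. r \<sqsubseteq> q \<and> v \<in> pairs x \<and> r \<sqsubseteq> fst v \<and> forces_eq (leq P) (snd v) (snd u) r"
    using below_refl(1)[OF *(2)] forces_eq_sym unfolding forces.simps by blast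
qed

lemma nm_hat: "countable A \<Longrightarrow> \<forall>y\<in>A. nm y \<Longrightarrow> nm (hat one A)"
  by (rule is_name.intros) (auto simp: pairs_hat[OF infinite_index] one)

lemma hat_memI: "countable A \<Longrightarrow> y \<in> A \<Longrightarrow> p \<in> conds P \<Longrightarrow> p \<tturnstile> (y \<^bold>\<in> hat one A)"
  using pairs_hat[OF infinite_index, of A one] leq_one by (intro memI[of one]) auto

lemma hat_memI_eq:
  "countable A \<Longrightarrow> y \<in> A \<Longrightarrow> p \<in> conds P \<Longrightarrow> p \<tturnstile> (x \<^bold>= y) \<Longrightarrow> p \<tturnstile> (x \<^bold>\<in> hat one A)"
  by (rule mem_eqL[OF hat_memI eq_sym])

lemma hat_memE:
  assumes "p \<tturnstile> (x \<^bold>\<in> hat one A)" "countable A"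
    and "\<And>q y. q \<sqsubseteq> p \<Longrightarrow> y \<in> A \<Longrightarrow> q \<tturnstile> (x \<^bold>= y) \<Longrightarrow> q \<tturnstile> \<chi>"
  shows "p \<tturnstile> \<chi>"
  by (rule memE[OF assms(1)]) (use assms(2,3) pairs_hat[OF infinite_index assms(2)] in auto)

lemma hat_dense:
  assumes "p \<tturnstile> (x \<^bold>\<in> hat one A)" "countable A" "q \<sqsubseteq> p"
  obtains r u where "r \<sqsubseteq> q" "u \<in> A" "r \<tturnstile> (x \<^bold>= u)"
proof -
  from mem_dense[OF assms(1,3)] obtain r c u
    where r: "r \<sqsubseteq> q" "(c, u) \<in> pairs (hat one A)" "r \<tturnstile> (x \<^bold>= u)" .
  from r(2) have "u \<in> A" unfolding pairs_hat[OF infinite_index assms(2)] by blast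
  then show thesis using that r by blast
qed

subsection \<open>Pairs\<close>

lemma forces_upair:
  "p \<tturnstile> upair_fm z x y \<longleftrightarrow>
     (\<forall>u q. nm u \<longrightarrow> q \<sqsubseteq> p \<longrightarrow> (q \<tturnstile> (u \<^bold>\<in> z) \<longleftrightarrow> q \<tturnstile> (u \<^bold>= x \<^bold>\<or> u \<^bold>= y)))"
  unfolding upair_fm_def forces.simps(5) forces_iff by blast

lemma upair_mem_iff:
  "p \<tturnstile> upair_fm z x y \<Longrightarrow> nm u \<Longrightarrow> q \<sqsubseteq> p \<Longrightarrow>
     q \<tturnstile> (u \<^bold>\<in> z) \<longleftrightarrow> q \<tturnstile> (u \<^bold>= x \<^bold>\<or> u \<^bold>= y)"
  by (simp add: forces_upair)

lemma upair_memL: "p \<tturnstile> upair_fm z x y \<Longrightarrow> nm x \<Longrightarrow> p \<in> conds P \<Longrightarrow> p \<tturnstile> (x \<^bold>\<in> z)"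
  and upair_memR: "p \<tturnstile> upair_fm z x y \<Longrightarrow> nm y \<Longrightarrow> p \<in> conds P \<Longrightarrow> p \<tturnstile> (y \<^bold>\<in> z)"
  and upair_memE: "p \<tturnstile> upair_fm z x y \<Longrightarrow> nm u \<Longrightarrow> p \<tturnstile> (u \<^bold>\<in> z) \<Longrightarrow> p \<in> conds P \<Longrightarrow>
         p \<tturnstile> (u \<^bold>= x \<^bold>\<or> u \<^bold>= y)"
  by (simp_all add: upair_mem_iff leq_refl forces_disjI1 forces_disjI2 eq_refl)

lemma disj_eq_cong:
  assumes "q \<tturnstile> (u \<^bold>= a \<^bold>\<or> u \<^bold>= b)" "q \<tturnstile> (a \<^bold>= a')" "q \<tturnstile> (b \<^bold>= b')"
  shows "q \<tturnstile> (u \<^bold>= a' \<^bold>\<or> u \<^bold>= b')"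
proof (rule forces_disjE[OF assms(1)])
  fix r assume "r \<sqsubseteq> q" "r \<tturnstile> (u \<^bold>= a)"
  then show "r \<tturnstile> (u \<^bold>= a' \<^bold>\<or> u \<^bold>= b')"
    using eq_trans[OF _ forces_mono[OF assms(2)]] by (intro forces_disjI1)
next
  fix r assume "r \<sqsubseteq> q" "r \<tturnstile> (u \<^bold>= b)"
  then show "r \<tturnstile> (u \<^bold>= a' \<^bold>\<or> u \<^bold>= b')"
    using eq_trans[OF _ forces_mono[OF assms(3)]] by (intro forces_disjI2)
qed

lemma upair_cong:
  assumes "p \<tturnstile> upair_fm z x y" "p \<tturnstile> (z \<^bold>= z')" "p \<tturnstile> (x \<^bold>= x')" "p \<tturnstile> (y \<^bold>= y')"
  shows "p \<tturnstile> upair_fm z' x' y'"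
  unfolding forces_upair
proof (intro allI impI)
  fix u q assume u: "nm u" and q: "q \<sqsubseteq> p"
  note e = assms(2-4)[THEN forces_mono, OF q]
  have "q \<tturnstile> (u \<^bold>\<in> z') \<longleftrightarrow> q \<tturnstile> (u \<^bold>\<in> z)"
    using mem_eqR[OF _ e(1)] mem_eqR[OF _ eq_sym[OF e(1)]] by blast
  also have "\<dots> \<longleftrightarrow> q \<tturnstile> (u \<^bold>= x \<^bold>\<or> u \<^bold>= y)" using upair_mem_iff[OF assms(1) u q] .
  also have "\<dots> \<longleftrightarrow> q \<tturnstile> (u \<^bold>= x' \<^bold>\<or> u \<^bold>= y')"
    using disj_eq_cong[OF _ e(2,3)] disj_eq_cong[OF _ eq_sym[OF e(2)] eq_sym[OF e(3)]] by blast
  finally show "q \<tturnstile> (u \<^bold>\<in> z') \<longleftrightarrow> q \<tturnstile> (u \<^bold>= x' \<^bold>\<or> u \<^bold>= y')" .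
qed

lemma opair_cong:
  assumes "p \<tturnstile> opair_fm z x y" "p \<tturnstile> (z \<^bold>= z')" "p \<tturnstile> (x \<^bold>= x')" "p \<tturnstile> (y \<^bold>= y')"
  shows "p \<tturnstile> opair_fm z' x' y'"
  using assms(1) unfolding opair_fm_def
proof (elim forces_exE, goal_cases)
  case (1 q u r v)
  note e = assms(2-4)[THEN forces_mono, OF leq_trans[OF 1(3,1)]]
  have "r \<tturnstile> (upair_fm u x' x' \<^bold>\<and> upair_fm v x' y' \<^bold>\<and> upair_fm z' u v)"
    using 1(5) upair_cong[OF _ eq_refl e(2,2)] upair_cong[OF _ eq_refl e(2,3)]
      upair_cong[OF _ e(1) eq_refl eq_refl] unfolding forces.simps by blast
  then show ?case using 1(2,4) by (intro forces_exI[of _ _ u] forces_exI[of _ _ v])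
qed

lemma related_cong:
  assumes "p \<tturnstile> related_fm f x y" "p \<tturnstile> (x \<^bold>= x')" "p \<tturnstile> (y \<^bold>= y')"
  shows "p \<tturnstile> related_fm f x' y'"
  using assms(1) unfolding related_fm_def
proof (elim forces_exE, goal_cases)
  case (1 q z)
  then have "q \<tturnstile> (opair_fm z x' y' \<^bold>\<and> z \<^bold>\<in> f)"
    using assms(2,3)[THEN forces_mono, OF 1(1)] opair_cong[OF _ eq_refl] unfolding forces.simps by blast
  then show ?case using 1(2) by (rule forces_exI)
qed

lemma opair_inj:
  assumes "p \<tturnstile> opair_fm z x y" "p \<tturnstile> opair_fm z x' y'" "p \<in> conds P" "nm x" "nm y" "nm x'" "nm y'"
  shows "p \<tturnstile> (x \<^bold>= x')" "p \<tturnstile> (y \<^bold>= y')"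
proof -
  \<comment> \<open>\<open>x'\<close> belongs to both elements of {{x'}, {x', y'}}, and {x} is equal
    to one of them.\<close>
  have fst_eq: "q \<tturnstile> (x' \<^bold>= x)"
    if h: "q \<in> conds P" "nm u" "q \<tturnstile> upair_fm u x x" "q \<tturnstile> upair_fm z u v"
      "q \<tturnstile> upair_fm u' x' x'" "q \<tturnstile> upair_fm v' x' y'" "q \<tturnstile> upair_fm z u' v'" for q u v u' v'
  proof -
    have "q \<tturnstile> (u \<^bold>= u' \<^bold>\<or> u \<^bold>= v')"
      using upair_memE[OF h(7) h(2) _ h(1)] upair_memL[OF h(4) h(2) h(1)] by blast
    then have "q \<tturnstile> (x' \<^bold>\<in> u)"
    proof (rule forces_disjE)
      fix r assume "r \<sqsubseteq> q" "r \<tturnstile> (u \<^bold>= u')"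
      moreover have "q \<tturnstile> (x' \<^bold>\<in> u')" using upair_memL[OF h(5)] assms h by blast
      ultimately show "r \<tturnstile> (x' \<^bold>\<in> u)" using mem_eqR eq_sym forces_mono by blast
    next
      fix r assume "r \<sqsubseteq> q" "r \<tturnstile> (u \<^bold>= v')"
      moreover have "q \<tturnstile> (x' \<^bold>\<in> v')" using upair_memL[OF h(6)] assms h by blast
      ultimately show "r \<tturnstile> (x' \<^bold>\<in> u)" using mem_eqR eq_sym forces_mono by blast
    qed
    then have "q \<tturnstile> (x' \<^bold>= x \<^bold>\<or> x' \<^bold>= x)" using upair_memE h assms by blast
    then show ?thesis by (rule forces_disjE) auto
  qed
  \<comment> \<open>Stated for arbitrary \<open>x\<close>, \<open>y\<close>, \<open>x'\<close>,
    \<open>y'\<close>, since it is needed a second time with the two pairs exchanged.\<close>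
  have snd_cases: "q \<tturnstile> (y \<^bold>= x' \<^bold>\<or> y \<^bold>= y')"
    if h: "q \<in> conds P" "nm v" "nm y" "q \<tturnstile> upair_fm v x y" "q \<tturnstile> upair_fm z u v"
      "q \<tturnstile> upair_fm u' x' x'" "q \<tturnstile> upair_fm v' x' y'" "q \<tturnstile> upair_fm z u' v'"
    for q u v u' v' x y x' y'
  proof -
    have yv: "q \<tturnstile> (y \<^bold>\<in> v)" using upair_memR h by blast
    have "q \<tturnstile> (v \<^bold>= u' \<^bold>\<or> v \<^bold>= v')"
      using upair_memE[OF h(8) h(2) _ h(1)] upair_memR[OF h(5) h(2) h(1)] by blast
    then show ?thesis
    proof (rule forces_disjE)
      fix r assume r: "r \<sqsubseteq> q" "r \<tturnstile> (v \<^bold>= u')"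
      then have "r \<tturnstile> (y \<^bold>\<in> u')" using mem_eqR yv forces_mono by blast
      then have "r \<tturnstile> (y \<^bold>= x' \<^bold>\<or> y \<^bold>= x')"
        using upair_memE h r(1) forces_mono leq_conds by blast
      then show "r \<tturnstile> (y \<^bold>= x' \<^bold>\<or> y \<^bold>= y')" by (rule forces_disjE) (rule forces_disjI1, assumption)+
    next
      fix r assume r: "r \<sqsubseteq> q" "r \<tturnstile> (v \<^bold>= v')"
      then have "r \<tturnstile> (y \<^bold>\<in> v')" using mem_eqR yv forces_mono by blast
      then show "r \<tturnstile> (y \<^bold>= x' \<^bold>\<or> y \<^bold>= y')"
        using upair_memE h r(1) forces_mono leq_conds by blast
    qed
  qed
  have "p \<tturnstile> (x \<^bold>= x' \<^bold>\<and> y \<^bold>= y')"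
    using assms(1)[unfolded opair_fm_def]
  proof (elim forces_exE, goal_cases)
    case (1 q u r v)
    note uv = 1(2,4,5)
    have rp: "r \<sqsubseteq> p" using leq_trans[OF 1(3,1)] .
    have "r \<tturnstile> opair_fm z x' y'" using assms(2) rp forces_mono by blast
    then show ?case unfolding opair_fm_def
    proof (elim forces_exE, goal_cases)
      case (1 q' u' s v')
      have sr: "s \<sqsubseteq> r" using leq_trans[OF 1(3,1)] .
      then have sc: "s \<in> conds P" using leq_conds by blast
      have a: "s \<tturnstile> upair_fm u x x" "s \<tturnstile> upair_fm v x y" "s \<tturnstile> upair_fm z u v"
        using forces_mono[OF uv(3) sr] by auto
      have b: "s \<tturnstile> upair_fm u' x' x'" "s \<tturnstile> upair_fm v' x' y'" "s \<tturnstile> upair_fm z u' v'"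
        using 1(5) by auto
      have xx: "s \<tturnstile> (x' \<^bold>= x)" using fst_eq[OF sc uv(1) a(1,3) b] .
      have y1: "s \<tturnstile> (y \<^bold>= x' \<^bold>\<or> y \<^bold>= y')" using snd_cases[OF sc uv(2) assms(5) a(2,3) b] .
      have y2: "s \<tturnstile> (y' \<^bold>= x \<^bold>\<or> y' \<^bold>= y)"
        using snd_cases[OF sc 1(4) assms(7) b(2,3) a] .
      have "s \<tturnstile> (y \<^bold>= y')"
        using y1
      proof (rule forces_disjE)
        \<comment> \<open>The degenerate case: \<open>y\<close> equals \<open>x'\<close>, hence
          \<open>x\<close>; by the exchanged alternative \<open>y'\<close> is \<open>x\<close> or
          \<open>y\<close>, so it equals \<open>y\<close> in any case.\<close>
        fix t assume t: "t \<sqsubseteq> s" "t \<tturnstile> (y \<^bold>= x')"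
        have "t \<tturnstile> (y' \<^bold>= x \<^bold>\<or> y' \<^bold>= y)" using y2 t forces_mono by blast
        then show "t \<tturnstile> (y \<^bold>= y')"
        proof (rule forces_disjE)
          fix w assume w: "w \<sqsubseteq> t" "w \<tturnstile> (y' \<^bold>= x)"
          have "w \<tturnstile> (y \<^bold>= x')" "w \<tturnstile> (x' \<^bold>= x)"
            using w t xx forces_mono leq_trans by blast+
          then show "w \<tturnstile> (y \<^bold>= y')" using w(2) eq_sym eq_trans by blast
        qed (use eq_sym in blast)
      qed
      then show ?case using eq_sym[OF xx] by simp
    qed
  qed
  then show "p \<tturnstile> (x \<^bold>= x')" "p \<tturnstile> (y \<^bold>= y')" by auto
qed

definition upair_name :: "('c, 'j) name \<Rightarrow> ('c, 'j) name \<Rightarrow> ('c, 'j) name" where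
  "upair_name x y = hat one {x, y}"

definition opair_name :: "('c, 'j) name \<Rightarrow> ('c, 'j) name \<Rightarrow> ('c, 'j) name" where
  "opair_name x y = upair_name (upair_name x x) (upair_name x y)"

lemma nm_upair_name: "nm x \<Longrightarrow> nm y \<Longrightarrow> nm (upair_name x y)"
  unfolding upair_name_def by (rule nm_hat) auto

lemma nm_opair_name: "nm x \<Longrightarrow> nm y \<Longrightarrow> nm (opair_name x y)"
  unfolding opair_name_def by (intro nm_upair_name)

lemma upair_name: "p \<tturnstile> upair_fm (upair_name x y) x y"
  unfolding forces_upair upair_name_def
proof (intro allI impI iffI)
  fix u q assume "q \<tturnstile> (u \<^bold>\<in> hat one {x, y})"
  then show "q \<tturnstile> (u \<^bold>= x \<^bold>\<or> u \<^bold>= y)"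
    by (rule hat_memE) (use forces_disjI1 forces_disjI2 in auto)
next
  fix u q assume *: "q \<sqsubseteq> p" "q \<tturnstile> (u \<^bold>= x \<^bold>\<or> u \<^bold>= y)"
  show "q \<tturnstile> (u \<^bold>\<in> hat one {x, y})"
    by (rule forces_disjE[OF *(2)])
      (use hat_memI_eq[of "{x, y}" x] hat_memI_eq[of "{x, y}" y] leq_conds in simp_all)
qed

lemma opair_name: "nm x \<Longrightarrow> nm y \<Longrightarrow> p \<tturnstile> opair_fm (opair_name x y) x y"
  unfolding opair_fm_def opair_name_def
  by (rule forces_exI[of _ _ "upair_name x x"], rule forces_exI[of _ _ "upair_name x y"])
    (auto simp: upair_name nm_upair_name)

subsection \<open>Natural numbers and finite sets\<close>

abbreviation num :: "nat \<Rightarrow> ('c, 'j) name" where "num \<equiv> numeral_name one"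

lemma num: "num n = hat one (num ` {..<n})"
  by (rule numeral_name.simps)

lemma nm_num: "nm (num n)"
proof (induction n rule: less_induct)
  case (less n)
  show ?case by (subst num) (use less in \<open>auto intro!: nm_hat\<close>)
qed

lemma num_memI: "i < n \<Longrightarrow> p \<in> conds P \<Longrightarrow> p \<tturnstile> (num i \<^bold>\<in> num n)"
  by (subst (2) num) (auto intro!: hat_memI)

lemma num_memI_eq: "p \<tturnstile> (x \<^bold>= num i) \<Longrightarrow> i < n \<Longrightarrow> p \<in> conds P \<Longrightarrow> p \<tturnstile> (x \<^bold>\<in> num n)"
  by (rule mem_eqL[OF num_memI eq_sym])

lemma num_memE:
  assumes "p \<tturnstile> (x \<^bold>\<in> num n)" "\<And>q i. q \<sqsubseteq> p \<Longrightarrow> i < n \<Longrightarrow> q \<tturnstile> (x \<^bold>= num i) \<Longrightarrow> q \<tturnstile> \<chi>"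
  shows "p \<tturnstile> \<chi>"
  by (rule hat_memE[OF assms(1)[unfolded num[of n]]]) (use assms(2) in auto)

text \<open>If \<open>n\<close> were forced into itself, some extension would equate it with an
  \<open>i < n\<close>, and the membership of \<open>i\<close> in \<open>n\<close> would become one
  of \<open>i\<close> in \<open>i\<close>.\<close>

lemma num_not_mem_self: "p \<in> conds P \<Longrightarrow> \<not> p \<tturnstile> (num n \<^bold>\<in> num n)"
proof (induction n arbitrary: p rule: less_induct)
  case (less n)
  show ?case
  proof
    assume "p \<tturnstile> (num n \<^bold>\<in> num n)"
    then have "p \<tturnstile> (num n \<^bold>\<in> hat one (num ` {..<n}))" by (metis num)
    then obtain r i where r: "r \<sqsubseteq> p" "i < n" "r \<tturnstile> (num n \<^bold>= num i)"
      by (rule hat_dense[OF _ _ leq_refl[OF less.prems]]) auto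
    then have "r \<in> conds P" using leq_conds by blast
    moreover from this have "r \<tturnstile> (num i \<^bold>\<in> num i)"
      using mem_eqR[OF num_memI r(3)] r(2) by blast
    ultimately show False using less.IH r(2) by blast
  qed
qed

lemma num_eq_imp_eq:
  assumes "p \<in> conds P" "p \<tturnstile> (num i \<^bold>= num j)"
  shows "i = j"
proof (rule ccontr)
  assume "i \<noteq> j"
  then consider "i < j" | "j < i" by linarith
  then show False
  proof cases
    case 1
    then show False using mem_eqR[OF num_memI eq_sym[OF assms(2)]] num_not_mem_self assms(1) by blast
  next
    case 2
    then show False using mem_eqR[OF num_memI assms(2)] num_not_mem_self assms(1) by blast
  qed
qed

lemma inductive_empty:
  assumes "p \<tturnstile> inductive_fm w" "nm x" "p \<in> conds P" "\<And>q z. q \<sqsubseteq> p \<Longrightarrow> nm z \<Longrightarrow> \<not> q \<tturnstile> (z \<^bold>\<in> x)"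
  shows "p \<tturnstile> (x \<^bold>\<in> w)"
proof -
  have "p \<tturnstile> ((\<^bold>\<forall>z. \<^bold>\<not> z \<^bold>\<in> x) \<^bold>\<longrightarrow> x \<^bold>\<in> w)"
    using assms(1,2) unfolding inductive_fm_def forces.simps(4,5) by blast
  moreover have "p \<tturnstile> (\<^bold>\<forall>z. \<^bold>\<not> z \<^bold>\<in> x)" unfolding forces.simps(3,5) using assms(4) by blast
  ultimately show ?thesis using forces_mp assms(3) by blast
qed

lemma inductive_step:
  assumes "p \<tturnstile> inductive_fm w" "p \<tturnstile> (x \<^bold>\<in> w)" "nm x" "nm y" "p \<in> conds P"
    and "\<And>q z. q \<sqsubseteq> p \<Longrightarrow> nm z \<Longrightarrow> q \<tturnstile> (z \<^bold>\<in> y) \<longleftrightarrow> q \<tturnstile> (z \<^bold>\<in> x \<^bold>\<or> z \<^bold>= x)"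
  shows "p \<tturnstile> (y \<^bold>\<in> w)"
proof -
  have "p \<tturnstile> (x \<^bold>\<in> w \<^bold>\<longrightarrow> (\<^bold>\<forall>y. (\<^bold>\<forall>z. z \<^bold>\<in> y \<^bold>\<longleftrightarrow> (z \<^bold>\<in> x \<^bold>\<or> z \<^bold>= x)) \<^bold>\<longrightarrow> y \<^bold>\<in> w))"
    using assms(1,3) unfolding inductive_fm_def forces.simps(4,5) by blast
  then have "p \<tturnstile> (\<^bold>\<forall>y. (\<^bold>\<forall>z. z \<^bold>\<in> y \<^bold>\<longleftrightarrow> (z \<^bold>\<in> x \<^bold>\<or> z \<^bold>= x)) \<^bold>\<longrightarrow> y \<^bold>\<in> w)"
    using forces_mp assms(2,5) by blast
  then have "p \<tturnstile> ((\<^bold>\<forall>z. z \<^bold>\<in> y \<^bold>\<longleftrightarrow> (z \<^bold>\<in> x \<^bold>\<or> z \<^bold>= x)) \<^bold>\<longrightarrow> y \<^bold>\<in> w)"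
    using forces_allD assms(4) by blast
  moreover have "p \<tturnstile> (\<^bold>\<forall>z. z \<^bold>\<in> y \<^bold>\<longleftrightarrow> (z \<^bold>\<in> x \<^bold>\<or> z \<^bold>= x))"
    unfolding forces.simps(5) forces_iff using assms(6) by blast
  ultimately show ?thesis using forces_mp assms(5) by blast
qed

lemma inductiveI:
  assumes "\<And>q x. q \<sqsubseteq> p \<Longrightarrow> nm x \<Longrightarrow> (\<And>r z. r \<sqsubseteq> q \<Longrightarrow> nm z \<Longrightarrow> \<not> r \<tturnstile> (z \<^bold>\<in> x)) \<Longrightarrow> q \<tturnstile> (x \<^bold>\<in> w)"
    and "\<And>q x y. q \<sqsubseteq> p \<Longrightarrow> nm x \<Longrightarrow> nm y \<Longrightarrow> q \<tturnstile> (x \<^bold>\<in> w) \<Longrightarrow>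
      (\<And>r z. r \<sqsubseteq> q \<Longrightarrow> nm z \<Longrightarrow> r \<tturnstile> (z \<^bold>\<in> y) \<longleftrightarrow> r \<tturnstile> (z \<^bold>\<in> x \<^bold>\<or> z \<^bold>= x)) \<Longrightarrow> q \<tturnstile> (y \<^bold>\<in> w)"
  shows "p \<tturnstile> inductive_fm w"
  unfolding inductive_fm_def forces.simps(3,4,5) forces_imp forces_iff
proof (intro conjI allI impI, goal_cases)
  case (1 x q)
  then show ?case using assms(1) by blast
next
  case (2 x q y r)
  have "r \<tturnstile> (x \<^bold>\<in> w)" "r \<sqsubseteq> p" using 2 forces_mono leq_trans by blast+
  then show ?case using 2 assms(2) by blast
qed

lemma num_Suc_mem_iff: "q \<in> conds P \<Longrightarrow> q \<tturnstile> (z \<^bold>\<in> num (Suc n)) \<longleftrightarrow> q \<tturnstile> (z \<^bold>\<in> num n \<^bold>\<or> z \<^bold>= num n)"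
proof
  assume "q \<in> conds P" "q \<tturnstile> (z \<^bold>\<in> num (Suc n))"
  from this(2) show "q \<tturnstile> (z \<^bold>\<in> num n \<^bold>\<or> z \<^bold>= num n)"
  proof (rule num_memE)
    fix r i assume r: "r \<sqsubseteq> q" "i < Suc n" "r \<tturnstile> (z \<^bold>= num i)"
    show "r \<tturnstile> (z \<^bold>\<in> num n \<^bold>\<or> z \<^bold>= num n)"
    proof (cases "i = n")
      case True
      then show ?thesis using r(3) by (auto intro: forces_disjI2)
    next
      case False
      then have "r \<tturnstile> (num i \<^bold>\<in> num n)" using r num_memI leq_conds by auto
      then show ?thesis using mem_eqL eq_sym r(3) forces_disjI1 by blast
    qed
  qed
next
  assume q: "q \<in> conds P" "q \<tturnstile> (z \<^bold>\<in> num n \<^bold>\<or> z \<^bold>= num n)"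
  from q(2) show "q \<tturnstile> (z \<^bold>\<in> num (Suc n))"
  proof (rule forces_disjE)
    fix r assume "r \<sqsubseteq> q" "r \<tturnstile> (z \<^bold>\<in> num n)"
    from this(2) show "r \<tturnstile> (z \<^bold>\<in> num (Suc n))"
    proof (rule num_memE)
      fix s i assume "s \<sqsubseteq> r" "i < n" "s \<tturnstile> (z \<^bold>= num i)"
      then show "s \<tturnstile> (z \<^bold>\<in> num (Suc n))"
        using num_memI_eq[of s z i "Suc n"] leq_conds[of s r] by simp
    qed
  next
    fix r assume "r \<sqsubseteq> q" "r \<tturnstile> (z \<^bold>= num n)"
    then show "r \<tturnstile> (z \<^bold>\<in> num (Suc n))" using num_memI_eq[of r z n "Suc n"] leq_conds[of r q] by simp
  qed
qed

lemma num_mem_inductive: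
  assumes "p \<tturnstile> inductive_fm w" "p \<in> conds P"
  shows "p \<tturnstile> (num n \<^bold>\<in> w)"
proof (induction n)
  case 0
  show ?case
  proof (rule inductive_empty[OF assms(1) nm_num assms(2)])
    fix q and z :: "('c, 'j) name" assume q: "q \<sqsubseteq> p"
    show "\<not> q \<tturnstile> (z \<^bold>\<in> num 0)"
    proof
      assume "q \<tturnstile> (z \<^bold>\<in> num 0)"
      then show False by (subst (asm) num) (auto elim: hat_dense[OF _ _ below_refl(1)[OF q]])
    qed
  qed
next
  case (Suc n)
  show ?case
    by (rule inductive_step[OF assms(1) Suc nm_num nm_num assms(2)])
      (use num_Suc_mem_iff leq_conds in blast)
qed

text \<open>The name of the ground model's set of naturals competes in the minimality clause of
  \<open>omega_fm\<close>; this is how new natural numbers are excluded.\<close>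

lemma inductive_range_num: "p \<tturnstile> inductive_fm (hat one (range num))"
proof (rule inductiveI)
  fix q x assume q: "q \<sqsubseteq> p" "nm x" "\<And>r z. r \<sqsubseteq> q \<Longrightarrow> nm z \<Longrightarrow> \<not> r \<tturnstile> (z \<^bold>\<in> x)"
  have "q \<tturnstile> (x \<^bold>= num 0)"
  proof (rule extensionality[OF q(2) nm_num])
    fix z r assume r: "nm z" "r \<sqsubseteq> q"
    moreover have "\<not> r \<tturnstile> (z \<^bold>\<in> num 0)"
    proof
      assume "r \<tturnstile> (z \<^bold>\<in> num 0)"
      then show False by (subst (asm) num) (auto elim: hat_dense[OF _ _ below_refl(1)[OF r(2)]])
    qed
    ultimately show "r \<tturnstile> (z \<^bold>\<in> x) \<longleftrightarrow> r \<tturnstile> (z \<^bold>\<in> num 0)" using q(3) by blast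
  qed
  then show "q \<tturnstile> (x \<^bold>\<in> hat one (range num))"
    using hat_memI_eq[of "range num" "num 0"] leq_conds[OF q(1)] by simp
next
  fix q x y
  assume q: "q \<sqsubseteq> p" "nm x" "nm y" "q \<tturnstile> (x \<^bold>\<in> hat one (range num))"
    "\<And>r z. r \<sqsubseteq> q \<Longrightarrow> nm z \<Longrightarrow> r \<tturnstile> (z \<^bold>\<in> y) \<longleftrightarrow> r \<tturnstile> (z \<^bold>\<in> x \<^bold>\<or> z \<^bold>= x)"
  from q(4) show "q \<tturnstile> (y \<^bold>\<in> hat one (range num))"
  proof (rule hat_memE)
    fix r t assume r: "r \<sqsubseteq> q" "t \<in> range num" "r \<tturnstile> (x \<^bold>= t)"
    then obtain n where t: "t = num n" by blast
    have "r \<tturnstile> (y \<^bold>= num (Suc n))"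
    proof (rule extensionality[OF q(3) nm_num])
      fix z s assume z: "nm z" and s: "s \<sqsubseteq> r"
      have e: "s \<tturnstile> (x \<^bold>= num n)" using forces_mono r(3) s t by blast
      have tr: "s \<tturnstile> (z \<^bold>\<in> b \<^bold>\<or> z \<^bold>= b)" if "s \<tturnstile> (z \<^bold>\<in> a \<^bold>\<or> z \<^bold>= a)" "s \<tturnstile> (a \<^bold>= b)" for a b
        using that(1)
      proof (rule forces_disjE)
        fix t assume "t \<sqsubseteq> s" "t \<tturnstile> (z \<^bold>\<in> a)"
        then show "t \<tturnstile> (z \<^bold>\<in> b \<^bold>\<or> z \<^bold>= b)"
          using mem_eqR[OF _ forces_mono[OF that(2)]] by (intro forces_disjI1)
      next
        fix t assume "t \<sqsubseteq> s" "t \<tturnstile> (z \<^bold>= a)"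
        then show "t \<tturnstile> (z \<^bold>\<in> b \<^bold>\<or> z \<^bold>= b)"
          using eq_trans[OF _ forces_mono[OF that(2)]] by (intro forces_disjI2)
      qed
      have "s \<tturnstile> (z \<^bold>\<in> y) \<longleftrightarrow> s \<tturnstile> (z \<^bold>\<in> x \<^bold>\<or> z \<^bold>= x)"
        using q(5)[OF leq_trans[OF s r(1)] z] .
      also have "\<dots> \<longleftrightarrow> s \<tturnstile> (z \<^bold>\<in> num n \<^bold>\<or> z \<^bold>= num n)"
        using tr e eq_sym by blast
      also have "\<dots> \<longleftrightarrow> s \<tturnstile> (z \<^bold>\<in> num (Suc n))"
        using num_Suc_mem_iff leq_conds s by blast
      finally show "s \<tturnstile> (z \<^bold>\<in> y) \<longleftrightarrow> s \<tturnstile> (z \<^bold>\<in> num (Suc n))" .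
    qed
    then show "r \<tturnstile> (y \<^bold>\<in> hat one (range num))"
      using hat_memI_eq[of "range num" "num (Suc n)"] leq_conds[OF r(1)] by simp
  qed simp
qed

lemma omega_num_mem: "p \<tturnstile> omega_fm w \<Longrightarrow> p \<in> conds P \<Longrightarrow> p \<tturnstile> (num n \<^bold>\<in> w)"
  using num_mem_inductive unfolding omega_fm_def by simp

lemma nm_range_num: "nm (hat one (range num))"
  by (rule nm_hat) (auto simp: nm_num)

text \<open>By minimality \<open>w\<close> is contained in the name that collects the numerals, and
  membership in that name is decided densely.\<close>

lemma omega_memE:
  assumes "p \<tturnstile> omega_fm w" "nm x" "p \<in> conds P" "p \<tturnstile> (x \<^bold>\<in> w)"
  obtains q n where "q \<sqsubseteq> p" "q \<tturnstile> (x \<^bold>= num n)"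
proof -
  have "p \<tturnstile> (inductive_fm (hat one (range num)) \<^bold>\<longrightarrow> w \<^bold>\<subseteq> hat one (range num))"
    using assms(1) forces_allD[OF _ nm_range_num] unfolding omega_fm_def forces.simps(4) by blast
  then have "p \<tturnstile> (w \<^bold>\<subseteq> hat one (range num))"
    using forces_mp inductive_range_num assms(3) by blast
  then have "p \<tturnstile> (x \<^bold>\<in> w \<^bold>\<longrightarrow> x \<^bold>\<in> hat one (range num))"
    using forces_allD[OF _ assms(2)] unfolding subset_fm_def by blast
  then have "p \<tturnstile> (x \<^bold>\<in> hat one (range num))" using forces_mp assms(3,4) by blast
  then show thesis by (rule hat_dense[OF _ _ leq_refl[OF assms(3)]]) (use that in auto)
qed

lemma onto_fm_finite:
  fixes k :: nat
  assumes "\<And>i. i < k \<Longrightarrow> nm (\<sigma> i)"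
  shows "p \<tturnstile> onto_fm (hat one ((\<lambda>i. opair_name (num i) (\<sigma> i)) ` {..<k})) (num k) (hat one (\<sigma> ` {..<k}))"
proof -
  let ?f = "hat one ((\<lambda>i. opair_name (num i) (\<sigma> i)) ` {..<k})"
  let ?F = "hat one (\<sigma> ` {..<k})"
  have related: "q \<tturnstile> related_fm ?f (num i) (\<sigma> i)" if "q \<in> conds P" "i < k" for q i
  proof -
    have "q \<tturnstile> (opair_fm (opair_name (num i) (\<sigma> i)) (num i) (\<sigma> i) \<^bold>\<and> opair_name (num i) (\<sigma> i) \<^bold>\<in> ?f)"
      using opair_name[OF nm_num assms] hat_memI that by simp
    then show ?thesis unfolding related_fm_def by (rule forces_exI) (intro nm_opair_name nm_num assms that)
  qed
  have relatedE: "q \<tturnstile> \<chi>"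
    if "q \<tturnstile> related_fm ?f x y" "nm x" "nm y"
      "\<And>r i. r \<sqsubseteq> q \<Longrightarrow> i < k \<Longrightarrow> r \<tturnstile> (x \<^bold>= num i) \<Longrightarrow> r \<tturnstile> (y \<^bold>= \<sigma> i) \<Longrightarrow> r \<tturnstile> \<chi>" for q x y \<chi>
    using that(1) unfolding related_fm_def
  proof (rule forces_exE)
    fix r z assume r: "r \<sqsubseteq> q" "nm z" "r \<tturnstile> (opair_fm z x y \<^bold>\<and> z \<^bold>\<in> ?f)"
    then have "r \<tturnstile> (z \<^bold>\<in> ?f)" by simp
    then show "r \<tturnstile> \<chi>"
    proof (rule hat_memE)
      fix s t assume s: "s \<sqsubseteq> r" "t \<in> (\<lambda>i. opair_name (num i) (\<sigma> i)) ` {..<k}" "s \<tturnstile> (z \<^bold>= t)"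
      then obtain i where i: "i < k" "t = opair_name (num i) (\<sigma> i)" by blast
      have "s \<tturnstile> opair_fm z x y" using forces_mono[OF r(3) s(1)] by simp
      then have "s \<tturnstile> opair_fm t x y" using s(3) eq_refl opair_cong by blast
      moreover have "s \<tturnstile> opair_fm t (num i) (\<sigma> i)" using opair_name[OF nm_num assms] i by simp
      ultimately have "s \<tturnstile> (x \<^bold>= num i)" "s \<tturnstile> (y \<^bold>= \<sigma> i)"
        using opair_inj that(2,3) nm_num assms[OF i(1)] leq_conds[OF s(1)] by blast+
      then show "s \<tturnstile> \<chi>" using that(4) i(1) leq_trans[OF s(1) r(1)] by blast
    qed simp
  qed
  show ?thesis
    unfolding onto_fm_def forces.simps(4,5) forces_imp
  proof (intro conjI allI impI, goal_cases)
    case (1 z q)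
    from 1(3) show ?case
    proof (rule hat_memE)
      fix r t assume r: "r \<sqsubseteq> q" "t \<in> (\<lambda>i. opair_name (num i) (\<sigma> i)) ` {..<k}" "r \<tturnstile> (z \<^bold>= t)"
      then obtain i where i: "i < k" "t = opair_name (num i) (\<sigma> i)" by blast
      have "r \<tturnstile> opair_fm t (num i) (\<sigma> i)" using opair_name[OF nm_num assms] i by simp
      then have "r \<tturnstile> opair_fm z (num i) (\<sigma> i)" using eq_sym[OF r(3)] eq_refl opair_cong by blast
      then have "r \<tturnstile> (num i \<^bold>\<in> num k \<^bold>\<and> \<sigma> i \<^bold>\<in> ?F \<^bold>\<and> opair_fm z (num i) (\<sigma> i))"
        using num_memI hat_memI leq_conds[OF r(1)] i by simp
      then show "r \<tturnstile> (\<^bold>\<exists>x y. x \<^bold>\<in> num k \<^bold>\<and> y \<^bold>\<in> ?F \<^bold>\<and> opair_fm z x y)"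
        by (intro forces_exI[of _ _ "num i"] forces_exI[of _ _ "\<sigma> i"] nm_num assms i)
    qed simp
  next
    case (2 x q)
    from 2(3) show ?case
    proof (rule num_memE)
      fix r i assume r: "r \<sqsubseteq> q" "i < k" "r \<tturnstile> (x \<^bold>= num i)"
      then have "r \<tturnstile> related_fm ?f x (\<sigma> i)"
        using related_cong[OF related eq_sym eq_refl] leq_conds by blast
      then show "r \<tturnstile> (\<^bold>\<exists>y. related_fm ?f x y)" by (rule forces_exI) (intro assms r)
    qed
  next
    case (3 x y z q)
    then have q: "q \<tturnstile> related_fm ?f x y" "q \<tturnstile> related_fm ?f x z" by auto
    from q(1) 3(1,2) show ?case
    proof (rule relatedE)
      fix r i assume r: "r \<sqsubseteq> q" "i < k" "r \<tturnstile> (x \<^bold>= num i)" "r \<tturnstile> (y \<^bold>= \<sigma> i)"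
      from forces_mono[OF q(2) r(1)] 3(1,3) show "r \<tturnstile> (y \<^bold>= z)"
      proof (rule relatedE)
        fix s j assume s: "s \<sqsubseteq> r" "j < k" "s \<tturnstile> (x \<^bold>= num j)" "s \<tturnstile> (z \<^bold>= \<sigma> j)"
        have "s \<tturnstile> (num i \<^bold>= num j)" using eq_trans[OF eq_sym[OF forces_mono[OF r(3) s(1)]] s(3)] .
        \<comment> \<open>Single-valuedness rests on distinct numerals never being forced
          equal.\<close>
        then have "i = j" using num_eq_imp_eq leq_conds s(1) by blast
        then show "s \<tturnstile> (y \<^bold>= z)" using eq_trans[OF forces_mono[OF r(4) s(1)] eq_sym] s(4) by blast
      qed
    qed
  next
    case (4 y q)
    from 4(3) show ?case
    proof (rule hat_memE)
      fix r t assume r: "r \<sqsubseteq> q" "t \<in> \<sigma> ` {..<k}" "r \<tturnstile> (y \<^bold>= t)"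
      then obtain i where i: "i < k" "t = \<sigma> i" by blast
      then have "r \<tturnstile> related_fm ?f (num i) y"
        using related_cong[OF related eq_refl eq_sym] leq_conds r by blast
      then show "r \<tturnstile> (\<^bold>\<exists>x. related_fm ?f x y)" by (rule forces_exI) (rule nm_num)
    qed simp
  qed
qed

text \<open>The name \<open>w\<close> of omega will come from the countability witness of a
  decomposition into centered pieces.\<close>

lemma finite_fm_hat:
  fixes k :: nat
  assumes "\<And>i. i < k \<Longrightarrow> nm (\<sigma> i)" "p \<tturnstile> omega_fm w" "nm w" "p \<in> conds P"
  shows "p \<tturnstile> finite_fm (hat one (\<sigma> ` {..<k}))"
proof -
  let ?f = "hat one ((\<lambda>i. opair_name (num i) (\<sigma> i)) ` {..<k})"
  have "p \<tturnstile> (omega_fm w \<^bold>\<and> num k \<^bold>\<in> w \<^bold>\<and> onto_fm ?f (num k) (hat one (\<sigma> ` {..<k})))"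
    using assms omega_num_mem onto_fm_finite by simp
  moreover have "nm ?f" using assms(1) by (intro nm_hat) (auto intro: nm_opair_name nm_num)
  ultimately show ?thesis
    unfolding finite_fm_def
    by (intro forces_exI[of _ _ w] forces_exI[of _ _ "num k"] forces_exI[of _ _ ?f] assms nm_num)
qed

subsection \<open>Centeredness\<close>

lemma centered_lower_bound:
  fixes k :: nat
  assumes "p \<tturnstile> centered_fm Q L C" "p \<tturnstile> omega_fm w" "nm w" "p \<in> conds P"
    and "\<And>i. i < k \<Longrightarrow> nm (\<sigma> i)" "\<And>i. i < k \<Longrightarrow> p \<tturnstile> (\<sigma> i \<^bold>\<in> C)"
  obtains q \<tau> where "q \<sqsubseteq> p" "\<tau> \<in> snd ` pairs Q" "q \<tturnstile> (\<tau> \<^bold>\<in> Q)"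
    "\<And>i. i < k \<Longrightarrow> q \<tturnstile> related_fm L \<tau> (\<sigma> i)"
proof -
  let ?F = "hat one (\<sigma> ` {..<k})"
  have F: "nm ?F" using assms(5) by (intro nm_hat) auto
  have "p \<tturnstile> (?F \<^bold>\<subseteq> C)"
    unfolding subset_fm_def forces.simps(5) forces_imp
  proof (intro allI impI)
    fix z q assume q: "q \<sqsubseteq> p" "q \<tturnstile> (z \<^bold>\<in> ?F)"
    from q(2) show "q \<tturnstile> (z \<^bold>\<in> C)"
    proof (rule hat_memE)
      fix r y assume r: "r \<sqsubseteq> q" "y \<in> \<sigma> ` {..<k}" "r \<tturnstile> (z \<^bold>= y)"
      then have "r \<tturnstile> (y \<^bold>\<in> C)" using assms(6) forces_mono leq_trans[OF r(1) q(1)] by blast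
      then show "r \<tturnstile> (z \<^bold>\<in> C)" using mem_eqL eq_sym r(3) by blast
    qed simp
  qed
  then have "p \<tturnstile> (?F \<^bold>\<subseteq> C \<^bold>\<and> finite_fm ?F)"
    using finite_fm_hat[OF assms(5,2-4)] by simp
  then have "p \<tturnstile> (\<^bold>\<exists>r. r \<^bold>\<in> Q \<^bold>\<and> (\<^bold>\<forall>x. x \<^bold>\<in> ?F \<^bold>\<longrightarrow> related_fm L r x))"
    using forces_mp[OF forces_allD[OF assms(1)[unfolded centered_fm_def] F]] assms(4) by blast
  then obtain q \<rho> where q: "q \<sqsubseteq> p" "nm \<rho>" "q \<tturnstile> (\<rho> \<^bold>\<in> Q \<^bold>\<and> (\<^bold>\<forall>x. x \<^bold>\<in> ?F \<^bold>\<longrightarrow> related_fm L \<rho> x))"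
    using forces_exE_dense leq_refl assms(4) by blast
  have qc: "q \<in> conds P" using q(1) leq_conds by blast
  have "q \<tturnstile> (\<rho> \<^bold>\<in> Q)" using q(3) by simp
  from mem_dense[OF this leq_refl[OF qc]] obtain r c \<tau>
    where r: "r \<sqsubseteq> q" "(c, \<tau>) \<in> pairs Q" "r \<sqsubseteq> c" "r \<tturnstile> (\<rho> \<^bold>= \<tau>)" .
  have "r \<tturnstile> related_fm L \<tau> (\<sigma> i)" if "i < k" for i
  proof -
    have "q \<tturnstile> (\<sigma> i \<^bold>\<in> ?F \<^bold>\<longrightarrow> related_fm L \<rho> (\<sigma> i))"
      using q(3) forces_allD[OF _ assms(5)[OF that]] unfolding forces.simps(4) by blast
    moreover have "q \<tturnstile> (\<sigma> i \<^bold>\<in> ?F)" using hat_memI that qc by simp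
    ultimately have "r \<tturnstile> related_fm L \<rho> (\<sigma> i)" using forces_mp qc forces_mono r(1) by blast
    then show ?thesis using related_cong r(4) eq_refl by blast
  qed
  moreover have "r \<tturnstile> (\<tau> \<^bold>\<in> Q)" using memI r by blast
  moreover have "\<tau> \<in> snd ` pairs Q" using r(2) by force
  ultimately show thesis using that leq_trans[OF r(1) q(1)] by blast
qed

section \<open>Decompositions into centered pieces, and their labels\<close>

definition centering :: "('c, 'j) name \<Rightarrow> ('c, 'j) name \<Rightarrow> ('c, 'j) name \<Rightarrow> ('c, 'j) name \<Rightarrow> ('c, 'j) name \<Rightarrow> 'c \<Rightarrow> bool" where
  "centering Q L S w f p \<longleftrightarrow> p \<in> conds P \<and> nm S \<and> nm w \<and> nm f \<and>
     p \<tturnstile> (omega_fm w \<^bold>\<and> onto_fm f w S \<^bold>\<and> (\<^bold>\<forall>C. C \<^bold>\<in> S \<^bold>\<longrightarrow> C \<^bold>\<subseteq> Q \<^bold>\<and> centered_fm Q L C) \<^bold>\<and>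
        (\<^bold>\<forall>x. x \<^bold>\<in> Q \<^bold>\<longrightarrow> (\<^bold>\<exists>C. C \<^bold>\<in> S \<^bold>\<and> x \<^bold>\<in> C)))"

lemma centering_dense:
  assumes "forced P (sigma_centered_fm Q L)" "p \<in> conds P"
  obtains q S w f where "q \<sqsubseteq> p" "centering Q L S w f q"
proof -
  have "p \<tturnstile> sigma_centered_fm Q L" using assms by (simp add: forced_def)
  from forces_exE_dense[OF this[unfolded sigma_centered_fm_def] leq_refl[OF assms(2)]]
  obtain q S where q: "q \<sqsubseteq> p" "nm S" "q \<tturnstile> (countable_fm S \<^bold>\<and>
          (\<^bold>\<forall>C. C \<^bold>\<in> S \<^bold>\<longrightarrow> C \<^bold>\<subseteq> Q \<^bold>\<and> centered_fm Q L C) \<^bold>\<and>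
          (\<^bold>\<forall>x. x \<^bold>\<in> Q \<^bold>\<longrightarrow> (\<^bold>\<exists>C. C \<^bold>\<in> S \<^bold>\<and> x \<^bold>\<in> C)))" .
  have "q \<tturnstile> countable_fm S" using q(3) by simp
  from forces_exE_dense[OF this[unfolded countable_fm_def] below_refl(1)[OF q(1)]]
  obtain r w where r: "r \<sqsubseteq> q" "nm w" "r \<tturnstile> (\<^bold>\<exists>f. omega_fm w \<^bold>\<and> onto_fm f w S)" .
  from forces_exE_dense[OF r(3) below_refl(1)[OF r(1)]]
  obtain s f where s: "s \<sqsubseteq> r" "nm f" "s \<tturnstile> (omega_fm w \<^bold>\<and> onto_fm f w S)" .
  have sq: "s \<sqsubseteq> q" using leq_trans[OF s(1) r(1)] .
  have "centering Q L S w f s"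
    unfolding centering_def using forces_mono[OF q(3) sq] s r(2) q(2) leq_conds[OF s(1)]
    unfolding forces.simps(4) by blast
  then show thesis using that leq_trans[OF sq q(1)] by blast
qed

lemma centering_mono: "centering Q L S w f p \<Longrightarrow> q \<sqsubseteq> p \<Longrightarrow> centering Q L S w f q"
  unfolding centering_def using forces_mono leq_conds by blast

text \<open>The piece is addressed through the enumeration \<open>f\<close> by an actual number
  \<open>n\<close> rather than by a name of a piece, so that a condition can decide the
  address.\<close>

definition in_piece :: "('c, 'j) name \<Rightarrow> ('c, 'j) name \<Rightarrow> nat \<Rightarrow> ('c, 'j) name \<Rightarrow> ('c, 'j) name fm" where
  "in_piece S f n \<sigma> = (\<^bold>\<exists>C. C \<^bold>\<in> S \<^bold>\<and> related_fm f (num n) C \<^bold>\<and> \<sigma> \<^bold>\<in> C)"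

lemma in_piece_dense:
  assumes "centering Q L S w f p" "nm \<sigma>" "p \<tturnstile> (\<sigma> \<^bold>\<in> Q)"
  obtains q n where "q \<sqsubseteq> p" "q \<tturnstile> in_piece S f n \<sigma>"
proof -
  have p: "p \<in> conds P" "p \<tturnstile> omega_fm w" "p \<tturnstile> onto_fm f w S"
    "p \<tturnstile> (\<^bold>\<forall>x. x \<^bold>\<in> Q \<^bold>\<longrightarrow> (\<^bold>\<exists>C. C \<^bold>\<in> S \<^bold>\<and> x \<^bold>\<in> C))"
    using assms(1) unfolding centering_def by auto
  have "p \<tturnstile> (\<^bold>\<exists>C. C \<^bold>\<in> S \<^bold>\<and> \<sigma> \<^bold>\<in> C)"
    using forces_mp[OF forces_allD[OF p(4) assms(2)]] assms(3) p(1) by blast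
  from forces_exE_dense[OF this leq_refl[OF p(1)]]
  obtain q C where q: "q \<sqsubseteq> p" "nm C" "q \<tturnstile> (C \<^bold>\<in> S \<^bold>\<and> \<sigma> \<^bold>\<in> C)" .
  have q': "q \<tturnstile> onto_fm f w S" "q \<in> conds P" "q \<tturnstile> (C \<^bold>\<in> S)"
    using forces_mono[OF p(3) q(1)] leq_conds[OF q(1)] q(3) by auto
  have "q \<tturnstile> (C \<^bold>\<in> S \<^bold>\<longrightarrow> (\<^bold>\<exists>x. related_fm f x C))"
    using q'(1) forces_allD[OF _ q(2)] unfolding onto_fm_def forces.simps(4) by blast
  from forces_exE_dense[OF forces_mp[OF this q'(3,2)] leq_refl[OF q'(2)]]
  obtain r x where r: "r \<sqsubseteq> q" "nm x" "r \<tturnstile> related_fm f x C" .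
  from forces_exE_dense[OF r(3)[unfolded related_fm_def] below_refl(1)[OF r(1)]]
  obtain s z where s: "s \<sqsubseteq> r" "nm z" "s \<tturnstile> (opair_fm z x C \<^bold>\<and> z \<^bold>\<in> f)" .
  have sc: "s \<in> conds P" and sq: "s \<sqsubseteq> q" using leq_conds[OF s(1)] leq_trans[OF s(1) r(1)] by auto
  \<comment> \<open>Surjectivity in \<open>onto_fm\<close> does not say that the preimage
    \<open>x\<close> is in \<open>w\<close>; only the clause on elements of \<open>f\<close> does.
    So the pair \<open>z\<close> is decomposed once more, and \<open>opair_inj\<close> identifies
    \<open>x\<close> with the first component found there.\<close>
  have "s \<tturnstile> (z \<^bold>\<in> f \<^bold>\<longrightarrow> (\<^bold>\<exists>x y. x \<^bold>\<in> w \<^bold>\<and> y \<^bold>\<in> S \<^bold>\<and> opair_fm z x y))"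
    using forces_mono[OF q'(1) sq] forces_allD[OF _ s(2)] unfolding onto_fm_def forces.simps(4) by blast
  from forces_mp[OF this _ sc] s(3)
  have "s \<tturnstile> (\<^bold>\<exists>x y. x \<^bold>\<in> w \<^bold>\<and> y \<^bold>\<in> S \<^bold>\<and> opair_fm z x y)" by simp
  from forces_exE_dense[OF this leq_refl[OF sc]]
  obtain t x' where t: "t \<sqsubseteq> s" "nm x'" "t \<tturnstile> (\<^bold>\<exists>y. x' \<^bold>\<in> w \<^bold>\<and> y \<^bold>\<in> S \<^bold>\<and> opair_fm z x' y)" .
  from forces_exE_dense[OF t(3) below_refl(1)[OF t(1)]]
  obtain u y' where u: "u \<sqsubseteq> t" "nm y'" "u \<tturnstile> (x' \<^bold>\<in> w \<^bold>\<and> y' \<^bold>\<in> S \<^bold>\<and> opair_fm z x' y')" .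
  have us: "u \<sqsubseteq> s" and uc: "u \<in> conds P" using leq_trans[OF u(1) t(1)] leq_conds[OF u(1)] by auto
  have uq: "u \<sqsubseteq> q" and up: "u \<sqsubseteq> p" using leq_trans[OF us sq] leq_trans[OF leq_trans[OF us sq] q(1)] by auto
  have "u \<tturnstile> (x \<^bold>= x')"
    using opair_inj(1)[of u z x C x' y'] forces_mono[OF s(3) us] u r(2) q(2) t(2) uc by simp
  moreover obtain v n where v: "v \<sqsubseteq> u" "v \<tturnstile> (x' \<^bold>= num n)"
    by (rule omega_memE[OF forces_mono[OF p(2) up] t(2) uc]) (use u(3) in simp)
  ultimately have "v \<tturnstile> (x \<^bold>= num n)" using eq_trans forces_mono by blast
  moreover have "v \<tturnstile> related_fm f x C"
    using forces_mono[OF r(3)] leq_trans[OF v(1) leq_trans[OF us s(1)]] by blast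
  ultimately have "v \<tturnstile> related_fm f (num n) C" using related_cong eq_refl by blast
  then have "v \<tturnstile> (C \<^bold>\<in> S \<^bold>\<and> related_fm f (num n) C \<^bold>\<and> \<sigma> \<^bold>\<in> C)"
    using forces_mono[OF q(3) leq_trans[OF v(1) uq]] by simp
  then have "v \<tturnstile> in_piece S f n \<sigma>" unfolding in_piece_def using q(2) by (rule forces_exI)
  then show thesis using that leq_trans[OF v(1) up] by blast
qed

text \<open>Since \<open>f\<close> is forced to be single-valued, every set that witnesses number
  \<open>n\<close> for some \<open>\<sigma> i\<close> equals the set chosen for
  \<open>\<sigma> 0\<close>.\<close>

lemma in_piece_same:
  assumes "centering Q L S w f p" "\<And>i. i < k \<Longrightarrow> nm (\<sigma> i)" "\<And>i. i < k \<Longrightarrow> p \<tturnstile> in_piece S f n (\<sigma> i)" "k > 0"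
  obtains q C where "q \<sqsubseteq> p" "nm C" "q \<tturnstile> (C \<^bold>\<in> S)" "\<And>i. i < k \<Longrightarrow> q \<tturnstile> (\<sigma> i \<^bold>\<in> C)"
proof -
  have p: "p \<in> conds P" "p \<tturnstile> onto_fm f w S" using assms(1) unfolding centering_def by auto
  from forces_exE_dense[OF assms(3)[OF assms(4), unfolded in_piece_def] leq_refl[OF p(1)]]
  obtain q C where q: "q \<sqsubseteq> p" "nm C" "q \<tturnstile> (C \<^bold>\<in> S \<^bold>\<and> related_fm f (num n) C \<^bold>\<and> \<sigma> 0 \<^bold>\<in> C)" .
  have "q \<tturnstile> (\<sigma> i \<^bold>\<in> C)" if i: "i < k" for i
  proof (rule forces_exE[OF forces_mono[OF assms(3)[OF i, unfolded in_piece_def] q(1)]])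
    fix r D assume r: "r \<sqsubseteq> q" "nm D" "r \<tturnstile> (D \<^bold>\<in> S \<^bold>\<and> related_fm f (num n) D \<^bold>\<and> \<sigma> i \<^bold>\<in> D)"
    have "r \<tturnstile> (\<^bold>\<forall>x y z. related_fm f x y \<^bold>\<and> related_fm f x z \<^bold>\<longrightarrow> y \<^bold>= z)"
      using forces_mono[OF p(2) leq_trans[OF r(1) q(1)]]
      unfolding onto_fm_def forces.simps(4) by blast
    then have "r \<tturnstile> (related_fm f (num n) D \<^bold>\<and> related_fm f (num n) C \<^bold>\<longrightarrow> D \<^bold>= C)"
      unfolding forces.simps(5) using nm_num r(2) q(2) by blast
    moreover have "r \<tturnstile> (related_fm f (num n) D \<^bold>\<and> related_fm f (num n) C)"
      using r(3) forces_mono[OF q(3) r(1)] by simp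
    ultimately have "r \<tturnstile> (D \<^bold>= C)" using forces_mp leq_conds[OF r(1)] by blast
    moreover have "r \<tturnstile> (\<sigma> i \<^bold>\<in> D)" using r(3) by simp
    ultimately show "r \<tturnstile> (\<sigma> i \<^bold>\<in> C)" using mem_eqR by blast
  qed
  moreover have "q \<tturnstile> (C \<^bold>\<in> S)" using q(3) by simp
  ultimately show thesis using that q(1,2) by blast
qed

text \<open>Zorn's lemma inside \<open>D\<close>. It will be applied to the conditions that carry a
  decomposition, which form a dense set.\<close>

lemma maximal_antichain:
  "\<exists>A\<subseteq>D. (\<forall>q\<in>A. \<forall>q'\<in>A. \<forall>r. r \<sqsubseteq> q \<longrightarrow> r \<sqsubseteq> q' \<longrightarrow> q = q') \<and>
     (\<forall>p\<in>D. p \<in> conds P \<longrightarrow> (\<exists>q\<in>A. \<exists>r. r \<sqsubseteq> q \<and> r \<sqsubseteq> p))"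
proof -
  define anti where "anti = {A. A \<subseteq> D \<and> (\<forall>q\<in>A. \<forall>q'\<in>A. \<forall>r. r \<sqsubseteq> q \<longrightarrow> r \<sqsubseteq> q' \<longrightarrow> q = q')}"
  have "\<exists>M\<in>anti. \<forall>X\<in>anti. M \<subseteq> X \<longrightarrow> X = M"
  proof (rule subset_Zorn')
    fix C assume C: "subset.chain anti C"
    then have sub: "C \<subseteq> anti" and lin: "\<And>A B. A \<in> C \<Longrightarrow> B \<in> C \<Longrightarrow> A \<subseteq> B \<or> B \<subseteq> A"
      unfolding subset.chain_def subset_chain_def by blast+
    show "\<Union> C \<in> anti"
      unfolding anti_def
    proof (intro CollectI conjI ballI allI impI)
      show "\<Union> C \<subseteq> D" using sub unfolding anti_def by blast
    next
      fix q q' r assume *: "q \<in> \<Union> C" "q' \<in> \<Union> C" "r \<sqsubseteq> q" "r \<sqsubseteq> q'"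
      then obtain A B where AB: "A \<in> C" "q \<in> A" "B \<in> C" "q' \<in> B" by blast
      then obtain E where "E \<in> C" "q \<in> E" "q' \<in> E" using lin[OF AB(1,3)] by blast
      then show "q = q'" using sub * unfolding anti_def by blast
    qed
  qed
  then obtain A where A: "A \<in> anti" "\<And>X. X \<in> anti \<Longrightarrow> A \<subseteq> X \<Longrightarrow> X = A" by blast
  have "\<exists>q\<in>A. \<exists>r. r \<sqsubseteq> q \<and> r \<sqsubseteq> p" if p: "p \<in> D" "p \<in> conds P" for p
  proof (rule ccontr)
    assume n: "\<not> ?thesis"
    then have n': "\<not> r \<sqsubseteq> p" if "q \<in> A" "r \<sqsubseteq> q" for q r using that by blast
    have A': "A \<subseteq> D" "\<And>q q' r. q \<in> A \<Longrightarrow> q' \<in> A \<Longrightarrow> r \<sqsubseteq> q \<Longrightarrow> r \<sqsubseteq> q' \<Longrightarrow> q = q'"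
      using A(1) unfolding anti_def by blast+
    have "q = q'" if "q \<in> insert p A" "q' \<in> insert p A" "r \<sqsubseteq> q" "r \<sqsubseteq> q'" for q q' r
      using that n' A'(2) by (metis insertE)
    then have "insert p A \<in> anti" using A'(1) p(1) unfolding anti_def by simp
    then have "p \<in> A" using A(2) by blast
    then show False using n leq_refl[OF p(2)] by blast
  qed
  then show ?thesis using A(1) unfolding anti_def by blast
qed

text \<open>Which piece of \<open>Q\<close> a name belongs to is measured by a decomposition that is chosen along a
  maximal antichain; compatible conditions thus refer to the same decomposition, and a natural
  number suffices as a label.\<close>

lemma ex_labelling:
  fixes Q L :: "('c, 'j) name"
  assumes "forced P (sigma_centered_fm Q L)"
  shows "\<exists>lab. labelling P Q L lab"
proof -
  define D where "D = {q. \<exists>S w f. centering Q L S w f q}"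
  obtain A where A_sub: "A \<subseteq> D"
    and A_anti: "\<forall>q\<in>A. \<forall>q'\<in>A. \<forall>r. r \<sqsubseteq> q \<longrightarrow> r \<sqsubseteq> q' \<longrightarrow> q = q'"
    and A_max: "\<forall>p\<in>D. p \<in> conds P \<longrightarrow> (\<exists>q\<in>A. \<exists>r. r \<sqsubseteq> q \<and> r \<sqsubseteq> p)"
    using maximal_antichain[of D] by (elim exE conjE)
  have "\<forall>q\<in>A. \<exists>S w f. centering Q L S w f q" using A_sub unfolding D_def by blast
  from bchoice[OF this] obtain S where "\<forall>q\<in>A. \<exists>w f. centering Q L (S q) w f q" by blast
  from bchoice[OF this] obtain w where "\<forall>q\<in>A. \<exists>f. centering Q L (S q) (w q) f q" by blast
  from bchoice[OF this] obtain f where c: "\<And>q. q \<in> A \<Longrightarrow> centering Q L (S q) (w q) (f q) q" by blast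
  define lab where "lab p \<sigma> n \<longleftrightarrow> (\<exists>q\<in>A. p \<sqsubseteq> q \<and> p \<tturnstile> in_piece (S q) (f q) n \<sigma>)" for p \<sigma> n
  have "labelling P Q L lab"
    unfolding labelling_def
  proof (intro conjI allI impI)
    fix p q \<sigma> n assume "lab p \<sigma> n" "q \<sqsubseteq> p"
    then show "lab q \<sigma> n" unfolding lab_def using leq_trans forces_mono by blast
  next
    fix p \<sigma> assume p: "p \<in> conds P" "nm \<sigma>" "p \<tturnstile> (\<sigma> \<^bold>\<in> Q)"
    \<comment> \<open>Maximality speaks only about members of \<open>D\<close>, so \<open>p\<close>
      is extended into \<open>D\<close> before a compatible element of \<open>A\<close> is
      taken.\<close>
    obtain p' S' w' f' where p': "p' \<sqsubseteq> p" "centering Q L S' w' f' p'"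
      using centering_dense[OF assms p(1)] .
    then obtain q r where q: "q \<in> A" "r \<sqsubseteq> q" "r \<sqsubseteq> p'"
      using A_max[unfolded D_def] leq_conds[OF p'(1)] by blast
    have rp: "r \<sqsubseteq> p" using leq_trans[OF q(3) p'(1)] .
    obtain s n where "s \<sqsubseteq> r" "s \<tturnstile> in_piece (S q) (f q) n \<sigma>"
      using in_piece_dense[OF centering_mono[OF c[OF q(1)] q(2)] p(2) forces_mono[OF p(3) rp]] .
    then show "\<exists>q n. q \<sqsubseteq> p \<and> lab q \<sigma> n"
      unfolding lab_def using leq_trans[OF _ rp] leq_trans[OF _ q(2)] q(1) by blast
  next
    fix p and k :: nat and \<sigma> n
    assume "0 < k" "\<forall>i<k. nm (\<sigma> i) \<and> lab p (\<sigma> i) n"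
    then have k: "0 < k" "\<And>i. i < k \<Longrightarrow> nm (\<sigma> i)" "\<And>i. i < k \<Longrightarrow> lab p (\<sigma> i) n" by blast+
    from k(3)[OF k(1)] obtain q where q: "q \<in> A" "p \<sqsubseteq> q" unfolding lab_def by blast
    have ip: "p \<tturnstile> in_piece (S q) (f q) n (\<sigma> i)" if i: "i < k" for i
    proof -
      obtain q' where q': "q' \<in> A" "p \<sqsubseteq> q'" "p \<tturnstile> in_piece (S q') (f q') n (\<sigma> i)"
        using k(3)[OF i] unfolding lab_def by blast
      then show ?thesis using A_anti[rule_format, OF q(1) q'(1) q(2) q'(2)] by simp
    qed
    obtain r C where r: "r \<sqsubseteq> p" "nm C" "r \<tturnstile> (C \<^bold>\<in> S q)" "\<And>i. i < k \<Longrightarrow> r \<tturnstile> (\<sigma> i \<^bold>\<in> C)"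
      by (rule in_piece_same[of Q L "S q" "w q" "f q" p k \<sigma> n])
        (use centering_mono[OF c[OF q(1)] q(2)] k(1,2) ip in blast)+
    have cr: "centering Q L (S q) (w q) (f q) r" using centering_mono[OF centering_mono[OF c[OF q(1)] q(2)] r(1)] .
    then have "r \<tturnstile> (C \<^bold>\<in> S q \<^bold>\<longrightarrow> C \<^bold>\<subseteq> Q \<^bold>\<and> centered_fm Q L C)"
      unfolding centering_def forces.simps(4) using forces_allD[OF _ r(2)] by blast
    from forces_mp[OF this r(3)] have "r \<tturnstile> centered_fm Q L C" using leq_conds[OF r(1)] by simp
    moreover have "r \<tturnstile> omega_fm (w q)" "nm (w q)" using cr unfolding centering_def by auto
    ultimately obtain s \<tau> where s: "s \<sqsubseteq> r" "\<tau> \<in> snd ` pairs Q" "s \<tturnstile> (\<tau> \<^bold>\<in> Q)"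
       "\<And>i. i < k \<Longrightarrow> s \<tturnstile> related_fm L \<tau> (\<sigma> i)"
      using centered_lower_bound[of r Q L C "w q" k \<sigma>] leq_conds[OF r(1)] k(2) r(4) by metis
    then show "\<exists>q \<tau>. q \<sqsubseteq> p \<and> \<tau> \<in> snd ` pairs Q \<and> q \<tturnstile> (\<tau> \<^bold>\<in> Q) \<and> (\<forall>i<k. q \<tturnstile> related_fm L \<tau> (\<sigma> i))"
      using leq_trans[OF _ r(1)] by blast
  qed
  then show ?thesis by blast
qed

end

section \<open>Fubini powers of a saturated normal ideal\<close>

text \<open>A cardinal smaller than a well-order is isomorphic to a proper initial segment of it.
  This makes functions with few values regressive from some point on.\<close>

lemma small_imp_below:
  includes cardinal_syntax
  fixes V :: "'a set"
  assumes "V \<prec> (UNIV :: 'k::wellorder set)"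
  shows "\<exists>\<delta> :: 'k. \<exists>e. inj_on e V \<and> e ` V \<subseteq> {..<\<delta>}"
proof -
  let ?r = "{(x, y). x \<le> (y :: 'k)}"
  have fld: "Field ?r = UNIV" by (auto simp: Field_def)
  have "wf (?r - Id)"
    by (rule wf_subset[OF wf]) auto
  then have wo: "well_order_on UNIV ?r"
    by (auto simp: well_order_on_def linear_order_on_def partial_order_on_def preorder_on_def
        refl_on_def trans_def antisym_def total_on_def)
  have "\<not> (\<exists>f. inj_on f (UNIV :: 'k set) \<and> f ` UNIV \<subseteq> V)"
    using assms lepoll_antisym unfolding lesspoll_def lepoll_def[of UNIV V, symmetric] by blast
  then have "|V| <o |UNIV :: 'k set|" using card_of_ordLess[of "UNIV :: 'k set" V] by blast
  also have "|UNIV :: 'k set| \<le>o ?r" by (rule card_of_least[OF wo])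
  finally have "|V| <o ?r" .
  then obtain a where "|V| =o Restr ?r (underS ?r a)"
    using ordLess_iff_ordIso_Restr[of ?r "|V|"] wo fld card_of_Well_order by fastforce
  then obtain f where "iso |V| (Restr ?r (underS ?r a)) f"
    unfolding ordIso_def by blast
  then have "inj_on f V" "f ` V = Field (Restr ?r (underS ?r a))"
    unfolding iso_def by (auto simp: bij_betw_def Field_card_of)
  moreover have "Field (Restr ?r (underS ?r a)) \<subseteq> {..<a}"
    by (auto simp: Field_def underS_def)
  ultimately show ?thesis by blast
qed

text \<open>Provides codes in \<kappa> for pairs of a tuple and a position, which index the points
  of the ultrapower used below.\<close>

lemma prod_list_lepoll:
  includes cardinal_syntax
  assumes "infinite (UNIV :: 'a set)"
  shows "(UNIV :: ('a list \<times> nat) set) \<lesssim> (UNIV :: 'a set)"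
proof -
  have "infinite (Field |UNIV :: 'a set| )" using assms by (simp add: Field_card_of)
  note times = card_of_Times_ordLeq_infinite_Field[OF this _ _ card_of_Card_order]
  have "card_of {xs :: 'a list. length xs = n} \<le>o |UNIV :: 'a set|" for n
  proof (induction n)
    case 0
    have "{xs :: 'a list. length xs = 0} = {[]}" by auto
    then show ?case using assms card_of_ordLeq_finite card_of_ordLeq_infinite
      by (metis card_of_mono1 card_of_singl_ordLeq empty_not_UNIV)
  next
    case (Suc n)
    have "{xs :: 'a list. length xs = Suc n} = (\<lambda>(x, xs). x # xs) ` (UNIV \<times> {xs. length xs = n})"
      by (auto simp: length_Suc_conv image_iff)
    then have "card_of {xs :: 'a list. length xs = Suc n} \<le>o card_of ((UNIV :: 'a set) \<times> {xs :: 'a list. length xs = n})"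
      by (metis card_of_image)
    also have "card_of ((UNIV :: 'a set) \<times> {xs :: 'a list. length xs = n}) \<le>o |UNIV :: 'a set|"
      by (rule times[OF card_of_mono1[OF subset_refl] Suc])
    finally show ?case .
  qed
  moreover have nat: "|UNIV :: nat set| \<le>o |UNIV :: 'a set|"
    using assms infinite_iff_card_of_nat by blast
  ultimately have "card_of (\<Union>n. {xs :: 'a list. length xs = n}) \<le>o |UNIV :: 'a set|"
    by (intro card_of_UNION_ordLeq_infinite[OF assms]) auto
  moreover have "(\<Union>n. {xs :: 'a list. length xs = n}) = UNIV" by auto
  ultimately have "card_of ((UNIV :: 'a list set) \<times> (UNIV :: nat set)) \<le>o |UNIV :: 'a set|"
    using times[OF _ nat] by metis
  then show ?thesis by (auto simp: card_of_ordLeq[symmetric] lepoll_def)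
qed

section \<open>Finite partial functions and similar tuples\<close>

definition agree :: "('a \<rightharpoonup> 'b) \<Rightarrow> ('a \<rightharpoonup> 'b) \<Rightarrow> bool" where
  "agree f g \<longleftrightarrow> (\<forall>x u v. f x = Some u \<longrightarrow> g x = Some v \<longrightarrow> u = v)"

text \<open>The increasing enumeration of the domain separates \<open>f\<close> into a list of
  ordinals and the word \<open>vals f\<close>. There are only countably many words of naturals, so
  completeness can fix the word while the points still vary.\<close>

definition pts :: "('a::linorder \<rightharpoonup> 'b) \<Rightarrow> 'a list" where
  "pts f = sorted_list_of_set (dom f)"

definition vals :: "('a::linorder \<rightharpoonup> 'b) \<Rightarrow> 'b list" where
  "vals f = map (the \<circ> f) (pts f)"

lemma pts: "finite (dom f) \<Longrightarrow> set (pts f) = dom f" "distinct (pts f)"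
  by (simp_all add: pts_def)

lemma length_vals [simp]: "length (vals f) = length (pts f)"
  by (simp add: vals_def)

lemma nth_pts: "finite (dom f) \<Longrightarrow> i < length (pts f) \<Longrightarrow> f (pts f ! i) = Some (vals f ! i)"
  using nth_mem[of i "pts f"] by (auto simp: vals_def pts)

lemma nth_ptsE:
  assumes "finite (dom f)" "f x = Some u"
  obtains i where "i < length (pts f)" "x = pts f ! i" "u = vals f ! i"
proof -
  have "x \<in> set (pts f)" using assms pts(1) by blast
  then obtain i where "i < length (pts f)" "pts f ! i = x" by (metis in_set_conv_nth)
  then show thesis using that assms nth_pts by (metis option.inject)
qed

lemma pts_vals_inject:
  assumes "finite (dom f)" "finite (dom g)" "pts f = pts g" "vals f = vals g"
  shows "f = g"
proof
  fix x show "f x = g x"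
  proof (cases "x \<in> dom f")
    case True
    then obtain u where u: "f x = Some u" by blast
    then show ?thesis using nth_ptsE[OF assms(1) u] nth_pts[OF assms(2)] assms(3,4) by metis
  next
    case False
    then show ?thesis using assms pts(1) by (metis domIff)
  qed
qed

lemma similar_sym:
  assumes "a \<simeq> b"
  shows "b \<simeq> a"
proof -
  obtain h where h: "bij_betw h (set a) (set b)" "strict_mono_on (set a) h" "\<forall>x\<in>set a \<inter> set b. h x = x"
    using assms unfolding similar_def by blast
  then have inj: "inj_on h (set a)" and im: "h ` set a = set b" by (simp_all only: bij_betw_def)
  let ?g = "inv_into (set a) h"
  have "bij_betw ?g (set b) (set a)" using h(1) by (rule bij_betw_inv_into)
  moreover have "strict_mono_on (set b) ?g"
  proof (rule strict_mono_onI)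
    fix r s assume rs: "r \<in> set b" "s \<in> set b" "r < s"
    have g: "?g r \<in> set a" "?g s \<in> set a" "h (?g r) = r" "h (?g s) = s"
      using rs im by (simp_all add: inv_into_into f_inv_into_f)
    show "?g r < ?g s"
    proof (rule ccontr)
      assume "\<not> ?g r < ?g s"
      then consider "?g s = ?g r" | "?g s < ?g r" by fastforce
      then show False
      proof cases
        case 1
        then have "h (?g s) = h (?g r)" by simp
        then show False using g(3,4) rs(3) by simp
      next
        case 2
        then have "h (?g s) < h (?g r)" using h(2) g(1,2) by (simp add: strict_mono_onD)
        then show False using g(3,4) rs(3) by simp
      qed
    qed
  qed
  moreover have "?g x = x" if "x \<in> set b \<inter> set a" for x
    using inv_into_f_f[OF inj, of x] h(3) that by simp
  ultimately show ?thesis unfolding similar_def by blast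
qed

text \<open>An order isomorphism takes the last element to the last element, so it restricts to the
  initial parts. If \<beta> also occurs in the second tuple, it is fixed, although its image is
  \<beta>'.\<close>

lemma similar_snoc:
  assumes "c @ [\<beta>] \<in> tuples (Suc n)" "c' @ [\<beta>'] \<in> tuples (Suc n)" "c @ [\<beta>] \<simeq> c' @ [\<beta>']"
  shows "c \<simeq> c'" "\<beta> \<in> set (c' @ [\<beta>']) \<Longrightarrow> \<beta>' = \<beta>"
proof -
  let ?a = "set (c @ [\<beta>])" and ?b = "set (c' @ [\<beta>'])"
  obtain h where h: "bij_betw h ?a ?b" "strict_mono_on ?a h" "\<forall>x \<in> ?a \<inter> ?b. h x = x"
    using assms(3) unfolding similar_def by blast
  have c: "\<forall>x\<in>set c. x < \<beta>" "\<forall>x\<in>set c'. x < \<beta>'"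
    using assms(1,2) by (auto simp: tuples_def sorted_wrt_append)
  have "h ` ?a = ?b" using h(1) by (simp only: bij_betw_def)
  then obtain x where x: "x \<in> ?a" "h x = \<beta>'" by (metis imageE in_set_conv_decomp)
  have "h \<beta> \<in> ?b" using \<open>h ` ?a = ?b\<close> by auto
  then have "h \<beta> \<le> \<beta>'" using c(2) by auto
  moreover have "\<beta>' \<le> h \<beta>"
  proof (cases "x = \<beta>")
    case False
    then have "x < \<beta>" using x(1) c(1) by auto
    then show ?thesis using h(2) x unfolding strict_mono_on_def by fastforce
  qed (use x in simp)
  ultimately have hb: "h \<beta> = \<beta>'" by simp
  then show "\<beta> \<in> ?b \<Longrightarrow> \<beta>' = \<beta>" using h(3) by auto
  have "\<beta> \<notin> set c" "\<beta>' \<notin> set c'" using c by auto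
  then have "set c = ?a - {\<beta>}" "set c' = ?b - {\<beta>'}" by auto
  moreover have "h ` (?a - {\<beta>}) = ?b - {\<beta>'}"
    using h(1) hb inj_on_image_set_diff[of h ?a ?a "{\<beta>}"] by (auto simp: bij_betw_def)
  ultimately have "bij_betw h (set c) (set c')"
    using h(1) unfolding bij_betw_def by (metis Diff_subset inj_on_subset)
  moreover have "strict_mono_on (set c) h" using h(2) unfolding strict_mono_on_def by auto
  ultimately show "c \<simeq> c'" unfolding similar_def using h(3) by auto
qed

section \<open>Completeness and normality of the ideal\<close>

locale saturated_normal_ideal =
  fixes J :: "'k::wellorder set set" and \<gamma> :: 'k
  assumes card: "is_cardinal TYPE('k)"
    and uniform: "uniform_ideal J" and normal: "normal_ideal J" and saturated: "saturated_ideal \<gamma> J"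
begin

lemma ideal_subset: "B \<in> J \<Longrightarrow> A \<subseteq> B \<Longrightarrow> A \<in> J"
  and ideal_Un: "A \<in> J \<Longrightarrow> B \<in> J \<Longrightarrow> A \<union> B \<in> J"
  and UNIV_not_ideal: "UNIV \<notin> J"
  and ideal_small: "A \<prec> (UNIV :: 'k set) \<Longrightarrow> A \<in> J"
  using uniform unfolding uniform_ideal_def by blast+

lemma positive_Diff: "A \<notin> J \<Longrightarrow> B \<in> J \<Longrightarrow> A - B \<notin> J"
  using ideal_subset[of "(A - B) \<union> B" A] ideal_Un[of "A - B" B] by blast

lemma small_lessThan: "{..<\<alpha> :: 'k} \<prec> (UNIV :: 'k set)"
  using card unfolding is_cardinal_def by blast

lemma singleton_ideal: "{x} \<in> J"
proof -
  \<comment> \<open>Saturation for the constant family \<open>UNIV\<close> yields two different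
    ordinals; hence singletons are smaller than \<kappa>.\<close>
  obtain i j :: 'k where ij: "i < j"
    using saturated UNIV_not_ideal unfolding saturated_ideal_def by (metis (no_types))
  have "\<not> (UNIV :: 'k set) \<lesssim> {x}"
  proof
    assume "(UNIV :: 'k set) \<lesssim> {x}"
    then obtain f :: "'k \<Rightarrow> 'k" where f: "inj f" "range f \<subseteq> {x}" unfolding lepoll_def by blast
    have "f i = x" "f j = x" using f(2) by blast+
    then have "f i = f j" by simp
    then have "i = j" by (rule injD[OF f(1)])
    then show False using ij by simp
  qed
  moreover have "{x} \<lesssim> (UNIV :: 'k set)" by (simp add: subset_imp_lepoll)
  ultimately have "{x} \<prec> (UNIV :: 'k set)" unfolding lesspoll_def using eqpoll_imp_lepoll eqpoll_sym by blast
  then show ?thesis by (rule ideal_small)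
qed

lemma atMost_ideal: "{..\<alpha>} \<in> J"
  using ideal_Un[OF ideal_small[OF small_lessThan[of \<alpha>]] singleton_ideal[of \<alpha>]]
  by (metis ivl_disj_un_singleton(2))

lemma positive_nonempty: "X \<notin> J \<Longrightarrow> \<exists>x. x \<in> X"
  using ideal_subset[OF singleton_ideal, of "{}"] by (metis empty_subsetI equals0I)

lemma finite_UN_ideal: "finite F \<Longrightarrow> (\<And>x. x \<in> F \<Longrightarrow> A x \<in> J) \<Longrightarrow> (\<Union>x\<in>F. A x) \<in> J"
proof (induction F rule: finite_induct)
  case empty
  then show ?case using ideal_subset[OF singleton_ideal] by auto
qed (auto intro: ideal_Un)

lemma regressive:
  assumes "X \<notin> J" "\<And>\<alpha>. \<alpha> \<in> X \<Longrightarrow> f \<alpha> < \<alpha>"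
  obtains \<xi> where "{\<alpha>\<in>X. f \<alpha> = \<xi>} \<notin> J"
proof -
  obtain Y \<xi> where "Y \<subseteq> X" "Y \<notin> J" "\<forall>\<alpha>\<in>Y. f \<alpha> = \<xi>"
    using normal[unfolded normal_ideal_def, rule_format, OF conjI[OF assms(1) ballI[OF assms(2)]]] by blast
  then have "{\<alpha>\<in>X. f \<alpha> = \<xi>} \<notin> J" using ideal_subset[of "{\<alpha>\<in>X. f \<alpha> = \<xi>}" Y] by blast
  then show thesis by (rule that)
qed

text \<open>If all initial segments were finite, the predecessor map would be regressive and
  injective off the least element, and normality would make a set with at most one element
  positive.\<close>

lemma uncountable: "(UNIV :: nat set) \<prec> (UNIV :: 'k set)"
proof -
  have "\<exists>\<alpha>::'k. infinite {..<\<alpha>}"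
  proof (rule ccontr)
    assume "\<not> ?thesis"
    then have fin: "finite {..<\<alpha>}" for \<alpha> :: 'k by blast
    define X where "X = {\<alpha>::'k. {..<\<alpha>} \<noteq> {}}"
    have "UNIV - {LEAST x::'k. True} \<subseteq> X"
    proof
      fix \<alpha> :: 'k assume "\<alpha> \<in> UNIV - {LEAST x::'k. True}"
      moreover have "(LEAST x::'k. True) \<le> \<alpha>" by (rule Least_le) simp
      ultimately show "\<alpha> \<in> X" unfolding X_def by (auto simp: order.strict_iff_order)
    qed
    then have "X \<notin> J"
      using positive_Diff[OF UNIV_not_ideal singleton_ideal] ideal_subset by blast
    moreover have mx: "Max {..<\<alpha>} < \<alpha>" if "\<alpha> \<in> X" for \<alpha>
      using Max_in[OF fin[of \<alpha>]] that unfolding X_def by auto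
    ultimately obtain \<xi> where xi: "{\<alpha>\<in>X. Max {..<\<alpha>} = \<xi>} \<notin> J"
      by (rule regressive[of X "\<lambda>\<alpha>. Max {..<\<alpha>}"])
    have "\<alpha> = \<alpha>'" if "\<alpha> \<in> {\<alpha>\<in>X. Max {..<\<alpha>} = \<xi>}" "\<alpha>' \<in> {\<alpha>\<in>X. Max {..<\<alpha>} = \<xi>}" for \<alpha> \<alpha>'
    proof -
      have *: False if "\<alpha> < \<alpha>'" "\<alpha> \<in> X" "\<alpha>' \<in> X" "Max {..<\<alpha>} = Max {..<\<alpha>'}" for \<alpha> \<alpha>'
        using Max_ge[OF fin[of \<alpha>'], of \<alpha>] mx[of \<alpha>] that by auto
      show ?thesis using *[of \<alpha> \<alpha>'] *[of \<alpha>' \<alpha>] that by (cases \<alpha> \<alpha>' rule: linorder_cases) auto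
    qed
    then have "\<exists>x. {\<alpha>\<in>X. Max {..<\<alpha>} = \<xi>} \<subseteq> {x}" by blast
    then show False using xi singleton_ideal ideal_subset by blast
  qed
  then obtain \<alpha> :: 'k where "infinite {..<\<alpha>}" by blast
  then have "(UNIV :: nat set) \<lesssim> {..<\<alpha>}" by (simp add: infinite_le_lepoll)
  then show ?thesis using small_lessThan lesspoll_trans1 by blast
qed

lemma infinite_UNIV: "infinite (UNIV :: 'k set)"
  using uncountable infinite_le_lepoll lesspoll_imp_lepoll by blast

lemma small_countable: "countable A \<Longrightarrow> A \<prec> (UNIV :: 'k set)"
  using lesspoll_trans1[OF _ uncountable, of A] unfolding countable_def lepoll_def by blast

text \<open>\<kappa>-completeness as a pigeonhole principle: with \<open>V\<close> embedded below
  some \<delta>, the map is regressive beyond \<delta>, and an initial segment is null.\<close>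

lemma complete:
  assumes "V \<prec> (UNIV :: 'k set)" "X \<notin> J" "\<And>\<alpha>. \<alpha> \<in> X \<Longrightarrow> v \<alpha> \<in> V"
  obtains c where "c \<in> V" "{\<alpha>\<in>X. v \<alpha> = c} \<notin> J"
proof -
  obtain \<delta> e where e: "inj_on e V" "e ` V \<subseteq> {..<\<delta> :: 'k}" using small_imp_below[OF assms(1)] by blast
  have "X - {..\<delta>} \<notin> J" using positive_Diff[OF assms(2) atMost_ideal] .
  moreover have "e (v \<alpha>) < \<alpha>" if "\<alpha> \<in> X - {..\<delta>}" for \<alpha>
    using e(2) assms(3)[of \<alpha>] that by fastforce
  ultimately obtain \<xi> where xi: "{\<alpha>\<in>X - {..\<delta>}. e (v \<alpha>) = \<xi>} \<notin> J"
    by (rule regressive[of "X - {..\<delta>}" "\<lambda>\<alpha>. e (v \<alpha>)"])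
  then obtain \<alpha> where \<alpha>: "\<alpha> \<in> X" "e (v \<alpha>) = \<xi>" using positive_nonempty by blast
  have "{\<alpha>\<in>X - {..\<delta>}. e (v \<alpha>) = \<xi>} \<subseteq> {\<beta>\<in>X. v \<beta> = v \<alpha>}"
  proof
    fix \<beta> assume "\<beta> \<in> {\<alpha>\<in>X - {..\<delta>}. e (v \<alpha>) = \<xi>}"
    then have "\<beta> \<in> X" "e (v \<beta>) = e (v \<alpha>)" using \<alpha>(2) by simp_all
    then show "\<beta> \<in> {\<beta>\<in>X. v \<beta> = v \<alpha>}" using inj_onD[OF e(1)] assms(3) \<alpha>(1) by simp
  qed
  then show thesis using that[of "v \<alpha>"] assms(3) \<alpha>(1) xi ideal_subset by blast
qed

text \<open>Completeness fixes the length, and normality fixes the entries one after the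
  other.\<close>

lemma regressive_list:
  assumes "Z \<notin> J" "\<And>\<beta>. \<beta> \<in> Z \<Longrightarrow> set (g \<beta>) \<subseteq> {..<\<beta>}"
  obtains c where "{\<beta>\<in>Z. g \<beta> = c} \<notin> J"
proof -
  obtain n where n: "{\<beta>\<in>Z. length (g \<beta>) = n} \<notin> J"
    using complete[OF uncountable assms(1), of "\<lambda>\<beta>. length (g \<beta>)"] by auto
  have "\<exists>c. {\<beta>\<in>Z. g \<beta> = c} \<notin> J" if "Z \<notin> J" "\<And>\<beta>. \<beta> \<in> Z \<Longrightarrow> set (g \<beta>) \<subseteq> {..<\<beta>} \<and> length (g \<beta>) = n"
    for Z and g :: "'k \<Rightarrow> 'k list"
    using that
  proof (induction n arbitrary: Z g)
    case 0
    then have "{\<beta>\<in>Z. g \<beta> = []} = Z" by auto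
    then show ?case using 0(1) by metis
  next
    case (Suc n)
    have ne: "g \<beta> \<noteq> []" if "\<beta> \<in> Z" for \<beta> using Suc.prems(2)[OF that] by auto
    have "hd (g \<beta>) < \<beta>" if "\<beta> \<in> Z" for \<beta>
      using Suc.prems(2)[OF that] hd_in_set[OF ne[OF that]] by auto
    then obtain \<xi> where "{\<beta>\<in>Z. hd (g \<beta>) = \<xi>} \<notin> J"
      by (rule regressive[OF Suc.prems(1), of "\<lambda>\<beta>. hd (g \<beta>)"])
    moreover have "set (tl (g \<beta>)) \<subseteq> {..<\<beta>} \<and> length (tl (g \<beta>)) = n" if "\<beta> \<in> {\<beta>\<in>Z. hd (g \<beta>) = \<xi>}" for \<beta>
      using Suc.prems(2)[of \<beta>] that list.set_sel(2)[OF ne[of \<beta>]] by (auto simp: subset_iff)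
    ultimately obtain c where c: "{\<beta>\<in>{\<beta>\<in>Z. hd (g \<beta>) = \<xi>}. tl (g \<beta>) = c} \<notin> J"
      using Suc.IH[of "{\<beta>\<in>Z. hd (g \<beta>) = \<xi>}" "\<lambda>\<beta>. tl (g \<beta>)"] by blast
    have "{\<beta>\<in>{\<beta>\<in>Z. hd (g \<beta>) = \<xi>}. tl (g \<beta>) = c} \<subseteq> {\<beta>\<in>Z. g \<beta> = \<xi> # c}"
      using ne by force
    then show ?case using c ideal_subset by blast
  qed
  from this[of "{\<beta>\<in>Z. length (g \<beta>) = n}" g] n assms(2)
  obtain c where c: "{\<beta>\<in>{\<beta>\<in>Z. length (g \<beta>) = n}. g \<beta> = c} \<notin> J" by blast
  have "{\<beta>\<in>{\<beta>\<in>Z. length (g \<beta>) = n}. g \<beta> = c} \<subseteq> {\<beta>\<in>Z. g \<beta> = c}" by blast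
  then show thesis using that c ideal_subset by blast
qed

text \<open>The domain is a list below \<beta> and falls to normality, the word of values falls to
  completeness, and the two determine the map.\<close>

lemma regressive_map:
  fixes h :: "'k \<Rightarrow> 'k \<rightharpoonup> nat"
  assumes "Z \<notin> J" "\<And>\<beta>. \<beta> \<in> Z \<Longrightarrow> finite (dom (h \<beta>)) \<and> dom (h \<beta>) \<subseteq> {..<\<beta>}"
  obtains e where "{\<beta>\<in>Z. h \<beta> = e} \<notin> J"
proof -
  have "\<And>\<beta>. \<beta> \<in> Z \<Longrightarrow> set (pts (h \<beta>)) \<subseteq> {..<\<beta>}" using assms(2) pts(1) by blast
  with assms(1) obtain c where c: "{\<beta>\<in>Z. pts (h \<beta>) = c} \<notin> J" by (rule regressive_list)
  obtain d where d: "{\<beta>\<in>{\<beta>\<in>Z. pts (h \<beta>) = c}. vals (h \<beta>) = d} \<notin> J"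
    by (rule complete[OF small_countable[of "UNIV :: nat list set"] c, of "\<lambda>\<beta>. vals (h \<beta>)"]) auto
  let ?Z = "{\<beta>\<in>{\<beta>\<in>Z. pts (h \<beta>) = c}. vals (h \<beta>) = d}"
  obtain \<beta> where b: "\<beta> \<in> ?Z" using d positive_nonempty by blast
  have "?Z \<subseteq> {\<alpha>\<in>Z. h \<alpha> = h \<beta>}"
    using b assms(2) by (auto intro: pts_vals_inject)
  then show thesis using that d ideal_subset by blast
qed

subsection \<open>Positive sets of tuples\<close>

abbreviation pos :: "nat \<Rightarrow> 'k list set set" where "pos \<equiv> fubini_positive J"

lemma tuples_0: "tuples 0 = {[] :: 'k list}"
  by (auto simp: tuples_def)

lemma pos_0: "X \<in> pos 0 \<longleftrightarrow> X = {[]}"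
  by (auto simp: fubini_positive_def tuples_def)

text \<open>\<open>fubini_power\<close> treats exponent 1 separately and recurses from 2 on; phrased
  for positive sets, one clause covers every successor.\<close>

lemma pos_Cons:
  "X \<in> pos (Suc n) \<longleftrightarrow> X \<subseteq> tuples (Suc n) \<and> {\<alpha>. {b \<in> tuples n. \<alpha> # b \<in> X} \<in> pos n} \<notin> J"
proof (cases n)
  case 0
  have "(X \<in> fubini_power J 1) = ({\<alpha>. [\<alpha>] \<in> X} \<in> J)" if "X \<subseteq> tuples 1"
  proof -
    have X: "X = (\<lambda>\<alpha>. [\<alpha>]) ` {\<alpha>. [\<alpha>] \<in> X}" using that by (auto simp: tuples_def length_Suc_conv)
    show ?thesis
    proof
      assume "X \<in> fubini_power J 1"
      then obtain A where "X = (\<lambda>\<alpha>. [\<alpha>]) ` A" "A \<in> J" by auto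
      moreover from this(1) have "{\<alpha>. [\<alpha>] \<in> X} = A" by auto
      ultimately show "{\<alpha>. [\<alpha>] \<in> X} \<in> J" by simp
    next
      assume "{\<alpha>. [\<alpha>] \<in> X} \<in> J"
      then show "X \<in> fubini_power J 1" using X by auto
    qed
  qed
  moreover have "{b \<in> tuples 0. \<alpha> # b \<in> X} \<in> pos 0 \<longleftrightarrow> [\<alpha>] \<in> X" for \<alpha>
    unfolding pos_0 tuples_0 by auto
  ultimately show ?thesis using 0 by (auto simp: fubini_positive_def)
next
  case (Suc m)
  have "{b \<in> tuples (Suc m). \<alpha> # b \<in> X} \<in> pos (Suc m) \<longleftrightarrow>
      {b \<in> tuples (Suc m). \<alpha> # b \<in> X} \<notin> fubini_power J (Suc m)" for \<alpha>
    by (auto simp: fubini_positive_def)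
  then have "{\<alpha>. {b \<in> tuples (Suc m). \<alpha> # b \<in> X} \<in> pos (Suc m)} =
      - {\<alpha>. {b \<in> tuples (Suc m). \<alpha> # b \<in> X} \<in> fubini_power J (Suc m)}" by auto
  then show ?thesis using Suc by (auto simp: fubini_positive_def dual_filter_def)
qed

text \<open>Fubini products are associative. The definition peels off the first coordinate, whereas
  the arguments below peel off the last one: it lies above the rest of the tuple, so normality can
  be applied to it.\<close>

lemma pos_snoc:
  "X \<in> pos (Suc n) \<longleftrightarrow> X \<subseteq> tuples (Suc n) \<and> {c \<in> tuples n. {\<beta>. c @ [\<beta>] \<in> X} \<notin> J} \<in> pos n"
proof (induction n arbitrary: X)
  case 0
  have *: "{b \<in> tuples 0. Q b} \<in> pos 0 \<longleftrightarrow> Q []" for Q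
    unfolding pos_0 tuples_0 by auto
  have "{b \<in> tuples 0. \<alpha> # b \<in> X} \<in> pos 0 \<longleftrightarrow> [\<alpha>] \<in> X" for \<alpha>
    by (rule *)
  moreover have "{c \<in> tuples 0. {\<beta>. c @ [\<beta>] \<in> X} \<notin> J} \<in> pos 0 \<longleftrightarrow> {\<beta>. [\<beta>] \<in> X} \<notin> J"
    unfolding * by simp
  ultimately show ?case unfolding pos_Cons[of X 0] by simp
next
  case (Suc n)
  show ?case
  proof (cases "X \<subseteq> tuples (Suc (Suc n))")
    case True
    let ?S = "{c \<in> tuples (Suc n). {\<beta>. c @ [\<beta>] \<in> X} \<notin> J}"
    have ne: "\<exists>\<beta>. c @ [\<beta>] \<in> X" if "{\<beta>. c @ [\<beta>] \<in> X} \<notin> J" for c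
      using positive_nonempty[OF that] by blast
    have "{b \<in> tuples (Suc n). \<alpha> # b \<in> X} \<in> pos (Suc n) \<longleftrightarrow> {c \<in> tuples n. \<alpha> # c \<in> ?S} \<in> pos n" for \<alpha>
    proof -
      have "{\<beta>. c @ [\<beta>] \<in> {b \<in> tuples (Suc n). \<alpha> # b \<in> X}} = {\<beta>. \<alpha> # c @ [\<beta>] \<in> X}" for c
        using True by (auto simp: tuples_def)
      \<comment> \<open>The list is increasing because a positive section is nonempty, so some
        prolongation of it lies in \<open>X\<close>.\<close>
      moreover have "\<alpha> # c \<in> tuples (Suc n)" if "{\<beta>. (\<alpha> # c) @ [\<beta>] \<in> X} \<notin> J" for c
        using ne[OF that] True by (fastforce simp: tuples_def sorted_wrt_append)
      ultimately have "{c \<in> tuples n. {\<beta>. c @ [\<beta>] \<in> {b \<in> tuples (Suc n). \<alpha> # b \<in> X}} \<notin> J}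
          = {c \<in> tuples n. \<alpha> # c \<in> ?S}" by auto
      then show ?thesis unfolding Suc.IH[of "{b \<in> tuples (Suc n). \<alpha> # b \<in> X}"] by auto
    qed
    then show ?thesis unfolding pos_Cons[of X] pos_Cons[of ?S] using True by auto
  qed (auto simp: fubini_positive_def)
qed

lemma pos_tuples: "X \<in> pos n \<Longrightarrow> X \<subseteq> tuples n"
  by (simp add: fubini_positive_def)

lemma pos_mono: "X \<in> pos n \<Longrightarrow> X \<subseteq> Y \<Longrightarrow> Y \<subseteq> tuples n \<Longrightarrow> Y \<in> pos n"
proof (induction n arbitrary: X Y)
  case 0
  then show ?case unfolding pos_0 by (auto simp: tuples_def)
next
  case (Suc n)
  have "{c \<in> tuples n. {\<beta>. c @ [\<beta>] \<in> X} \<notin> J} \<subseteq> {c \<in> tuples n. {\<beta>. c @ [\<beta>] \<in> Y} \<notin> J}"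
    using Suc.prems(2) ideal_subset by (auto intro: ideal_subset)
  then show ?case using Suc.IH Suc.prems unfolding pos_snoc by blast
qed

lemma pos_nonempty: "X \<in> pos n \<Longrightarrow> X \<noteq> {}"
proof (induction n arbitrary: X)
  case (Suc n)
  show ?case
  proof
    assume "X = {}"
    then have "{c \<in> tuples n. {\<beta>. c @ [\<beta>] \<in> X} \<notin> J} = {}"
      using ideal_subset[OF singleton_ideal] by auto
    then show False using Suc unfolding pos_snoc by blast
  qed
qed (simp add: pos_0)

text \<open>For each \<open>c\<close>, completeness of \<open>J\<close> picks a value taken on a
  positive section over \<open>c\<close>; the induction hypothesis then makes this choice
  constant.\<close>

lemma pos_complete:
  assumes "X \<in> pos n" "V \<prec> (UNIV :: 'k set)" "\<And>a. a \<in> X \<Longrightarrow> v a \<in> V"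
  obtains c where "c \<in> V" "{a\<in>X. v a = c} \<in> pos n"
proof -
  have "\<exists>c\<in>V. {a\<in>X. v a = c} \<in> pos n"
    using assms(1,3)
  proof (induction n arbitrary: X v)
    case 0
    then have "{a\<in>X. v a = v []} = {[]}" "v [] \<in> V" unfolding pos_0 by auto
    then show ?case using pos_0 by blast
  next
    case (Suc n)
    let ?X = "{c \<in> tuples n. {\<beta>. c @ [\<beta>] \<in> X} \<notin> J}"
    have "\<exists>d\<in>V. {\<beta>. c @ [\<beta>] \<in> X \<and> v (c @ [\<beta>]) = d} \<notin> J" if c: "c \<in> ?X" for c
    proof -
      obtain d where "d \<in> V" "{\<beta>\<in>{\<beta>. c @ [\<beta>] \<in> X}. v (c @ [\<beta>]) = d} \<notin> J"
        by (rule complete[OF assms(2), of "{\<beta>. c @ [\<beta>] \<in> X}" "\<lambda>\<beta>. v (c @ [\<beta>])"])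
          (use c Suc.prems(2) in auto)
      then show ?thesis by auto
    qed
    then have "\<forall>c\<in>?X. \<exists>d. d \<in> V \<and> {\<beta>. c @ [\<beta>] \<in> X \<and> v (c @ [\<beta>]) = d} \<notin> J" by blast
    from bchoice[OF this] obtain w where w: "\<And>c. c \<in> ?X \<Longrightarrow> w c \<in> V"
      "\<And>c. c \<in> ?X \<Longrightarrow> {\<beta>. c @ [\<beta>] \<in> X \<and> v (c @ [\<beta>]) = w c} \<notin> J" by blast
    have "?X \<in> pos n" using Suc.prems(1) unfolding pos_snoc by blast
    from Suc.IH[of ?X w, OF this w(1)] obtain d where d: "d \<in> V" "{c\<in>?X. w c = d} \<in> pos n" by blast
    have "{c\<in>?X. w c = d} \<subseteq> {c \<in> tuples n. {\<beta>. c @ [\<beta>] \<in> {a\<in>X. v a = d}} \<notin> J}"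
      using w(2) by auto
    with d(2) have "{c \<in> tuples n. {\<beta>. c @ [\<beta>] \<in> {a\<in>X. v a = d}} \<notin> J} \<in> pos n"
      by (rule pos_mono) auto
    then have "{a\<in>X. v a = d} \<in> pos (Suc n)"
      unfolding pos_snoc[of "{a\<in>X. v a = d}"] using pos_tuples[OF Suc.prems(1)] by auto
    then show ?case using d(1) by blast
  qed
  then show thesis using that by blast
qed

lemma pos_complete_list:
  assumes "X \<in> pos n" "V \<prec> (UNIV :: 'k set)" "\<And>a. a \<in> X \<Longrightarrow> set (g a) \<subseteq> V"
  obtains c where "{a\<in>X. g a = c} \<in> pos n"
proof -
  obtain l where l: "{a\<in>X. length (g a) = l} \<in> pos n"
    by (rule pos_complete[OF assms(1) uncountable, of "\<lambda>a. length (g a)"]) auto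
  have "\<exists>c. {a\<in>X. g a = c} \<in> pos n" if "X \<in> pos n" "\<And>a. a \<in> X \<Longrightarrow> set (g a) \<subseteq> V \<and> length (g a) = l" for X g
    using that
  proof (induction l arbitrary: X g)
    case 0
    then have "{a\<in>X. g a = []} = X" by auto
    then show ?case using 0(1) by metis
  next
    case (Suc l)
    have ne: "g a \<noteq> []" if "a \<in> X" for a using Suc.prems(2)[OF that] by auto
    have hd: "hd (g a) \<in> V" if "a \<in> X" for a using Suc.prems(2)[OF that] hd_in_set[OF ne[OF that]] by auto
    obtain d where d: "{a\<in>X. hd (g a) = d} \<in> pos n"
      by (rule pos_complete[OF Suc.prems(1) assms(2), of "\<lambda>a. hd (g a)"]) (use hd in auto)
    have "set (tl (g a)) \<subseteq> V \<and> length (tl (g a)) = l" if "a \<in> {a\<in>X. hd (g a) = d}" for a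
      using Suc.prems(2)[of a] that list.set_sel(2)[OF ne[of a]] by (auto simp: subset_iff)
    then obtain c where c: "{a\<in>{a\<in>X. hd (g a) = d}. tl (g a) = c} \<in> pos n"
      using Suc.IH[OF d, of "\<lambda>a. tl (g a)"] by blast
    have "{a\<in>{a\<in>X. hd (g a) = d}. tl (g a) = c} \<subseteq> {a\<in>X. g a = d # c}" using ne by force
    then show ?case using pos_mono[OF c] pos_tuples[OF Suc.prems(1)] by blast
  qed
  from this[OF l, of g] assms(3) obtain c where c: "{a\<in>{a\<in>X. length (g a) = l}. g a = c} \<in> pos n" by blast
  have "{a\<in>{a\<in>X. length (g a) = l}. g a = c} \<subseteq> {a\<in>X. g a = c}" by blast
  then show thesis using that pos_mono[OF c] pos_tuples[OF assms(1)] by blast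
qed

text \<open>Used to confine all elements of the tuples to a set of the dual filter, such as a set of
  closure points.\<close>

lemma pos_restrict: "X \<in> pos n \<Longrightarrow> - D \<in> J \<Longrightarrow> {a\<in>X. set a \<subseteq> D} \<in> pos n"
proof (induction n arbitrary: X)
  case 0
  then show ?case unfolding pos_0 by auto
next
  case (Suc n)
  let ?X = "{c \<in> tuples n. {\<beta>. c @ [\<beta>] \<in> X} \<notin> J}"
  have "{c\<in>?X. set c \<subseteq> D} \<in> pos n" using Suc unfolding pos_snoc by blast
  moreover have "{\<beta>. c @ [\<beta>] \<in> {a\<in>X. set a \<subseteq> D}} \<notin> J" if "c \<in> ?X" "set c \<subseteq> D" for c
  proof -
    have "{\<beta>. c @ [\<beta>] \<in> X} - - D \<notin> J" using that Suc.prems(2) by (intro positive_Diff) auto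
    moreover have "{\<beta>. c @ [\<beta>] \<in> X} - - D = {\<beta>. c @ [\<beta>] \<in> {a\<in>X. set a \<subseteq> D}}" using that(2) by auto
    ultimately show ?thesis by simp
  qed
  then have "{c\<in>?X. set c \<subseteq> D} \<subseteq> {c \<in> tuples n. {\<beta>. c @ [\<beta>] \<in> {a\<in>X. set a \<subseteq> D}} \<notin> J}" by auto
  ultimately have "{c \<in> tuples n. {\<beta>. c @ [\<beta>] \<in> {a\<in>X. set a \<subseteq> D}} \<notin> J} \<in> pos n"
    by (rule pos_mono) auto
  then show ?case
    unfolding pos_snoc[of "{a\<in>X. set a \<subseteq> D}"] using pos_tuples[OF Suc.prems(1)] by auto
qed

end

subsection \<open>Homogeneous families of finite partial functions\<close>

lemma lepoll_total: "A \<lesssim> B \<or> B \<lesssim> A"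
  unfolding lepoll_def card_of_ordLeq by (rule ordLeq_total) (rule card_of_Well_order)+

text \<open>\<open>S\<close> splits a node \<open>Z\<close> of a tree into \<open>S Z\<close> and
  the rest of \<open>Z\<close>. The fibre is the node at level \<open>i\<close> on the branch of
  \<alpha>: the ordinals that went the same way as \<alpha> at all earlier levels.\<close>

function fibre :: "('k::wellorder set \<Rightarrow> 'k set) \<Rightarrow> 'k \<Rightarrow> 'k \<Rightarrow> 'k set" where
  "fibre S \<alpha> i = {x. \<forall>j\<in>{..<i}. x \<in> S (fibre S \<alpha> j) \<longleftrightarrow> \<alpha> \<in> S (fibre S \<alpha> j)}"
  by auto
termination by (relation "inv_image {(x, y). x < y} (\<lambda>(S, \<alpha>, i). i)") (auto intro: wf wf_inv_image)

declare fibre.simps [simp del]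

section \<open>Prime pieces of the ideal and homogeneity\<close>

context saturated_normal_ideal
begin

definition prime_set :: "'k set \<Rightarrow> bool" where
  "prime_set B \<longleftrightarrow> (\<forall>Z\<subseteq>B. Z \<in> J \<or> B - Z \<in> J)"

text \<open>Every ordinal is sent down a tree of height \<open>\<gamma>\<close> that splits positive sets as long as possible;
  a branch that never reaches a prime set would give \<open>\<gamma>\<close> disjoint positive sets.\<close>

lemma prime_fibres:
  "\<exists>code :: 'k \<Rightarrow> 'k set. (\<forall>\<alpha>. code \<alpha> \<in> Pow {..<\<gamma>}) \<and>
    (\<forall>v. {\<alpha>. code \<alpha> = v} \<notin> J \<longrightarrow> prime_set {\<alpha>. code \<alpha> = v})"
proof -
  have "\<forall>Z. \<exists>S. \<not> prime_set Z \<longrightarrow> S \<subseteq> Z \<and> S \<notin> J \<and> Z - S \<notin> J"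
    unfolding prime_set_def by blast
  from choice[OF this] obtain S where S: "\<And>Z. \<not> prime_set Z \<Longrightarrow> S Z \<subseteq> Z \<and> S Z \<notin> J \<and> Z - S Z \<notin> J"
    by blast
  let ?Z = "fibre S"
  \<comment> \<open>The branch of \<alpha>, recorded as the set of levels below \<gamma> at which it
    enters the chosen part. There are at most 2^\<gamma> branches.\<close>
  define code where "code \<alpha> = {i. i < \<gamma> \<and> \<alpha> \<in> S (?Z \<alpha> i)}" for \<alpha>
  show ?thesis
  proof (intro exI[of _ code] conjI allI impI)
    show "code \<alpha> \<in> Pow {..<\<gamma>}" for \<alpha> by (auto simp: code_def)
  next
    fix v assume pos: "{\<alpha>. code \<alpha> = v} \<notin> J"
    then obtain \<alpha> where \<alpha>: "code \<alpha> = v" using positive_nonempty by blast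
    have same: "?Z \<beta> i = ?Z \<alpha> i" if "i \<le> \<gamma>" "code \<beta> = v" for \<beta> i
      using that(1)
    proof (induction i rule: less_induct)
      case (less i)
      have "?Z \<beta> j = ?Z \<alpha> j" "\<beta> \<in> S (?Z \<alpha> j) \<longleftrightarrow> \<alpha> \<in> S (?Z \<alpha> j)" if j: "j < i" for j
      proof -
        show eq: "?Z \<beta> j = ?Z \<alpha> j" using less j by auto
        have "j \<in> code \<beta> \<longleftrightarrow> j \<in> code \<alpha>" using \<alpha> \<open>code \<beta> = v\<close> by simp
        then show "\<beta> \<in> S (?Z \<alpha> j) \<longleftrightarrow> \<alpha> \<in> S (?Z \<alpha> j)"
          using j less.prems eq unfolding code_def by auto
      qed
      then show ?case unfolding fibre.simps[of S \<beta> i] fibre.simps[of S \<alpha> i] by auto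
    qed
    have sub: "{\<alpha>. code \<alpha> = v} \<subseteq> ?Z \<alpha> i" if "i \<le> \<gamma>" for i
    proof
      fix \<beta> assume "\<beta> \<in> {\<alpha>. code \<alpha> = v}"
      then have "?Z \<beta> i = ?Z \<alpha> i" using same that by simp
      moreover have "\<beta> \<in> ?Z \<beta> i" by (subst fibre.simps) simp
      ultimately show "\<beta> \<in> ?Z \<alpha> i" by simp
    qed
    have "\<exists>i<\<gamma>. prime_set (?Z \<alpha> i)"
    proof (rule ccontr)
      assume "\<not> ?thesis"
      then have np: "\<not> prime_set (?Z \<alpha> i)" if "i < \<gamma>" for i using that by blast
      \<comment> \<open>What leaves the branch of \<alpha> exactly at level \<open>i\<close>. It is
        positive because a node that is not prime has been split into two positive parts. Different
        levels give disjoint sets, since elements of a later one still agree with \<alpha> at the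
        earlier level.\<close>
      define W where "W i = {x \<in> ?Z \<alpha> i. (x \<in> S (?Z \<alpha> i)) \<noteq> (\<alpha> \<in> S (?Z \<alpha> i))}" for i
      have "W i \<notin> J" if "i < \<gamma>" for i
      proof (cases "\<alpha> \<in> S (?Z \<alpha> i)")
        case True
        then have "W i = ?Z \<alpha> i - S (?Z \<alpha> i)" unfolding W_def by auto
        then show ?thesis using S[OF np[OF that]] by simp
      next
        case False
        then have "W i = S (?Z \<alpha> i)" unfolding W_def using S[OF np[OF that]] by auto
        then show ?thesis using S[OF np[OF that]] by simp
      qed
      then obtain i j where ij: "j < \<gamma>" "i < j" "W i \<inter> W j \<notin> J"
        using saturated unfolding saturated_ideal_def by blast
      have "W i \<inter> W j = {}"
        using ij(2) unfolding W_def by (subst (3) fibre.simps) auto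
      then show False using ij(3) positive_nonempty by blast
    qed
    then obtain i where i: "i < \<gamma>" "prime_set (?Z \<alpha> i)" by blast
    show "prime_set {\<alpha>. code \<alpha> = v}"
      unfolding prime_set_def
    proof (intro allI impI)
      fix T assume T: "T \<subseteq> {\<alpha>. code \<alpha> = v}"
      note sub_i = sub[OF order_less_imp_le[OF i(1)]]
      have "T \<subseteq> ?Z \<alpha> i" using T sub_i by (rule subset_trans)
      then have "T \<in> J \<or> ?Z \<alpha> i - T \<in> J" using i(2) unfolding prime_set_def by blast
      then show "T \<in> J \<or> {\<alpha>. code \<alpha> = v} - T \<in> J"
        using ideal_subset[of "?Z \<alpha> i - T" "{\<alpha>. code \<alpha> = v} - T"] Diff_mono[OF sub_i subset_refl] by blast
    qed
  qed
qed

text \<open>Otherwise every \<open>y\<close> in a positive set has a tuple below it whose function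
  reaches up to \<open>y\<close> or beyond. Normality makes the tuple constant, but a single finite
  domain can do this only for the \<open>y\<close> in a null set.\<close>

lemma closure_points:
  assumes fin: "\<And>a. a \<in> X \<Longrightarrow> finite (dom (f a))"
  shows "- {y. \<forall>a\<in>X. set a \<subseteq> {..<y} \<longrightarrow> dom (f a) \<subseteq> {..<y}} \<in> J"
proof (rule ccontr)
  let ?N = "- {y. \<forall>a\<in>X. set a \<subseteq> {..<y} \<longrightarrow> dom (f a) \<subseteq> {..<y}}"
  assume N: "?N \<notin> J"
  have "\<forall>y\<in>?N. \<exists>a. a \<in> X \<and> set a \<subseteq> {..<y} \<and> \<not> dom (f a) \<subseteq> {..<y}" by blast
  from bchoice[OF this] obtain g where
    g: "\<And>y. y \<in> ?N \<Longrightarrow> g y \<in> X \<and> set (g y) \<subseteq> {..<y} \<and> \<not> dom (f (g y)) \<subseteq> {..<y}" by blast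
  obtain a where a: "{y\<in>?N. g y = a} \<notin> J"
    by (rule regressive_list[OF N, of g]) (use g in blast)
  then obtain y where "y \<in> ?N" "g y = a" using positive_nonempty by blast
  then have "finite (dom (f a))" using g fin by blast
  then have "(\<Union>\<xi>\<in>dom (f a). {..\<xi>}) \<in> J" by (intro finite_UN_ideal atMost_ideal)
  moreover have "{y\<in>?N. g y = a} \<subseteq> (\<Union>\<xi>\<in>dom (f a). {..\<xi>})"
  proof
    fix y assume "y \<in> {y\<in>?N. g y = a}"
    then have "\<not> dom (f a) \<subseteq> {..<y}" using g by blast
    then show "y \<in> (\<Union>\<xi>\<in>dom (f a). {..\<xi>})" by (auto simp: not_less)
  qed
  ultimately show False using a ideal_subset by blast
qed

text \<open>The clause on \<open>D\<close> says that the domain of \<open>f a\<close> reaches past a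
  member \<open>y\<close> of \<open>D\<close> only if \<open>a\<close> has an element in between.
  The function \<open>f\<close> is generalized because the step applies the hypothesis to two other
  families, \<open>e\<close> and \<open>F\<close>.\<close>

lemma homogeneous_small_power:
  fixes f :: "'k list \<Rightarrow> 'k \<rightharpoonup> nat"
  assumes "Pow {..<\<gamma>} \<prec> (UNIV :: 'k set)"
  shows "X \<in> pos n \<Longrightarrow> \<forall>a\<in>X. finite (dom (f a)) \<Longrightarrow>
    \<exists>Y D. Y \<subseteq> X \<and> Y \<in> pos n \<and> - D \<in> J \<and>
      (\<forall>a\<in>Y. set a \<subseteq> D \<and> (\<forall>\<xi>\<in>dom (f a). \<forall>y\<in>D. y \<le> \<xi> \<longrightarrow> (\<exists>x\<in>set a. y \<le> x \<and> x \<le> \<xi>))) \<and>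
      (\<forall>a\<in>Y. \<forall>b\<in>Y. a \<simeq> b \<longrightarrow> agree (f a) (f b))"
proof (induction n arbitrary: X f)
  case 0
  then have X: "X = {[]}" and fin: "finite (dom (f []))" by (auto simp: pos_0)
  \<comment> \<open>Everything above the finite domain of the only function, so that the clause on
    \<open>D\<close> is vacuous.\<close>
  let ?D = "- (\<Union>\<xi>\<in>dom (f []). {..\<xi>})"
  have "- ?D \<in> J" using finite_UN_ideal[OF fin, of atMost] atMost_ideal by simp
  moreover have "agree (f []) (f [])" by (auto simp: agree_def)
  moreover have "\<forall>\<xi>\<in>dom (f []). \<forall>y\<in>?D. \<not> y \<le> \<xi>" by blast
  ultimately show ?case
    using 0(1) unfolding X by (intro exI[of _ "{[]}"] exI[of _ ?D]) auto
next
  case (Suc n)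
  let ?f = "\<lambda>c \<beta>. f (c @ [\<beta>])"
  define Xc where "Xc c = {\<beta>. c @ [\<beta>] \<in> X}" for c
  have fin: "finite (dom (?f c \<beta>))" if "\<beta> \<in> Xc c" for c \<beta> using Suc.prems(2) that by (simp add: Xc_def)
  define X0 where "X0 = {c \<in> tuples n. Xc c \<notin> J}"
  have X0: "X0 \<in> pos n" using Suc.prems(1) unfolding pos_snoc X0_def Xc_def by blast
  obtain code :: "'k \<Rightarrow> 'k set" where code: "\<forall>\<alpha>. code \<alpha> \<in> Pow {..<\<gamma>}"
    "\<forall>v. {\<alpha>. code \<alpha> = v} \<notin> J \<longrightarrow> prime_set {\<alpha>. code \<alpha> = v}" using prime_fibres by blast
  \<comment> \<open>There are fewer than \<kappa> branches, so by completeness one of them meets the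
    section over \<open>c\<close> in a positive set.\<close>
  have "\<exists>v. v \<in> Pow {..<\<gamma>} \<and> {\<beta>\<in>Xc c. code \<beta> = v} \<notin> J" if c: "c \<in> X0" for c
  proof -
    have "Xc c \<notin> J" using c by (simp add: X0_def)
    then obtain w where "w \<in> Pow {..<\<gamma>}" "{\<beta>\<in>Xc c. code \<beta> = w} \<notin> J"
      by (rule complete[OF assms, of _ code]) (use code(1) in blast)
    then show ?thesis by blast
  qed
  then have "\<forall>c\<in>X0. \<exists>v. v \<in> Pow {..<\<gamma>} \<and> {\<beta>\<in>Xc c. code \<beta> = v} \<notin> J" by blast
  from bchoice[OF this] obtain v where
    v: "\<And>c. c \<in> X0 \<Longrightarrow> v c \<in> Pow {..<\<gamma>}" "\<And>c. c \<in> X0 \<Longrightarrow> {\<beta>\<in>Xc c. code \<beta> = v c} \<notin> J" by blast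
  \<comment> \<open>The same branch for positively many \<open>c\<close>, so that a single
    ultrafilter serves all of them.\<close>
  obtain v0 where "{c\<in>X0. v c = v0} \<in> pos n" using pos_complete[OF X0 assms v(1)] .
  moreover define X1 where "X1 = {c\<in>X0. v c = v0}"
  ultimately have X1: "X1 \<in> pos n" by simp
  define B where "B = {\<beta>. code \<beta> = v0}"
  have B1: "B \<inter> Xc c \<notin> J" if "c \<in> X1" for c
  proof -
    have "{\<beta>\<in>Xc c. code \<beta> = v c} = B \<inter> Xc c" using that by (auto simp: X1_def B_def)
    then show ?thesis using v(2)[of c] that by (simp add: X1_def)
  qed
  have B: "B \<notin> J" using B1 pos_nonempty[OF X1] ideal_subset by blast
  have "prime_set B" using code(2) B by (simp add: B_def)

  \<comment> \<open>\<open>U\<close> holds of the sets that contain almost all of \<open>B\<close>.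
    As \<open>B\<close> is prime and positive, this is a \<kappa>-complete ultrafilter concentrating
    on \<open>B\<close>; primeness enters through \<open>U_pos\<close>.\<close>
  define U where "U Z \<longleftrightarrow> B - Z \<in> J" for Z
  have U_mono: "U Z" if "U Y" "Y \<inter> B \<subseteq> Z" for Y Z
    using that(1) unfolding U_def by (rule ideal_subset) (use that(2) in blast)
  have U_Int: "U (Y \<inter> Z)" if "U Y" "U Z" for Y Z
    using ideal_Un[OF that[unfolded U_def]] unfolding U_def by (simp add: Diff_Int)
  have U_pos: "U Z" if "B \<inter> Z \<notin> J" for Z
  proof -
    have "B \<inter> Z \<in> J \<or> B - B \<inter> Z \<in> J"
      using \<open>prime_set B\<close> unfolding prime_set_def by blast
    moreover have "B - B \<inter> Z = B - Z" by blast
    ultimately show ?thesis using that unfolding U_def by simp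
  qed
  have U_notin: "B \<inter> Z \<notin> J" if "U Z" for Z
  proof -
    have "B - (B - Z) \<notin> J" using positive_Diff[OF B] that unfolding U_def by blast
    moreover have "B - (B - Z) = B \<inter> Z" by blast
    ultimately show ?thesis by simp
  qed
  have U_ex: "\<exists>\<beta>. \<beta> \<in> B \<and> \<beta> \<in> Z" if "U Z" for Z using positive_nonempty[OF U_notin[OF that]] by blast
  have U_const: "\<exists>d. U {\<beta>\<in>Z. w \<beta> = d}" if UZ: "U Z" "countable (range w)" for Z and w :: "'k \<Rightarrow> 'x"
  proof -
    obtain d where d: "{\<beta>\<in>B \<inter> Z. w \<beta> = d} \<notin> J"
      by (rule complete[OF small_countable[OF UZ(2)] U_notin[OF UZ(1)], of w]) auto
    have "{\<beta>\<in>B \<inter> Z. w \<beta> = d} = B \<inter> {\<beta>\<in>Z. w \<beta> = d}" by blast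
    from U_pos[OF d[unfolded this]] show ?thesis by blast
  qed
  have UXc: "U (Xc c)" if "c \<in> X1" for c using U_pos[OF B1[OF that]] .

  \<comment> \<open>Normality: the part below \<beta> is a regressive finite function, so it is
    constant on a positive subset of \<open>B\<close>, which is then in the ultrafilter.\<close>
  have "\<exists>e. U {\<beta>\<in>Xc c. ?f c \<beta> |` {..<\<beta>} = e}" if c: "c \<in> X1" for c
  proof -
    have "finite (dom (?f c \<beta> |` {..<\<beta>})) \<and> dom (?f c \<beta> |` {..<\<beta>}) \<subseteq> {..<\<beta>}" if "\<beta> \<in> B \<inter> Xc c" for \<beta>
      using fin[of \<beta> c] that by simp
    then obtain e where e: "{\<beta>\<in>B \<inter> Xc c. ?f c \<beta> |` {..<\<beta>} = e} \<notin> J"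
      by (rule regressive_map[OF B1[OF c], of "\<lambda>\<beta>. ?f c \<beta> |` {..<\<beta>}"])
    have "{\<beta>\<in>B \<inter> Xc c. ?f c \<beta> |` {..<\<beta>} = e} = B \<inter> {\<beta>\<in>Xc c. ?f c \<beta> |` {..<\<beta>} = e}" by blast
    from U_pos[OF e[unfolded this]] show ?thesis by blast
  qed
  then have "\<forall>c\<in>X1. \<exists>e. U {\<beta>\<in>Xc c. ?f c \<beta> |` {..<\<beta>} = e}" by blast
  from bchoice[OF this] obtain e where e: "\<And>c. c \<in> X1 \<Longrightarrow> U {\<beta>\<in>Xc c. ?f c \<beta> |` {..<\<beta>} = e c}" by blast
  have "finite (dom (e c))" if c: "c \<in> X1" for c
  proof -
    obtain \<beta> where b: "\<beta> \<in> Xc c" "?f c \<beta> |` {..<\<beta>} = e c" using U_ex[OF e[OF c]] by blast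
    show ?thesis unfolding b(2)[symmetric] using fin[OF b(1)] by simp
  qed
  then have fe: "\<forall>c\<in>X1. finite (dom (e c))" by blast
  from Suc.IH[of X1 e, OF X1 fe] obtain Y1 D1 where Y1: "Y1 \<subseteq> X1" "Y1 \<in> pos n" "- D1 \<in> J"
    "\<forall>a\<in>Y1. set a \<subseteq> D1 \<and> (\<forall>\<xi>\<in>dom (e a). \<forall>y\<in>D1. y \<le> \<xi> \<longrightarrow> (\<exists>x\<in>set a. y \<le> x \<and> x \<le> \<xi>))"
    "\<forall>a\<in>Y1. \<forall>b\<in>Y1. a \<simeq> b \<longrightarrow> agree (e a) (e b)" by (elim exE conjE)

  have "\<exists>C. U {\<beta>\<in>Xc c. vals (?f c \<beta>) = C}" if "c \<in> X1" for c
    by (rule U_const[OF UXc[OF that], of "\<lambda>\<beta>. vals (?f c \<beta>)"]) (rule countableI_type)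
  then have "\<forall>c\<in>X1. \<exists>C. U {\<beta>\<in>Xc c. vals (?f c \<beta>) = C}" by blast
  from bchoice[OF this] obtain C where C: "\<And>c. c \<in> X1 \<Longrightarrow> U {\<beta>\<in>Xc c. vals (?f c \<beta>) = C c}" by blast
  \<comment> \<open>For \<open>p = (c, i)\<close> the map \<open>pt p\<close> sends \<beta> to the
    domain point number \<open>i\<close> of \<open>f (c @ [\<beta>])\<close>. It represents an
    element of the ultrapower of \<kappa> by \<open>U\<close>, and \<open>E\<close> is equality
    there.\<close>
  define pt where "pt p \<beta> = pts (?f (fst p) \<beta>) ! snd p" for p \<beta>
  define E where "E p q \<longleftrightarrow> U {\<beta>. pt p \<beta> = pt q \<beta>}" for p q
  have E_refl: "E p p" for p unfolding E_def U_def using ideal_subset[OF singleton_ideal] by simp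
  have E_sym: "E q p" if "E p q" for p q
    using that unfolding E_def by (rule U_mono) auto
  have E_trans: "E p r" if "E p q" "E q r" for p q r
    using U_Int[OF that[unfolded E_def]] unfolding E_def by (rule U_mono) auto
  obtain enc :: "'k list \<times> nat \<Rightarrow> 'k" where enc: "inj enc"
    using prod_list_lepoll[OF infinite_UNIV] unfolding lepoll_def by blast
  \<comment> \<open>Codes ultrapower elements by ordinals, because the induction hypothesis is about
    functions on \<kappa>. The chosen representative depends only on the class, as equivalent
    \<open>p\<close> and \<open>q\<close> satisfy \<open>E p = E q\<close>.\<close>
  define \<phi> where "\<phi> p = enc (SOME q. E p q)" for p
  have \<phi>_eq: "\<phi> p = \<phi> q" if "E p q" for p q
  proof -
    have "E p = E q" using E_sym E_trans that by blast
    then show ?thesis unfolding \<phi>_def by simp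
  qed
  have \<phi>_E: "E p q" if "\<phi> p = \<phi> q" for p q
  proof -
    have "(SOME r. E p r) = (SOME r. E q r)" using injD[OF enc] that unfolding \<phi>_def by blast
    moreover have "E p (SOME r. E p r)" "E q (SOME r. E q r)" using E_refl by (metis someI)+
    ultimately show ?thesis using E_sym E_trans by metis
  qed
  \<comment> \<open>The class of the map from \<beta> to \<open>f (c @ [\<beta>])\<close> in the
    ultrapower, transported to \<kappa>: the domain consists of the codes of its points, and the
    values form the word \<open>C c\<close>, which is the same for almost all \<beta>.\<close>
  define F where "F c = map_of (zip (map (\<lambda>i. \<phi> (c, i)) [0..<length (C c)]) (C c))" for c
  have F: "F c (\<phi> (c, i)) = Some (C c ! i)" if c: "c \<in> X1" and i: "i < length (C c)" for c i
  proof -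
    \<comment> \<open>Two positions with the same code would hold the same domain point for almost
      all \<beta>, but \<open>pts\<close> has no repetitions.\<close>
    have "distinct (map (\<lambda>i. \<phi> (c, i)) [0..<length (C c)])"
      unfolding distinct_map
    proof (intro conjI inj_onI)
      fix i j assume ij: "i \<in> set [0..<length (C c)]" "j \<in> set [0..<length (C c)]" "\<phi> (c, i) = \<phi> (c, j)"
      obtain \<beta> where b: "\<beta> \<in> Xc c" "vals (?f c \<beta>) = C c" "pt (c, i) \<beta> = pt (c, j) \<beta>"
        using U_ex[OF U_Int[OF C[OF c] \<phi>_E[OF ij(3), unfolded E_def]]] by blast
      have "length (pts (?f c \<beta>)) = length (C c)" using b(2) length_vals by metis
      then show "i = j" using b(3) ij(1,2) by (simp add: pt_def nth_eq_iff_index_eq[OF pts(2)])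
    qed simp
    then show ?thesis unfolding F_def
      using map_of_zip_nth[of "map (\<lambda>i. \<phi> (c, i)) [0..<length (C c)]" "C c" i] i by simp
  qed
  have fF: "\<forall>c\<in>Y1. finite (dom (F c))" unfolding F_def by (simp add: finite_dom_map_of)
  from Suc.IH[of Y1 F, OF Y1(2) fF] obtain Y2 D2 where Y2: "Y2 \<subseteq> Y1" "Y2 \<in> pos n"
    "\<forall>a\<in>Y2. \<forall>b\<in>Y2. a \<simeq> b \<longrightarrow> agree (F a) (F b)" by (elim exE conjE)

  \<comment> \<open>An instance of the theorem of Los: if the functions disagreed for almost all
    \<beta>, so would their classes \<open>F c\<close> and \<open>F c'\<close>.\<close>
  have agree_U: "U {\<beta>. agree (?f c \<beta>) (?f c' \<beta>)}" if cc: "c \<in> Y2" "c' \<in> Y2" "c \<simeq> c'" for c c'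
  proof (rule ccontr)
    assume n: "\<not> U {\<beta>. agree (?f c \<beta>) (?f c' \<beta>)}"
    have "U {\<beta>. \<not> agree (?f c \<beta>) (?f c' \<beta>)}"
    proof (rule U_pos)
      have "B - {\<beta>. agree (?f c \<beta>) (?f c' \<beta>)} = B \<inter> {\<beta>. \<not> agree (?f c \<beta>) (?f c' \<beta>)}" by blast
      then show "B \<inter> {\<beta>. \<not> agree (?f c \<beta>) (?f c' \<beta>)} \<notin> J" using n unfolding U_def by simp
    qed
    moreover have cX: "c \<in> X1" "c' \<in> X1" using cc Y2(1) Y1(1) by blast+
    moreover define G where "G = {\<beta>. \<not> agree (?f c \<beta>) (?f c' \<beta>)} \<inter>
      ({\<beta>\<in>Xc c. vals (?f c \<beta>) = C c} \<inter> {\<beta>\<in>Xc c'. vals (?f c' \<beta>) = C c'})"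
    ultimately have UG: "U G" using U_Int C by blast
    have "\<exists>p. fst p < length (C c) \<and> snd p < length (C c') \<and> pt (c, fst p) \<beta> = pt (c', snd p) \<beta> \<and>
        C c ! fst p \<noteq> C c' ! snd p" if b: "\<beta> \<in> G" for \<beta>
    proof -
      have G: "\<beta> \<in> Xc c" "\<beta> \<in> Xc c'" "vals (?f c \<beta>) = C c" "vals (?f c' \<beta>) = C c'" using b by (simp_all add: G_def)
      obtain x u w where x: "?f c \<beta> x = Some u" "?f c' \<beta> x = Some w" "u \<noteq> w"
        using b by (auto simp: G_def agree_def)
      obtain i where i: "i < length (pts (?f c \<beta>))" "x = pts (?f c \<beta>) ! i" "u = vals (?f c \<beta>) ! i"
        using nth_ptsE[OF fin[OF G(1)] x(1)] .
      obtain j where j: "j < length (pts (?f c' \<beta>))" "x = pts (?f c' \<beta>) ! j" "w = vals (?f c' \<beta>) ! j"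
        using nth_ptsE[OF fin[OF G(2)] x(2)] .
      have "i < length (C c)" "j < length (C c')"
        using i(1) j(1) length_vals[of "?f c \<beta>"] length_vals[of "?f c' \<beta>"] G(3,4) by auto
      then show ?thesis using i j x(3) G(3,4) unfolding pt_def by (intro exI[of _ "(i, j)"]) simp
    qed
    then have "\<forall>\<beta>\<in>G. \<exists>p. fst p < length (C c) \<and> snd p < length (C c') \<and>
        pt (c, fst p) \<beta> = pt (c', snd p) \<beta> \<and> C c ! fst p \<noteq> C c' ! snd p" by blast
    from bchoice[OF this] obtain p :: "'k \<Rightarrow> nat \<times> nat" where
      p: "\<And>\<beta>. \<beta> \<in> G \<Longrightarrow> fst (p \<beta>) < length (C c) \<and> snd (p \<beta>) < length (C c') \<and>
        pt (c, fst (p \<beta>)) \<beta> = pt (c', snd (p \<beta>)) \<beta> \<and> C c ! fst (p \<beta>) \<noteq> C c' ! snd (p \<beta>)" by blast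
    \<comment> \<open>The pair of positions at which the disagreement occurs is one of countably
      many, hence constant on a set of the ultrafilter; there the two points coincide.\<close>
    obtain ij where ij: "U {\<beta>\<in>G. p \<beta> = ij}" using U_const[OF UG countableI_type, of p] by blast
    obtain i j where [simp]: "ij = (i, j)" by (cases ij)
    obtain \<beta> where "\<beta> \<in> G" "p \<beta> = (i, j)" using U_ex[OF ij] by auto
    then have i: "i < length (C c)" "j < length (C c')" "C c ! i \<noteq> C c' ! j" using p[of \<beta>] by auto
    have "pt (c, i) \<beta> = pt (c', j) \<beta>" if "\<beta> \<in> G" "p \<beta> = ij" for \<beta>
      using p[OF that(1)] that(2) by simp
    then have "{\<beta>\<in>G. p \<beta> = ij} \<inter> B \<subseteq> {\<beta>. pt (c, i) \<beta> = pt (c', j) \<beta>}" by blast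
    with ij have "E (c, i) (c', j)" unfolding E_def by (rule U_mono)
    then have ph: "\<phi> (c, i) = \<phi> (c', j)" by (rule \<phi>_eq)
    have "F c (\<phi> (c, i)) = Some (C c ! i)" "F c' (\<phi> (c, i)) = Some (C c' ! j)"
      using F[OF cX(1) i(1)] F[OF cX(2) i(2)] unfolding ph by simp_all
    moreover have "agree (F c) (F c')" using Y2(3) cc by blast
    ultimately show False using i(3) unfolding agree_def by blast
  qed

  \<comment> \<open>The diagonal union, over pairs of tuples below \<beta>, of the exceptional sets
    from \<open>agree_U\<close>.\<close>
  define Bad where "Bad = {\<beta>\<in>B. \<exists>c\<in>Y2. \<exists>c'\<in>Y2. c \<simeq> c' \<and> set c \<subseteq> {..<\<beta>} \<and> set c' \<subseteq> {..<\<beta>} \<and>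
    \<not> agree (?f c \<beta>) (?f c' \<beta>)}"
  have Bad: "Bad \<in> J"
  proof (rule ccontr)
    assume N: "Bad \<notin> J"
    have "\<forall>\<beta>\<in>Bad. \<exists>p. fst p \<in> Y2 \<and> snd p \<in> Y2 \<and> fst p \<simeq> snd p \<and> set (fst p) \<subseteq> {..<\<beta>} \<and> set (snd p) \<subseteq> {..<\<beta>} \<and>
      \<not> agree (?f (fst p) \<beta>) (?f (snd p) \<beta>)" unfolding Bad_def by auto
    from bchoice[OF this] obtain p where p: "\<And>\<beta>. \<beta> \<in> Bad \<Longrightarrow> fst (p \<beta>) \<in> Y2 \<and> snd (p \<beta>) \<in> Y2 \<and>
      fst (p \<beta>) \<simeq> snd (p \<beta>) \<and> set (fst (p \<beta>)) \<subseteq> {..<\<beta>} \<and> set (snd (p \<beta>)) \<subseteq> {..<\<beta>} \<and>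
      \<not> agree (?f (fst (p \<beta>)) \<beta>) (?f (snd (p \<beta>)) \<beta>)" by blast
    \<comment> \<open>Concatenated, the two witnesses are one finite list below \<beta>, so
      normality fixes both. Their lengths are \<open>n\<close>, so cutting at \<open>n\<close>
      recovers them, and the exceptional set of a single pair is null.\<close>
    obtain l where l: "{\<beta>\<in>Bad. fst (p \<beta>) @ snd (p \<beta>) = l} \<notin> J"
      by (rule regressive_list[OF N, of "\<lambda>\<beta>. fst (p \<beta>) @ snd (p \<beta>)"]) (use p in auto)
    have eq: "fst (p \<beta>) = take n l" "snd (p \<beta>) = drop n l" if bl: "\<beta> \<in> Bad" "fst (p \<beta>) @ snd (p \<beta>) = l" for \<beta>
    proof -
      have "length (fst (p \<beta>)) = n" using p[OF bl(1)] pos_tuples[OF Y2(2)] by (auto simp: tuples_def)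
      then show "fst (p \<beta>) = take n l" "snd (p \<beta>) = drop n l" using bl(2) by auto
    qed
    let ?c = "take n l" and ?c' = "drop n l"
    obtain \<beta> where b: "\<beta> \<in> Bad" "fst (p \<beta>) @ snd (p \<beta>) = l" using positive_nonempty[OF l] by blast
    have "U {\<alpha>. agree (?f (fst (p \<beta>)) \<alpha>) (?f (snd (p \<beta>)) \<alpha>)}"
      by (rule agree_U) (use p[OF b(1)] in simp_all)
    then have "U {\<beta>. agree (?f ?c \<beta>) (?f ?c' \<beta>)}" unfolding eq[OF b] .
    then have "B - {\<beta>. agree (?f ?c \<beta>) (?f ?c' \<beta>)} \<in> J" unfolding U_def .
    moreover have "{\<beta>\<in>Bad. fst (p \<beta>) @ snd (p \<beta>) = l} \<subseteq> B - {\<beta>. agree (?f ?c \<beta>) (?f ?c' \<beta>)}"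
    proof
      fix \<beta> assume "\<beta> \<in> {\<beta>\<in>Bad. fst (p \<beta>) @ snd (p \<beta>) = l}"
      then have b: "\<beta> \<in> Bad" "fst (p \<beta>) @ snd (p \<beta>) = l" by auto
      then have "\<beta> \<in> B" by (simp add: Bad_def)
      then show "\<beta> \<in> B - {\<beta>. agree (?f ?c \<beta>) (?f ?c' \<beta>)}" using p[OF b(1)] unfolding eq[OF b] by simp
    qed
    ultimately show False using l ideal_subset by blast
  qed

  \<comment> \<open>Closure is required for the given \<open>f\<close> on whole tuples, last element
    included; this bounds what \<open>f (c @ [\<beta>])\<close> does above \<beta>.\<close>
  define Cl where "Cl = {y. \<forall>a\<in>X. set a \<subseteq> {..<y} \<longrightarrow> dom (f a) \<subseteq> {..<y}}"
  have Cl: "- Cl \<in> J" unfolding Cl_def by (rule closure_points) (use Suc.prems(2) in blast)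
  define D where "D = D1 \<inter> Cl"
  have D: "- D \<in> J" using ideal_Un[OF Y1(3) Cl] by (simp add: D_def)
  define H where "H c = B \<inter> {\<beta>\<in>Xc c. ?f c \<beta> |` {..<\<beta>} = e c} \<inter> D - Bad" for c
  define Y where "Y = {c @ [\<beta>] | c \<beta>. c \<in> Y2 \<and> set c \<subseteq> D \<and> \<beta> \<in> H c}"
  have YX: "Y \<subseteq> X" unfolding Y_def H_def Xc_def by auto
  have Xt: "X \<subseteq> tuples (Suc n)" using pos_tuples[OF Suc.prems(1)] .
  have Ypos: "Y \<in> pos (Suc n)"
  proof -
    have "H c \<notin> J" if "c \<in> Y2" for c
    proof -
      have "c \<in> X1" using that Y2(1) Y1(1) by blast
      from U_notin[OF e[OF this]] have "B \<inter> {\<beta>\<in>Xc c. ?f c \<beta> |` {..<\<beta>} = e c} - (- D \<union> Bad) \<notin> J"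
        using positive_Diff ideal_Un[OF D Bad] by blast
      moreover have "B \<inter> {\<beta>\<in>Xc c. ?f c \<beta> |` {..<\<beta>} = e c} - (- D \<union> Bad) = H c" unfolding H_def by blast
      ultimately show ?thesis by simp
    qed
    moreover have "{\<beta>. c @ [\<beta>] \<in> Y} = H c" if "c \<in> Y2" "set c \<subseteq> D" for c
      using that unfolding Y_def by auto
    ultimately have "{c\<in>Y2. set c \<subseteq> D} \<subseteq> {c \<in> tuples n. {\<beta>. c @ [\<beta>] \<in> Y} \<notin> J}"
      using pos_tuples[OF Y2(2)] by auto
    then have "{c \<in> tuples n. {\<beta>. c @ [\<beta>] \<in> Y} \<notin> J} \<in> pos n"
      by (rule pos_mono[OF pos_restrict[OF Y2(2) D]]) auto
    then show ?thesis unfolding pos_snoc[of Y n] using subset_trans[OF YX Xt] by (rule conjI[rotated])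
  qed
  have YE: "\<exists>c \<beta>. a = c @ [\<beta>] \<and> c \<in> Y2 \<and> c \<in> Y1 \<and> set c \<subseteq> D \<and> \<beta> \<in> D \<and> \<beta> \<in> B \<and> \<beta> \<notin> Bad \<and>
      c @ [\<beta>] \<in> X \<and> c @ [\<beta>] \<in> tuples (Suc n) \<and> set c \<subseteq> {..<\<beta>} \<and>
      (\<forall>\<xi><\<beta>. f (c @ [\<beta>]) \<xi> = e c \<xi>) \<and> dom (e c) \<subseteq> {..<\<beta>}" if a: "a \<in> Y" for a
  proof -
    obtain c \<beta> where c: "a = c @ [\<beta>]" "c \<in> Y2" "set c \<subseteq> D" "\<beta> \<in> H c" using a unfolding Y_def by blast
    have t: "c @ [\<beta>] \<in> X" "c @ [\<beta>] \<in> tuples (Suc n)" using a c(1) YX Xt by auto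
    have ec: "e c = f (c @ [\<beta>]) |` {..<\<beta>}" using c(4) unfolding H_def by simp
    have "f (c @ [\<beta>]) \<xi> = e c \<xi>" if "\<xi> < \<beta>" for \<xi> using that unfolding ec by simp
    moreover have "dom (e c) \<subseteq> {..<\<beta>}" unfolding ec by simp
    moreover have "set c \<subseteq> {..<\<beta>}" using t(2) by (auto simp: tuples_def sorted_wrt_append)
    ultimately show ?thesis using c t Y2(1) unfolding H_def by blast
  qed
  have gap: "\<exists>x\<in>set a. y \<le> x \<and> x \<le> \<xi>" if a: "a \<in> Y" and xi: "\<xi> \<in> dom (f a)" and y: "y \<in> D" "y \<le> \<xi>" for a \<xi> y
  proof -
    obtain c \<beta> where c: "a = c @ [\<beta>]" "c \<in> Y2" "c \<in> Y1" "set c \<subseteq> D" "\<beta> \<in> D" "\<beta> \<in> B" "\<beta> \<notin> Bad"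
      "c @ [\<beta>] \<in> X" "c @ [\<beta>] \<in> tuples (Suc n)" "set c \<subseteq> {..<\<beta>}"
      "\<forall>\<xi><\<beta>. f (c @ [\<beta>]) \<xi> = e c \<xi>" "dom (e c) \<subseteq> {..<\<beta>}" using YE[OF a] by (elim exE conjE)
    show ?thesis
    proof (cases "\<xi> < \<beta>")
      case True
      then have "\<xi> \<in> dom (e c)" using xi c(1,11) by auto
      moreover have "y \<in> D1" using y(1) by (simp add: D_def)
      ultimately obtain x where "x \<in> set c" "y \<le> x" "x \<le> \<xi>" using Y1(4) c(3) y(2) by blast
      then show ?thesis using c(1) by auto
    next
      case False
      \<comment> \<open>If \<open>y\<close> were above \<beta>, all of \<open>a\<close> would lie
        below the closure point \<open>y\<close>, and so would the domain point \<xi>. Hence \<beta>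
        itself is the required element.\<close>
      have "y \<le> \<beta>"
      proof (rule ccontr)
        assume "\<not> y \<le> \<beta>"
        then have "set a \<subseteq> {..<y}" using c(1,10) by auto
        moreover have "y \<in> Cl" using y(1) by (simp add: D_def)
        ultimately have "dom (f a) \<subseteq> {..<y}" using c(1,8) unfolding Cl_def by blast
        then show False using xi y(2) by auto
      qed
      then show ?thesis using False c(1) by auto
    qed
  qed
  have agr: "agree (f a) (f b)" if a: "a \<in> Y" and b: "b \<in> Y" and ab: "a \<simeq> b" for a b
    unfolding agree_def
  proof (intro allI impI)
    fix \<xi> u w assume u: "f a \<xi> = Some u" and w: "f b \<xi> = Some w"
    obtain c \<beta> where c: "a = c @ [\<beta>]" "c \<in> Y2" "c \<in> Y1" "set c \<subseteq> D" "\<beta> \<in> D" "\<beta> \<in> B" "\<beta> \<notin> Bad"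
      "c @ [\<beta>] \<in> X" "c @ [\<beta>] \<in> tuples (Suc n)" "set c \<subseteq> {..<\<beta>}"
      "\<forall>\<xi><\<beta>. f (c @ [\<beta>]) \<xi> = e c \<xi>" "dom (e c) \<subseteq> {..<\<beta>}" using YE[OF a] by (elim exE conjE)
    obtain c' \<beta>' where c': "b = c' @ [\<beta>']" "c' \<in> Y2" "c' \<in> Y1" "set c' \<subseteq> D" "\<beta>' \<in> D" "\<beta>' \<in> B" "\<beta>' \<notin> Bad"
      "c' @ [\<beta>'] \<in> X" "c' @ [\<beta>'] \<in> tuples (Suc n)" "set c' \<subseteq> {..<\<beta>'}"
      "\<forall>\<xi><\<beta>'. f (c' @ [\<beta>']) \<xi> = e c' \<xi>" "dom (e c') \<subseteq> {..<\<beta>'}" using YE[OF b] by (elim exE conjE)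
    note sim = similar_snoc[OF c(9) c'(9) ab[unfolded c(1) c'(1)]]
    note sim' = similar_snoc(2)[OF c'(9) c(9) similar_sym[OF ab, unfolded c(1) c'(1)]]
    show "u = w"
    proof (cases "\<xi> < \<beta> \<and> \<xi> < \<beta>'")
      case True
      then have "e c \<xi> = Some u" "e c' \<xi> = Some w" using u w c(1,11) c'(1,11) by auto
      then show ?thesis using Y1(5) c(3) c'(3) sim(1) unfolding agree_def by blast
    next
      case False
      \<comment> \<open>Say \<beta> \<le> \<xi>. The gap property of \<open>b\<close> gives an
        \<open>x\<close> in \<open>b\<close> between \<beta> and \<xi>; that of \<open>a\<close>,
        applied to \<open>x\<close>, gives an element of \<open>a\<close> above or at
        \<open>x\<close>, hence at most \<beta>. So \<open>x\<close> is \<beta>, and similarity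
        fixes a shared last element.\<close>
      have "\<beta>' = \<beta>"
      proof (cases "\<beta> \<le> \<xi>")
        case True
        have "\<xi> \<in> dom (f b)" using w by blast
        from gap[OF b this c(5) True] obtain x where x: "x \<in> set b" "\<beta> \<le> x" "x \<le> \<xi>" by blast
        then have "x \<in> D" using c'(1,4,5) by auto
        moreover have "\<xi> \<in> dom (f a)" using u by blast
        ultimately obtain z where "z \<in> set a" "x \<le> z" using gap[OF a] x(3) by blast
        then have "z \<le> \<beta>" using c(1,10) by auto
        then have "x = \<beta>" using x(2) \<open>x \<le> z\<close> by auto
        then show ?thesis using sim(2) x(1) c'(1) by simp
      next
        case False
        then have True: "\<beta>' \<le> \<xi>" using \<open>\<not> (\<xi> < \<beta> \<and> \<xi> < \<beta>')\<close> by auto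
        have "\<xi> \<in> dom (f a)" using u by blast
        from gap[OF a this c'(5) True] obtain x where x: "x \<in> set a" "\<beta>' \<le> x" "x \<le> \<xi>" by blast
        then have "x \<in> D" using c(1,4,5) by auto
        moreover have "\<xi> \<in> dom (f b)" using w by blast
        ultimately obtain z where "z \<in> set b" "x \<le> z" using gap[OF b] x(3) by blast
        then have "z \<le> \<beta>'" using c'(1,10) by auto
        then have "x = \<beta>'" using x(2) \<open>x \<le> z\<close> by auto
        then show ?thesis using sim' x(1) c(1) by simp
      qed
      \<comment> \<open>With a common last element outside \<open>Bad\<close>, agreement holds at
        every point, also above \<beta>.\<close>
      then have "agree (f a) (f b)"
        using c(2,6,7,10) c'(2,10) sim(1) unfolding Bad_def c(1) c'(1) by blast
      then show ?thesis using u w unfolding agree_def by blast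
    qed
  qed
  have YD: "set a \<subseteq> D" if "a \<in> Y" for a using YE[OF that] by auto
  show ?case
  proof (intro exI[of _ Y] exI[of _ D] conjI ballI impI)
    show "\<exists>x\<in>set a. y \<le> x \<and> x \<le> \<xi>" if "a \<in> Y" "\<xi> \<in> dom (f a)" "y \<in> D" "y \<le> \<xi>" for a \<xi> y
      using gap that .
    show "agree (f a) (f b)" if "a \<in> Y" "b \<in> Y" "a \<simeq> b" for a b using agr that .
  qed (fact YX Ypos D YD)+
qed

text \<open>If \<open>\<kappa> \<le> 2\<^sup>\<gamma>\<close>, finitely many ordinals below \<open>\<gamma>\<close> separate the domain of each function, and
  \<open>\<kappa>\<close>-completeness makes the separating data constant.\<close>

lemma homogeneous_large_power:
  assumes large: "(UNIV :: 'k set) \<lesssim> Pow {..<\<gamma>}"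
    and X: "X \<in> pos n" and finite: "\<forall>a\<in>X. finite (dom (f a))"
  shows "\<exists>Y\<subseteq>X. Y \<in> pos n \<and> (\<forall>a\<in>Y. \<forall>b\<in>Y. agree (f a) (f b :: 'k \<rightharpoonup> nat))"
proof -
  note fin = finite[rule_format]
  obtain r :: "'k \<Rightarrow> 'k set" where r: "inj r" "range r \<subseteq> Pow {..<\<gamma>}"
    using large unfolding lepoll_def by blast
  \<comment> \<open>The bits that the subset of \<gamma> assigned to \<open>x\<close> shows at the
    ordinals listed in \<open>s\<close>.\<close>
  define trace where "trace s x = map (\<lambda>d. d \<in> r x) s" for s :: "'k list" and x
  have "\<exists>s. set s \<subseteq> {..<\<gamma>} \<and> inj_on (trace s) F" if F: "finite F" for F
  proof -
    have "\<exists>d<\<gamma>. (d \<in> r x) \<noteq> (d \<in> r y)" if "x \<noteq> y" for x y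
    proof -
      have "r x \<noteq> r y" using that injD[OF r(1)] by blast
      then obtain d where "(d \<in> r x) \<noteq> (d \<in> r y)" by blast
      moreover from this have "d < \<gamma>" using r(2) by blast
      ultimately show ?thesis by blast
    qed
    then have "\<forall>x y. \<exists>d. x \<noteq> y \<longrightarrow> d < \<gamma> \<and> (d \<in> r x) \<noteq> (d \<in> r y)" by blast
    then obtain d where d: "\<And>x y. x \<noteq> y \<Longrightarrow> d x y < \<gamma> \<and> (d x y \<in> r x) \<noteq> (d x y \<in> r y)" by metis
    \<comment> \<open>One separating ordinal for each pair in \<open>F\<close>. On the diagonal
      \<open>d x x\<close> is arbitrary, hence the intersection with the ordinals below
      \<gamma>.\<close>
    define Dm where "Dm = (\<Union>x\<in>F. d x ` F) \<inter> {..<\<gamma>}"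
    have "finite Dm" using F unfolding Dm_def by simp
    then obtain s where s: "set s = Dm" using finite_list by blast
    have "inj_on (trace s) F"
    proof (rule inj_onI, rule ccontr)
      fix x y assume xy: "x \<in> F" "y \<in> F" "trace s x = trace s y" "x \<noteq> y"
      have "d x y \<in> set s" unfolding s Dm_def using xy(1,2) d[OF xy(4)] by blast
      then have "(d x y \<in> r x) = (d x y \<in> r y)" using xy(3) unfolding trace_def by (simp add: map_eq_conv)
      then show False using d xy(4) by blast
    qed
    moreover have "set s \<subseteq> {..<\<gamma>}" unfolding s Dm_def by blast
    ultimately show ?thesis by blast
  qed
  then have "\<forall>a\<in>X. \<exists>s. set s \<subseteq> {..<\<gamma>} \<and> inj_on (trace s) (dom (f a))" using fin by blast
  from bchoice[OF this] obtain s where s: "\<And>a. a \<in> X \<Longrightarrow> set (s a) \<subseteq> {..<\<gamma>}"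
    "\<And>a. a \<in> X \<Longrightarrow> inj_on (trace (s a)) (dom (f a))" by blast
  obtain s0 where s0: "{a\<in>X. s a = s0} \<in> pos n"
    by (rule pos_complete_list[OF X small_lessThan, of s]) (rule s(1))
  \<comment> \<open>Traces along a fixed \<open>s0\<close> are finite bit strings, so the data of a
    function consist of countably many possibilities although its points range over
    \<kappa>.\<close>
  obtain key where "{a\<in>{a\<in>X. s a = s0}. (map (trace s0) (pts (f a)), vals (f a)) = key} \<in> pos n"
    by (rule pos_complete[OF s0 small_countable[of "UNIV :: (bool list list \<times> nat list) set"],
          of "\<lambda>a. (map (trace s0) (pts (f a)), vals (f a))"]) auto
  moreover define Y where "Y = {a\<in>{a\<in>X. s a = s0}. (map (trace s0) (pts (f a)), vals (f a)) = key}"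
  ultimately have Y: "Y \<in> pos n" by simp
  have ag: "agree (f a) (f b)" if ab: "a \<in> Y" "b \<in> Y" for a b
    unfolding agree_def
  proof (intro allI impI)
    fix x u w assume u: "f a x = Some u" and w: "f b x = Some w"
    have X: "a \<in> X" "b \<in> X" "s a = s0" and tr: "map (trace s0) (pts (f a)) = map (trace s0) (pts (f b))"
      and vl: "vals (f a) = vals (f b)" using ab unfolding Y_def by auto
    obtain i where i: "i < length (pts (f a))" "x = pts (f a) ! i" "u = vals (f a) ! i"
      using nth_ptsE[OF fin[OF X(1)] u] .
    obtain j where j: "j < length (pts (f b))" "x = pts (f b) ! j" "w = vals (f b) ! j"
      using nth_ptsE[OF fin[OF X(2)] w] .
    have len: "length (pts (f a)) = length (pts (f b))" using tr by (metis length_map)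
    \<comment> \<open>A common point has the same trace on both sides. The lists of traces are equal
      and without repetition, so it occupies the same position in both enumerations, where the
      values coincide.\<close>
    have "distinct (map (trace s0) (pts (f a)))"
      using s(2)[OF X(1)] X(3) pts[of "f a"] fin[OF X(1)] by (simp add: distinct_map)
    moreover have "map (trace s0) (pts (f a)) ! i = trace s0 x" using i(1,2) by simp
    moreover have "map (trace s0) (pts (f a)) ! j = trace s0 x" unfolding tr using j(1,2) by simp
    ultimately have "i = j" using i(1) j(1) len nth_eq_iff_index_eq by fastforce
    then show "u = w" using i(3) j(3) vl by simp
  qed
  have YX: "Y \<subseteq> X" unfolding Y_def by blast
  show ?thesis
  proof (intro exI[of _ Y] conjI ballI)
    show "agree (f a) (f b)" if "a \<in> Y" "b \<in> Y" for a b using ag that .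
  qed (fact YX Y)+
qed

lemma homogeneous:
  assumes "X \<in> pos n" "\<forall>a\<in>X. finite (dom (f a))"
  shows "\<exists>Y\<subseteq>X. Y \<in> pos n \<and> (\<forall>a\<in>Y. \<forall>b\<in>Y. a \<simeq> b \<longrightarrow> agree (f a) (f b :: 'k \<rightharpoonup> nat))"
proof (cases "(UNIV :: 'k set) \<lesssim> Pow {..<\<gamma>}")
  case True
  obtain Y where Y: "Y \<subseteq> X" "Y \<in> pos n" and ag: "\<forall>a\<in>Y. \<forall>b\<in>Y. agree (f a) (f b)"
    using homogeneous_large_power[OF True assms] by (elim exE conjE)
  show ?thesis
    by (intro exI[of _ Y] conjI ballI impI) (fact Y | rule ag[rule_format], assumption+)+
next
  case False
  then have "Pow {..<\<gamma>} \<lesssim> (UNIV :: 'k set)"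
    using lepoll_total by blast
  then have small: "Pow {..<\<gamma>} \<prec> (UNIV :: 'k set)"
    unfolding lesspoll_def using False eqpoll_imp_lepoll[OF eqpoll_sym] by blast
  from homogeneous_small_power[OF small assms] obtain Y D where Y: "Y \<subseteq> X" "Y \<in> pos n"
    and ag: "\<forall>a\<in>Y. \<forall>b\<in>Y. a \<simeq> b \<longrightarrow> agree (f a) (f b)" by (elim exE conjE)
  show ?thesis
    by (intro exI[of _ Y] conjI ballI impI) (fact Y | rule ag[rule_format], assumption+)+
qed

end

section \<open>Finite support iterations of \<open>\<sigma>\<close>-centered posets\<close>

lemma coords_restr [simp]: "coords (restr p \<beta>) = coords p |` {..<\<beta>}"
  by (simp add: restr_def)

lemma restr_restr: "\<beta>' \<le> \<beta> \<Longrightarrow> restr (restr p \<beta>) \<beta>' = restr p \<beta>'"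
  by (simp add: restr_def Int_absorb1 lessThan_subset_iff inf_absorb2)

lemma coords_restr_Some: "coords (restr p \<beta>) \<beta>' = Some \<sigma> \<longleftrightarrow> \<beta>' < \<beta> \<and> coords p \<beta>' = Some \<sigma>"
  by (simp add: restrict_map_def)

definition adjoin :: "('k::wellorder, 'i) cond \<Rightarrow> 'k \<Rightarrow> ('k, 'i) iname \<Rightarrow> ('k, 'i) cond" where
  "adjoin p \<beta> \<sigma> = Cond ((coords p)(\<beta> \<mapsto> \<sigma>))"

lemma coords_adjoin [simp]: "coords (adjoin p \<beta> \<sigma>) = (coords p)(\<beta> \<mapsto> \<sigma>)"
  by (simp add: adjoin_def)

lemma restr_adjoin:
  "dom (coords p) \<subseteq> {..<\<beta>} \<Longrightarrow> restr (adjoin p \<beta> \<sigma>) \<beta> = p"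
  "\<beta>' < \<beta> \<Longrightarrow> restr (adjoin p \<beta> \<sigma>) \<beta>' = restr p \<beta>'"
proof -
  assume p: "dom (coords p) \<subseteq> {..<\<beta>}"
  have "((coords p)(\<beta> \<mapsto> \<sigma>) |` {..<\<beta>}) x = coords p x" for x
  proof (cases "x < \<beta>")
    case False
    then have "x \<notin> dom (coords p)" using p by blast
    then show ?thesis using False by (simp add: restrict_map_def domIff)
  qed (auto simp: restrict_map_def)
  then have "(coords p)(\<beta> \<mapsto> \<sigma>) |` {..<\<beta>} = coords p" by (rule ext)
  then show "restr (adjoin p \<beta> \<sigma>) \<beta> = p" by (simp add: restr_def)
next
  assume "\<beta>' < \<beta>"
  then have "\<beta> \<notin> {..<\<beta>'}" by auto
  then show "restr (adjoin p \<beta> \<sigma>) \<beta>' = restr p \<beta>'"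
    by (simp add: restr_def)
qed

abbreviation empty_cond :: "('k, 'i) cond" where "empty_cond \<equiv> Cond Map.empty"

section \<open>Stages as forcing notions\<close>

locale iteration =
  fixes P :: "'k::wellorder \<Rightarrow> ('k, 'i) cond poset" and Q L :: "'k \<Rightarrow> ('k, 'i) iname"
  assumes P_eq: "P \<alpha> = stage P Q L {..<\<alpha>}"
    and is_name_Q: "is_name (conds (P \<beta>)) (Q \<beta>)"
    and preorder: "forced (P \<beta>) (preorder_fm (Q \<beta>) (L \<beta>))"
    and infinite_k: "infinite (UNIV :: 'k set)"
begin

abbreviation stg :: "'k set \<Rightarrow> ('k, 'i) cond poset" where "stg \<equiv> stage P Q L"

lemma conds_stage:
  "p \<in> conds (stg A) \<longleftrightarrow> finite (dom (coords p)) \<and> dom (coords p) \<subseteq> A \<and>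
     (\<forall>\<beta> \<sigma>. coords p \<beta> = Some \<sigma> \<longrightarrow> \<sigma> \<in> snd ` pairs (Q \<beta>) \<and> forces (P \<beta>) (restr p \<beta>) (\<sigma> \<^bold>\<in> Q \<beta>))"
  by (simp add: stage_def stage_conds_def)

lemma leq_stage:
  "(p, q) \<in> leq (stg A) \<longleftrightarrow> p \<in> conds (stg A) \<and> q \<in> conds (stg A) \<and> dom (coords q) \<subseteq> dom (coords p) \<and>
     (\<forall>\<beta> \<sigma> \<tau>. coords p \<beta> = Some \<sigma> \<and> coords q \<beta> = Some \<tau> \<longrightarrow>
        forces (P \<beta>) (restr p \<beta>) (related_fm (L \<beta>) \<sigma> \<tau>))"
  by (simp add: stage_def)

lemma conds_P: "p \<in> conds (P \<beta>) \<longleftrightarrow> p \<in> conds (stg {..<\<beta>})"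
  using P_eq[of \<beta>] by simp

lemma leq_P: "(p, q) \<in> leq (P \<beta>) \<longleftrightarrow> (p, q) \<in> leq (stg {..<\<beta>})"
  using P_eq[of \<beta>] by simp

lemma restr_conds:
  assumes "p \<in> conds (stg A)"
  shows "restr p \<beta> \<in> conds (P \<beta>)"
  unfolding conds_P conds_stage coords_restr_Some
proof (intro conjI allI impI)
  show "finite (dom (coords (restr p \<beta>)))" "dom (coords (restr p \<beta>)) \<subseteq> {..<\<beta>}"
    using assms unfolding conds_stage by simp_all
next
  fix \<beta>' \<sigma> assume *: "\<beta>' < \<beta> \<and> coords p \<beta>' = Some \<sigma>"
  then have "\<sigma> \<in> snd ` pairs (Q \<beta>') \<and> forces (P \<beta>') (restr p \<beta>') (\<sigma> \<^bold>\<in> Q \<beta>')"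
    using assms unfolding conds_stage by blast
  moreover have "restr (restr p \<beta>) \<beta>' = restr p \<beta>'" using * restr_restr[OF order_less_imp_le, of \<beta>' \<beta> p] by blast
  ultimately show "\<sigma> \<in> snd ` pairs (Q \<beta>')" "forces (P \<beta>') (restr (restr p \<beta>) \<beta>') (\<sigma> \<^bold>\<in> Q \<beta>')"
    by simp_all
qed

lemma restr_leq:
  assumes "(p, q) \<in> leq (stg A)"
  shows "(restr p \<beta>, restr q \<beta>) \<in> leq (P \<beta>)"
  unfolding leq_P leq_stage coords_restr_Some conds_P[symmetric]
proof (intro conjI allI impI)
  show "restr p \<beta> \<in> conds (P \<beta>)" "restr q \<beta> \<in> conds (P \<beta>)"
    using assms restr_conds unfolding leq_stage by blast+
  show "dom (coords (restr q \<beta>)) \<subseteq> dom (coords (restr p \<beta>))"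
    using assms unfolding leq_stage coords_restr dom_restrict by blast
next
  fix \<beta>' \<sigma> \<tau> assume *: "(\<beta>' < \<beta> \<and> coords p \<beta>' = Some \<sigma>) \<and> \<beta>' < \<beta> \<and> coords q \<beta>' = Some \<tau>"
  then have "forces (P \<beta>') (restr p \<beta>') (related_fm (L \<beta>') \<sigma> \<tau>)"
    using assms unfolding leq_stage by blast
  moreover have "restr (restr p \<beta>) \<beta>' = restr p \<beta>'" using * restr_restr[OF order_less_imp_le, of \<beta>' \<beta> p] by blast
  ultimately show "forces (P \<beta>') (restr (restr p \<beta>) \<beta>') (related_fm (L \<beta>') \<sigma> \<tau>)" by simp
qed

abbreviation forcing :: "('k, 'i) cond poset \<Rightarrow> bool" where
  "forcing R \<equiv> forcing_notion TYPE('k + 'i) R empty_cond"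

text \<open>Reflexivity and transitivity at a coordinate are obtained from forced preorder axioms,
  which needs the forcing calculus of the earlier stage; \<open>forcing_P\<close> provides it by
  induction along the iteration.\<close>

lemma forcing_stage:
  assumes "\<And>\<beta>. \<beta> \<in> A \<Longrightarrow> forcing (P \<beta>)"
  shows "forcing (stg A)"
proof
  show "(p, p) \<in> leq (stg A)" if p: "p \<in> conds (stg A)" for p
    unfolding leq_stage
  proof (intro conjI p subset_refl allI impI)
    fix \<beta> \<sigma> \<tau> assume "coords p \<beta> = Some \<sigma> \<and> coords p \<beta> = Some \<tau>"
    then have s: "coords p \<beta> = Some \<sigma>" "\<tau> = \<sigma>" by auto
    then have "\<beta> \<in> A" and sQ: "\<sigma> \<in> snd ` pairs (Q \<beta>)" "forces (P \<beta>) (restr p \<beta>) (\<sigma> \<^bold>\<in> Q \<beta>)"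
      using p unfolding conds_stage by auto
    interpret N: forcing_notion "P \<beta>" empty_cond "TYPE('k + 'i)" using assms[OF \<open>\<beta> \<in> A\<close>] .
    have nm: "is_name (conds (P \<beta>)) \<sigma>" using sQ(1) N.nm_snd[OF is_name_Q[of \<beta>]] by auto
    have "forces (P \<beta>) (restr p \<beta>) (\<^bold>\<forall>x. x \<^bold>\<in> Q \<beta> \<^bold>\<longrightarrow> related_fm (L \<beta>) x x)"
      using preorder[of \<beta>] restr_conds[OF p] unfolding forced_def preorder_fm_def forces.simps(4) by blast
    from N.forces_mp[OF N.forces_allD[OF this nm] sQ(2) restr_conds[OF p]]
    show "forces (P \<beta>) (restr p \<beta>) (related_fm (L \<beta>) \<sigma> \<tau>)" unfolding s(2) .
  qed
next
  show "(p, r) \<in> leq (stg A)" if pq: "(p, q) \<in> leq (stg A)" and qr: "(q, r) \<in> leq (stg A)" for p q r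
    unfolding leq_stage
  proof (intro conjI allI impI)
    fix \<beta> \<sigma> \<rho> assume sr: "coords p \<beta> = Some \<sigma> \<and> coords r \<beta> = Some \<rho>"
    have cp: "p \<in> conds (stg A)" "q \<in> conds (stg A)" "r \<in> conds (stg A)"
      using pq qr unfolding leq_stage by blast+
    have "dom (coords r) \<subseteq> dom (coords q)" using qr unfolding leq_stage by blast
    then obtain \<tau> where t: "coords q \<beta> = Some \<tau>" using sr by blast
    have "\<beta> \<in> A" using cp(1) sr unfolding conds_stage by auto
    interpret N: forcing_notion "P \<beta>" empty_cond "TYPE('k + 'i)" using assms[OF \<open>\<beta> \<in> A\<close>] .
    note le = restr_leq[OF pq, of \<beta>] restr_leq[OF qr, of \<beta>]
    have mem: "forces (P \<beta>) (restr p \<beta>) (\<sigma> \<^bold>\<in> Q \<beta>)" "forces (P \<beta>) (restr p \<beta>) (\<tau> \<^bold>\<in> Q \<beta>)"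
       "forces (P \<beta>) (restr p \<beta>) (\<rho> \<^bold>\<in> Q \<beta>)"
      using cp sr t N.forces_mono[OF _ le(1)] N.forces_mono[OF _ N.leq_trans[OF le]] unfolding conds_stage by blast+
    have nm: "is_name (conds (P \<beta>)) \<sigma>" "is_name (conds (P \<beta>)) \<tau>" "is_name (conds (P \<beta>)) \<rho>"
    proof -
      have "\<sigma> \<in> snd ` pairs (Q \<beta>)" "\<tau> \<in> snd ` pairs (Q \<beta>)" "\<rho> \<in> snd ` pairs (Q \<beta>)"
        using cp sr t unfolding conds_stage by blast+
      then show "is_name (conds (P \<beta>)) \<sigma>" "is_name (conds (P \<beta>)) \<tau>" "is_name (conds (P \<beta>)) \<rho>"
        using N.nm_snd[OF is_name_Q[of \<beta>]] by auto
    qed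
    have rel: "forces (P \<beta>) (restr p \<beta>) (related_fm (L \<beta>) \<sigma> \<tau>)"
      "forces (P \<beta>) (restr p \<beta>) (related_fm (L \<beta>) \<tau> \<rho>)"
      using pq qr sr t N.forces_mono[OF _ le(1)] unfolding leq_stage by blast+
    have "forces (P \<beta>) (restr p \<beta>) (\<^bold>\<forall>x y z. x \<^bold>\<in> Q \<beta> \<^bold>\<and> y \<^bold>\<in> Q \<beta> \<^bold>\<and> z \<^bold>\<in> Q \<beta> \<^bold>\<and>
        related_fm (L \<beta>) x y \<^bold>\<and> related_fm (L \<beta>) y z \<^bold>\<longrightarrow> related_fm (L \<beta>) x z)"
      using preorder[of \<beta>] restr_conds[OF cp(1)] unfolding forced_def preorder_fm_def forces.simps(4) by blast
    then have "forces (P \<beta>) (restr p \<beta>) (\<sigma> \<^bold>\<in> Q \<beta> \<^bold>\<and> \<tau> \<^bold>\<in> Q \<beta> \<^bold>\<and> \<rho> \<^bold>\<in> Q \<beta> \<^bold>\<and>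
        related_fm (L \<beta>) \<sigma> \<tau> \<^bold>\<and> related_fm (L \<beta>) \<tau> \<rho> \<^bold>\<longrightarrow> related_fm (L \<beta>) \<sigma> \<rho>)"
      unfolding forces.simps(5) using nm by blast
    then show "forces (P \<beta>) (restr p \<beta>) (related_fm (L \<beta>) \<sigma> \<rho>)"
      by (rule N.forces_mp) (use mem rel restr_conds[OF cp(1)] in simp_all)
  qed (use pq qr leq_stage in blast)+
next
  show "infinite (UNIV :: ('k + 'i) set)"
    using infinite_k by (metis finite_Plus_UNIV_iff)
qed (auto simp: leq_stage conds_stage)

lemma forcing_P: "forcing (P \<beta>)"
proof (induction \<beta> rule: less_induct)
  case (less \<beta>)
  then show ?case using forcing_stage[of "{..<\<beta>}"] unfolding P_eq[of \<beta>, symmetric] by simp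
qed

lemma adjoin_conds:
  assumes "r \<in> conds (P \<beta>)" "{..\<beta>} \<subseteq> A" "\<sigma> \<in> snd ` pairs (Q \<beta>)" "forces (P \<beta>) r (\<sigma> \<^bold>\<in> Q \<beta>)"
  shows "adjoin r \<beta> \<sigma> \<in> conds (stg A)"
proof -
  have r: "finite (dom (coords r))" "dom (coords r) \<subseteq> {..<\<beta>}"
    "\<And>\<beta>' \<sigma>. coords r \<beta>' = Some \<sigma> \<Longrightarrow> \<sigma> \<in> snd ` pairs (Q \<beta>') \<and> forces (P \<beta>') (restr r \<beta>') (\<sigma> \<^bold>\<in> Q \<beta>')"
    using assms(1) unfolding conds_P conds_stage by blast+
  show ?thesis
    unfolding conds_stage
  proof (intro conjI allI impI)
    show "finite (dom (coords (adjoin r \<beta> \<sigma>)))" using r(1) by simp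
    have "\<beta> \<in> {..\<beta>}" "{..<\<beta>} \<subseteq> {..\<beta>}" by (simp_all add: subset_iff less_imp_le)
    then have "insert \<beta> (dom (coords r)) \<subseteq> A" using r(2) assms(2) by blast
    then show "dom (coords (adjoin r \<beta> \<sigma>)) \<subseteq> A" by simp
  next
    fix \<beta>' \<sigma>' assume *: "coords (adjoin r \<beta> \<sigma>) \<beta>' = Some \<sigma>'"
    have "\<sigma>' \<in> snd ` pairs (Q \<beta>') \<and> forces (P \<beta>') (restr (adjoin r \<beta> \<sigma>) \<beta>') (\<sigma>' \<^bold>\<in> Q \<beta>')"
    proof (cases "\<beta>' = \<beta>")
      case True
      then show ?thesis using * assms(3,4) by (simp add: restr_adjoin(1)[OF r(2)])
    next
      case False
      then have c: "coords r \<beta>' = Some \<sigma>'" using * by simp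
      then have "\<beta>' < \<beta>" using r(2) by auto
      then show ?thesis using r(3)[OF c] by (simp add: restr_adjoin(2))
    qed
    then show "\<sigma>' \<in> snd ` pairs (Q \<beta>')" "forces (P \<beta>') (restr (adjoin r \<beta> \<sigma>) \<beta>') (\<sigma>' \<^bold>\<in> Q \<beta>')" by auto
  qed
qed

text \<open>The last hypothesis is conditional because \<open>p\<close> may have no entry at
  \<beta>; a missing coordinate is trivial, and any new entry strengthens it.\<close>

lemma adjoin_leq:
  assumes "(r, restr p \<beta>) \<in> leq (P \<beta>)" "{..\<beta>} \<subseteq> A" "\<sigma> \<in> snd ` pairs (Q \<beta>)" "forces (P \<beta>) r (\<sigma> \<^bold>\<in> Q \<beta>)"
    and "p \<in> conds (stg A)" "dom (coords p) \<subseteq> {..\<beta>}"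
    and "\<And>\<tau>. coords p \<beta> = Some \<tau> \<Longrightarrow> forces (P \<beta>) r (related_fm (L \<beta>) \<sigma> \<tau>)"
  shows "(adjoin r \<beta> \<sigma>, p) \<in> leq (stg A)"
proof -
  note le = assms(1)[unfolded leq_P leq_stage conds_P[symmetric]]
  have r: "r \<in> conds (P \<beta>)" using le by (elim conjE)
  have rd: "dom (coords p |` {..<\<beta>}) \<subseteq> dom (coords r)" using le unfolding coords_restr by (elim conjE)
  have rl: "forces (P \<beta>') (restr r \<beta>') (related_fm (L \<beta>') \<rho> \<tau>)"
    if "coords r \<beta>' = Some \<rho>" "(coords p |` {..<\<beta>}) \<beta>' = Some \<tau>" for \<beta>' \<rho> \<tau>
    using le that unfolding coords_restr by blast
  have rdom: "dom (coords r) \<subseteq> {..<\<beta>}" using r unfolding conds_P conds_stage by blast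
  show ?thesis
    unfolding leq_stage
  proof (intro conjI allI impI adjoin_conds r assms)
    show "dom (coords p) \<subseteq> dom (coords (adjoin r \<beta> \<sigma>))"
    proof
      fix \<beta>' assume b: "\<beta>' \<in> dom (coords p)"
      show "\<beta>' \<in> dom (coords (adjoin r \<beta> \<sigma>))"
      proof (cases "\<beta>' = \<beta>")
        case False
        then have "\<beta>' < \<beta>" using b assms(6) by force
        then show ?thesis using b rd by auto
      qed simp
    qed
  next
    fix \<beta>' \<rho> \<tau> assume *: "coords (adjoin r \<beta> \<sigma>) \<beta>' = Some \<rho> \<and> coords p \<beta>' = Some \<tau>"
    show "forces (P \<beta>') (restr (adjoin r \<beta> \<sigma>) \<beta>') (related_fm (L \<beta>') \<rho> \<tau>)"
    proof (cases "\<beta>' = \<beta>")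
      case True
      then show ?thesis using * assms(7) by (simp add: restr_adjoin(1)[OF rdom])
    next
      case False
      then have c: "coords r \<beta>' = Some \<rho>" using * by simp
      then have b: "\<beta>' < \<beta>" using rdom by auto
      then show ?thesis using rl[OF c, of \<tau>] * b by (simp add: restr_adjoin(2)[OF b] restrict_map_def)
    qed
  qed
qed

end

section \<open>Deciding labels, and common lower bounds\<close>

locale labelled_iteration = iteration P Q L
  for P :: "'k::wellorder \<Rightarrow> ('k, 'i) cond poset" and Q L :: "'k \<Rightarrow> ('k, 'i) iname" +
  fixes lab :: "'k \<Rightarrow> ('k, 'i) cond \<Rightarrow> ('k, 'i) iname \<Rightarrow> nat \<Rightarrow> bool"
  assumes lab: "labelling (P \<beta>) (Q \<beta>) (L \<beta>) (lab \<beta>)"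
begin

lemma lab_mono: "lab \<beta> p \<sigma> n \<Longrightarrow> (q, p) \<in> leq (P \<beta>) \<Longrightarrow> lab \<beta> q \<sigma> n"
  using lab[of \<beta>] unfolding labelling_def by blast

lemma lab_dense:
  assumes "p \<in> conds (P \<beta>)" "is_name (conds (P \<beta>)) \<sigma>" "forces (P \<beta>) p (\<sigma> \<^bold>\<in> Q \<beta>)"
  obtains q n where "(q, p) \<in> leq (P \<beta>)" "lab \<beta> q \<sigma> n"
  using lab[of \<beta>, unfolded labelling_def, THEN conjunct2, THEN conjunct1, rule_format, OF assms]
  by (elim exE conjE)

lemma lab_centered:
  assumes "0 < (k::nat)" "\<And>i. i < k \<Longrightarrow> is_name (conds (P \<beta>)) (\<sigma> i)" "\<And>i. i < k \<Longrightarrow> lab \<beta> p (\<sigma> i) n"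
  obtains q \<tau> where "(q, p) \<in> leq (P \<beta>)" "\<tau> \<in> snd ` pairs (Q \<beta>)" "forces (P \<beta>) q (\<tau> \<^bold>\<in> Q \<beta>)"
    "\<And>i. i < k \<Longrightarrow> forces (P \<beta>) q (related_fm (L \<beta>) \<tau> (\<sigma> i))"
proof -
  have "\<forall>p k \<sigma> n. 0 < (k::nat) \<longrightarrow> (\<forall>i<k. is_name (conds (P \<beta>)) (\<sigma> i) \<and> lab \<beta> p (\<sigma> i) n) \<longrightarrow>
        (\<exists>q \<tau>. (q, p) \<in> leq (P \<beta>) \<and> \<tau> \<in> snd ` pairs (Q \<beta>) \<and> forces (P \<beta>) q (\<tau> \<^bold>\<in> Q \<beta>) \<and>
           (\<forall>i<k. forces (P \<beta>) q (related_fm (L \<beta>) \<tau> (\<sigma> i))))"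
    using lab[of \<beta>] unfolding labelling_def by (elim conjE)
  from this[THEN spec[of _ p], THEN spec[of _ k], THEN spec[of _ \<sigma>], THEN spec[of _ n], THEN mp[OF _ assms(1)]]
  obtain q \<tau> where "(q, p) \<in> leq (P \<beta>)" "\<tau> \<in> snd ` pairs (Q \<beta>)" "forces (P \<beta>) q (\<tau> \<^bold>\<in> Q \<beta>)"
    "\<forall>i<k. forces (P \<beta>) q (related_fm (L \<beta>) \<tau> (\<sigma> i))"
    using assms(2,3) by blast
  then show thesis using that by blast
qed

definition determined :: "('k, 'i) cond \<Rightarrow> bool" where
  "determined p \<longleftrightarrow> (\<forall>\<beta> \<sigma>. coords p \<beta> = Some \<sigma> \<longrightarrow> (\<exists>n. lab \<beta> (restr p \<beta>) \<sigma> n))"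

text \<open>An extension that decides the label of the top entry may enlarge the support below it.
  So the top is decided before the rest, and the induction runs over stages instead of the size of
  the support.\<close>

lemma determined_step:
  assumes IH: "\<And>\<beta> p. \<beta> \<in> A \<Longrightarrow> p \<in> conds (P \<beta>) \<Longrightarrow> \<exists>q. (q, p) \<in> leq (P \<beta>) \<and> determined q"
    and A: "\<And>\<beta>. \<beta> \<in> A \<Longrightarrow> {..\<beta>} \<subseteq> A" and p: "p \<in> conds (stg A)"
  shows "\<exists>q. (q, p) \<in> leq (stg A) \<and> determined q"
proof (cases "dom (coords p) = {}")
  case True
  interpret S: forcing_notion "stg A" empty_cond "TYPE('k + 'i)" using forcing_stage[OF forcing_P] .
  have "determined p" unfolding determined_def using True by auto
  then show ?thesis using S.leq_refl[OF p] by blast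
next
  case False
  have fin: "finite (dom (coords p))" "dom (coords p) \<subseteq> A" using p unfolding conds_stage by blast+
  define \<beta> where "\<beta> = Max (dom (coords p))"
  have b: "\<beta> \<in> dom (coords p)" "\<beta> \<in> A" using Max_in[OF fin(1) False] fin(2) unfolding \<beta>_def by blast+
  have le: "dom (coords p) \<subseteq> {..\<beta>}" using Max_ge[OF fin(1)] unfolding \<beta>_def by blast
  obtain \<sigma> where s: "coords p \<beta> = Some \<sigma>" using b(1) by blast
  have sQ: "\<sigma> \<in> snd ` pairs (Q \<beta>)" "forces (P \<beta>) (restr p \<beta>) (\<sigma> \<^bold>\<in> Q \<beta>)"
    using p s unfolding conds_stage by blast+
  interpret N: forcing_notion "P \<beta>" empty_cond "TYPE('k + 'i)" using forcing_P .
  interpret S: forcing_notion "stg A" empty_cond "TYPE('k + 'i)" using forcing_stage[OF forcing_P] .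
  have nm: "is_name (conds (P \<beta>)) \<sigma>" using sQ(1) N.nm_snd[OF is_name_Q[of \<beta>]] by auto
  obtain q n where q: "(q, restr p \<beta>) \<in> leq (P \<beta>)" "lab \<beta> q \<sigma> n"
    using lab_dense[OF restr_conds[OF p] nm sQ(2)] .
  obtain r where r: "(r, q) \<in> leq (P \<beta>)" "determined r" using IH[OF b(2)] N.leq_conds[OF q(1)] by blast
  have rp: "(r, restr p \<beta>) \<in> leq (P \<beta>)" using N.leq_trans[OF r(1) q(1)] .
  have rc: "r \<in> conds (P \<beta>)" using N.leq_conds[OF r(1)] by blast
  have rdom: "dom (coords r) \<subseteq> {..<\<beta>}" using rc unfolding conds_P conds_stage by blast
  \<comment> \<open>The top entry is kept, so the order at \<beta> compares \<sigma> with
    itself.\<close>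
  have "forces (P \<beta>) (restr p \<beta>) (related_fm (L \<beta>) \<sigma> \<sigma>)"
    using S.leq_refl[OF p] s unfolding leq_stage by blast
  then have "forces (P \<beta>) r (related_fm (L \<beta>) \<sigma> \<sigma>)" using N.forces_mono rp by blast
  then have "(adjoin r \<beta> \<sigma>, p) \<in> leq (stg A)"
    using adjoin_leq[OF rp A[OF b(2)] sQ(1) N.forces_mono[OF sQ(2) rp] p le] s by simp
  moreover have "determined (adjoin r \<beta> \<sigma>)"
    unfolding determined_def
  proof (intro allI impI)
    fix \<beta>' \<sigma>' assume *: "coords (adjoin r \<beta> \<sigma>) \<beta>' = Some \<sigma>'"
    show "\<exists>n. lab \<beta>' (restr (adjoin r \<beta> \<sigma>) \<beta>') \<sigma>' n"
    proof (cases "\<beta>' = \<beta>")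
      case True
      then show ?thesis using * lab_mono[OF q(2) r(1)] by (auto simp: restr_adjoin(1)[OF rdom])
    next
      case False
      then have c: "coords r \<beta>' = Some \<sigma>'" using * by simp
      then have b: "\<beta>' < \<beta>" using rdom by auto
      then show ?thesis using r(2) c unfolding restr_adjoin(2)[OF b] determined_def by blast
    qed
  qed
  ultimately show ?thesis by blast
qed

lemma determined_dense:
  assumes "\<And>\<beta>. \<beta> \<in> A \<Longrightarrow> {..\<beta>} \<subseteq> A" "p \<in> conds (stg A)"
  shows "\<exists>q. (q, p) \<in> leq (stg A) \<and> determined q"
proof -
  have "\<exists>q. (q, p) \<in> leq (P \<beta>) \<and> determined q" if "p \<in> conds (P \<beta>)" for \<beta> p
    using that
  proof (induction \<beta> arbitrary: p rule: less_induct)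
    case (less \<beta>)
    show ?case
      unfolding leq_P
      by (rule determined_step[of "{..<\<beta>}"]) (use less conds_P in auto)
  qed
  then show ?thesis using determined_step[OF _ assms] by blast
qed

text \<open>Induction on the size of the union of the supports. Below a common lower bound of the
  restrictions, all entries at the top coordinate carry one and the same label, by comparison with a
  single one of them; so pairwise agreement is enough for any finite number of conditions.\<close>

lemma amalgamation:
  fixes q :: "nat \<Rightarrow> ('k, 'i) cond" and f :: "nat \<Rightarrow> 'k \<rightharpoonup> nat"
  assumes "\<And>\<beta>. \<beta> \<in> A \<Longrightarrow> {..\<beta>} \<subseteq> A" "\<And>i. i < k \<Longrightarrow> q i \<in> conds (stg A)"
    and "\<And>i \<beta> \<sigma>. i < k \<Longrightarrow> coords (q i) \<beta> = Some \<sigma> \<Longrightarrow> \<exists>n. f i \<beta> = Some n \<and> lab \<beta> (restr (q i) \<beta>) \<sigma> n"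
    and agree: "\<And>i j. i < k \<Longrightarrow> j < k \<Longrightarrow> agree (f i) (f j)"
  shows "\<exists>r\<in>conds (stg A). \<forall>i<k. (r, q i) \<in> leq (stg A)"
  using assms(1-3)
proof (induction "card (\<Union>i<k. dom (coords (q i)))" arbitrary: A q rule: less_induct)
  case less
  let ?D = "\<Union>i<k. dom (coords (q i))"
  have fin: "finite ?D" using less.prems(2) unfolding conds_stage by blast
  show ?case
  proof (cases "?D = {}")
    case True
    have e: "empty_cond \<in> conds (stg A)" by (simp add: conds_stage)
    have "(empty_cond, q i) \<in> leq (stg A)" if "i < k" for i
      using True that less.prems(2)[OF that] e unfolding leq_stage by auto
    then show ?thesis using e by blast
  next
    case False
    define \<beta> where "\<beta> = Max ?D"
    have bD: "\<beta> \<in> ?D" using Max_in[OF fin False] unfolding \<beta>_def .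
    then obtain i0 where i0: "i0 < k" "\<beta> \<in> dom (coords (q i0))" by blast
    have bA: "\<beta> \<in> A" using i0 less.prems(2) unfolding conds_stage by blast
    have le: "dom (coords (q i)) \<subseteq> {..\<beta>}" if "i < k" for i
      using Max_ge[OF fin] that unfolding \<beta>_def by blast
    interpret N: forcing_notion "P \<beta>" empty_cond "TYPE('k + 'i)" using forcing_P .
    have "\<exists>r\<in>conds (stg {..<\<beta>}). \<forall>i<k. (r, restr (q i) \<beta>) \<in> leq (stg {..<\<beta>})"
    proof (rule less.hyps)
      have "(\<Union>i<k. dom (coords (restr (q i) \<beta>))) \<subseteq> ?D - {\<beta>}" by auto
      then have "card (\<Union>i<k. dom (coords (restr (q i) \<beta>))) \<le> card (?D - {\<beta>})"
        using fin by (intro card_mono) auto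
      also have "\<dots> < card ?D" using fin bD by (rule card_Diff1_less)
      finally show "card (\<Union>i<k. dom (coords (restr (q i) \<beta>))) < card ?D" .
    next
      show "{..\<alpha>} \<subseteq> {..<\<beta>}" if "\<alpha> \<in> {..<\<beta>}" for \<alpha> using that by auto
    next
      show "restr (q i) \<beta> \<in> conds (stg {..<\<beta>})" if "i < k" for i
        using restr_conds[OF less.prems(2)[OF that]] unfolding conds_P .
    next
      fix i \<beta>' \<sigma> assume i: "i < k" and "coords (restr (q i) \<beta>) \<beta>' = Some \<sigma>"
      then have "coords (q i) \<beta>' = Some \<sigma>" "\<beta>' < \<beta>" by (auto simp: restrict_map_def split: if_splits)
      then show "\<exists>n. f i \<beta>' = Some n \<and> lab \<beta>' (restr (restr (q i) \<beta>) \<beta>') \<sigma> n"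
        using less.prems(3)[OF i] restr_restr[OF order_less_imp_le, of \<beta>' \<beta> "q i"] by metis
    qed
    then obtain r where r: "r \<in> conds (P \<beta>)" "\<And>i. i < k \<Longrightarrow> (r, restr (q i) \<beta>) \<in> leq (P \<beta>)"
      unfolding P_eq[of \<beta>, symmetric] by blast
    obtain \<sigma>0 where s0: "coords (q i0) \<beta> = Some \<sigma>0" using i0(2) by blast
    obtain n where n: "f i0 \<beta> = Some n" "lab \<beta> (restr (q i0) \<beta>) \<sigma>0 n"
      using less.prems(3)[OF i0(1) s0] by blast
    \<comment> \<open>Conditions without an entry at \<beta> receive the entry
      \<open>\<sigma>0\<close> of \<open>q i0\<close> as a default. The family is then total and
      still uniformly labelled \<open>n\<close>, and the default imposes nothing new.\<close>
    define \<sigma> where "\<sigma> i = (case coords (q i) \<beta> of None \<Rightarrow> \<sigma>0 | Some \<sigma> \<Rightarrow> \<sigma>)" for i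
    have mem: "\<sigma> i \<in> snd ` pairs (Q \<beta>)" "lab \<beta> r (\<sigma> i) n" if i: "i < k" for i
    proof -
      have "\<sigma> i \<in> snd ` pairs (Q \<beta>) \<and> lab \<beta> r (\<sigma> i) n"
      proof (cases "coords (q i) \<beta>")
        case None
        have "\<sigma>0 \<in> snd ` pairs (Q \<beta>)" using less.prems(2)[OF i0(1)] s0 unfolding conds_stage by blast
        then show ?thesis using None lab_mono[OF n(2) r(2)[OF i0(1)]] unfolding \<sigma>_def by simp
      next
        case (Some \<tau>)
        obtain n' where n': "f i \<beta> = Some n'" "lab \<beta> (restr (q i) \<beta>) \<tau> n'"
          using less.prems(3)[OF i Some] by blast
        have "n' = n" using agree[OF i i0(1)] n(1) n'(1) unfolding agree_def by blast
        moreover have "\<tau> \<in> snd ` pairs (Q \<beta>)" using less.prems(2)[OF i] Some unfolding conds_stage by blast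
        ultimately show ?thesis using Some lab_mono[OF n'(2) r(2)[OF i]] unfolding \<sigma>_def by simp
      qed
      then show "\<sigma> i \<in> snd ` pairs (Q \<beta>)" "lab \<beta> r (\<sigma> i) n" by auto
    qed
    have nm: "is_name (conds (P \<beta>)) (\<sigma> i)" if "i < k" for i
      using mem(1)[OF that] N.nm_snd[OF is_name_Q[of \<beta>]] by auto
    have "0 < k" using i0(1) by simp
    then obtain s \<tau> where s: "(s, r) \<in> leq (P \<beta>)" "\<tau> \<in> snd ` pairs (Q \<beta>)" "forces (P \<beta>) s (\<tau> \<^bold>\<in> Q \<beta>)"
      "\<And>i. i < k \<Longrightarrow> forces (P \<beta>) s (related_fm (L \<beta>) \<tau> (\<sigma> i))"
      by (rule lab_centered[of k \<beta> \<sigma> r n]) (use nm mem(2) in blast)+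
    have "(adjoin s \<beta> \<tau>, q i) \<in> leq (stg A)" if i: "i < k" for i
    proof (rule adjoin_leq[OF N.leq_trans[OF s(1) r(2)[OF i]] less.prems(1)[OF bA] s(2,3) less.prems(2)[OF i] le[OF i]])
      show "forces (P \<beta>) s (related_fm (L \<beta>) \<tau> \<tau>')" if "coords (q i) \<beta> = Some \<tau>'" for \<tau>'
        using s(4)[OF i] that unfolding \<sigma>_def by simp
    qed
    moreover from this[OF i0(1)] have "adjoin s \<beta> \<tau> \<in> conds (stg A)" unfolding leq_stage by blast
    ultimately show ?thesis by blast
  qed
qed

end

section \<open>Linkedness of the full iteration\<close>

theorem theorem4p2:
  fixes J :: "'k::wellorder set set" and \<gamma> :: 'k and m n :: nat
    and P :: "'k \<Rightarrow> ('k, 'i) cond poset" and P\<kappa> :: "('k, 'i) cond poset"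
    and Q L :: "'k \<Rightarrow> ('k, 'i) iname"
  assumes "is_cardinal TYPE('k)"
    and "uniform_ideal J" and "normal_ideal J" and "saturated_ideal \<gamma> J"
    and "fs_iteration P P\<kappa> Q L"
    and "\<And>\<beta>. forced (P \<beta>) (sigma_centered_fm (Q \<beta>) (L \<beta>))"
  shows "linked J n m P\<kappa>"
proof -
  interpret S: saturated_normal_ideal J \<gamma>
    by unfold_locales (fact assms)+
  interpret I: iteration P Q L
    using assms(5) S.infinite_UNIV unfolding Defs.fs_iteration_def by unfold_locales blast+
  have P\<kappa>: "P\<kappa> = stage P Q L UNIV" using assms(5) unfolding Defs.fs_iteration_def by blast
  have "\<exists>lab. labelling (P \<beta>) (Q \<beta>) (L \<beta>) lab" for \<beta>
    using forcing_notion.ex_labelling[OF I.forcing_P assms(6)] .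
  then have "\<forall>\<beta>. \<exists>lab. labelling (P \<beta>) (Q \<beta>) (L \<beta>) lab" by blast
  from choice[OF this] obtain lab where "\<forall>\<beta>. labelling (P \<beta>) (Q \<beta>) (L \<beta>) (lab \<beta>)" by blast
  then interpret I: labelled_iteration P Q L lab by unfold_locales blast
  interpret F: forcing_notion P\<kappa> empty_cond "TYPE('k + 'i)"
    unfolding P\<kappa> using I.forcing_stage[OF I.forcing_P] .
  show ?thesis
    unfolding linked_def
  proof (intro ballI allI impI)
    fix X p assume X: "X \<in> fubini_positive J n" and p: "\<forall>a\<in>X. p a \<in> conds P\<kappa>"
    have "\<forall>a\<in>X. \<exists>q. (q, p a) \<in> leq P\<kappa> \<and> I.determined q"
      using I.determined_dense[of UNIV] p unfolding P\<kappa> by blast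
    from bchoice[OF this] obtain q where q: "\<And>a. a \<in> X \<Longrightarrow> (q a, p a) \<in> leq P\<kappa>" "\<And>a. a \<in> X \<Longrightarrow> I.determined (q a)"
      by blast
    \<comment> \<open>Pieces may overlap, so an entry can have several labels; one is chosen for
      each coordinate of the support.\<close>
    define f where "f a \<beta> = map_option (\<lambda>\<sigma>. SOME n. lab \<beta> (restr (q a) \<beta>) \<sigma> n) (coords (q a) \<beta>)" for a \<beta>
    have "\<forall>a\<in>X. finite (dom (f a))"
    proof
      fix a assume "a \<in> X"
      then have "q a \<in> conds P\<kappa>" using q(1) F.leq_conds by blast
      moreover have "dom (f a) = dom (coords (q a))" by (auto simp: f_def)
      ultimately show "finite (dom (f a))" unfolding P\<kappa> I.conds_stage by simp
    qed
    from S.homogeneous[OF X this] obtain Y where Y: "Y \<subseteq> X" "Y \<in> fubini_positive J n"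
      "\<forall>a\<in>Y. \<forall>b\<in>Y. a \<simeq> b \<longrightarrow> agree (f a) (f b)" by (elim exE conjE)
    have "\<exists>r\<in>conds P\<kappa>. \<forall>i<k. (r, p (a i)) \<in> leq P\<kappa>"
      if a: "(\<forall>i<k. a i \<in> Y) \<and> (\<forall>i<k. \<forall>j<k. a i \<simeq> a j)" for k and a :: "nat \<Rightarrow> 'k list"
    proof -
      have aX: "a i \<in> X" if "i < k" for i using a Y(1) that by blast
      have "\<exists>r\<in>conds (stage P Q L UNIV). \<forall>i<k. (r, q (a i)) \<in> leq (stage P Q L UNIV)"
      proof (rule I.amalgamation[where f = "\<lambda>i. f (a i)"])
        show "q (a i) \<in> conds (stage P Q L UNIV)" if "i < k" for i
          using F.leq_conds[OF q(1)[OF aX[OF that]]] unfolding P\<kappa> by blast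
        show "\<exists>n. f (a i) \<beta> = Some n \<and> lab \<beta> (restr (q (a i)) \<beta>) \<sigma> n"
          if i: "i < k" and s: "coords (q (a i)) \<beta> = Some \<sigma>" for i \<beta> \<sigma>
        proof -
          have "\<exists>n. lab \<beta> (restr (q (a i)) \<beta>) \<sigma> n" using q(2)[OF aX[OF i]] s unfolding I.determined_def by blast
          then show ?thesis using s by (simp add: f_def someI_ex)
        qed
        show "agree (f (a i)) (f (a j))" if "i < k" "j < k" for i j using Y(3) a that by blast
      qed simp
      then obtain r where r: "r \<in> conds P\<kappa>" "\<And>i. i < k \<Longrightarrow> (r, q (a i)) \<in> leq P\<kappa>"
        unfolding P\<kappa>[symmetric] by blast
      have "(r, p (a i)) \<in> leq P\<kappa>" if "i < k" for i
        using F.leq_trans[OF r(2)[OF that] q(1)[OF aX[OF that]]] .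
      then show ?thesis using r(1) by blast
    qed
    then show "\<exists>Y\<subseteq>X. Y \<in> fubini_positive J n \<and>
           (\<forall>k\<le>m. \<forall>a :: nat \<Rightarrow> 'k list.
              (\<forall>i<k. a i \<in> Y) \<and> (\<forall>i<k. \<forall>j<k. a i \<simeq> a j) \<longrightarrow>
              (\<exists>r \<in> conds P\<kappa>. \<forall>i<k. (r, p (a i)) \<in> leq P\<kappa>))"
      by (intro exI[of _ Y] conjI Y allI impI)
  qed
qed

end
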